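(* Let $p$ be a prime and let $0\ne\lambda\in\mathbb{F}_p$. For a set $Y$ of elements of an algebra, $\widehat Y=\{\hat y\mid y\in Y\}$ denotes a set of variables in bijection with $Y$. (1) For a semigroup $S$ in the class $\mathcal{P}$, there are isomorphisms of $\mathbb{F}_p$-algebras $$\mathrm{MS}_{\mathbb{F}_p,\lambda}(S)\cong\mathbb{F}_p[\widehat{\mathrm{TEL}}]/\langle\hat w^{\,p}-\hat w\mid\hat w\in\widehat{\mathrm{TEL}}_1\rangle\cong\Big(\mathbb{F}_p[\widehat{\mathrm{TEL}}_1]/\langle\hat w^{\,p}-\hat w\mid\hat w\in\widehat{\mathrm{TEL}}_1\rangle\Big)\otimes\mathbb{F}_p[\widehat{\mathrm{TEL}}_2].$$ In particular, for $S\in\mathcal{F}$, $\mathrm{MS}_{\mathbb{F}_p,\lambda}(S)\cong\mathbb{F}_p[\widehat{\mathrm{TEL}}]$. (2) For $S$ in the class $\mathcal{J}$, there is an isomorphism of $\mathbb{F}_p$-algebras $$\mathrm{MS}_{\mathbb{F}_p,\lambda}(S)\cong\Big(\mathbb{F}_p[\widehat{\mathrm{TL}}_1]/\langle\hat w^{\,p}-\hat w\mid\hat w\in\widehat{\mathrm{TL}}_1\rangle\Big)\otimes\Big(\mathbb{F}_p[\widehat{\widetilde{\mathrm{TL}}}_2]/\langle\hat w^{\,p}\mid\hat w\in\widehat{\widetilde{\mathrm{TL}}}_2\rangle\Big).$$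
   Context: Mixable shuffle algebra: let $\mathbf{k}$ be a commutative ring, $\lambda\in\mathbf{k}$, $S$ an abelian semigroup. $\mathrm{MS}_{\mathbf{k},\lambda}(S)$ is the free $\mathbf{k}$-module on the words $M^{\otimes}(S)=\{1\}\cup\{u_1\otimes\cdots\otimes u_r\mid u_i\in S,\ r\ge1\}$ with the bilinear product $\diamond$ with identity $1$ and $(a\otimes\mathfrak{a}')\diamond(b\otimes\mathfrak{b}')=a\otimes(\mathfrak{a}'\diamond(b\otimes\mathfrak{b}'))+b\otimes((a\otimes\mathfrak{a}')\diamond\mathfrak{b}')+\lambda\,(ab)\otimes(\mathfrak{a}'\diamond\mathfrak{b}')$ for letters $a,b\in S$ and (possibly empty) words $\mathfrak{a}',\mathfrak{b}'$ (with $a\otimes1$ read as $a$). It is a commutative $\mathbf{k}$-algebra. Classes of semigroups (no compatibility of the order with the product is assumed beyond what is listed). For an abelian semigroup $S$, let $S_1=\{g\in S\mid g^p=g\}$, $S_2=S\setminus S_1$. $\mathcal{P}$: well-ordered abelian semigroups $(S,<)$ such that for all $a,b\in S$, $a>b\Rightarrow a^p>b^p$, and $a^p\ge a$. $\mathcal{J}$: well-ordered abelian semigroups $(S,<)$ such that $g^{p^2}=g^p$ for all $g\in S$, and $g_1<g_2$ for all $g_1\in S_1$, $g_2\in S_2$. $\mathcal{F}$: free abelian semigroups (without identity) on finite ordered sets $X$, ordered first by total degree, then, for equal degree, lexicographically as induced by the order on $X$; $\mathcal{F}\subseteq\mathcal{P}$. Words: for $w=u_1\otimes\cdots\otimes u_r$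 put $w^{\langle p\rangle}=u_1^p\otimes\cdots\otimes u_r^p$; $w^{\otimes k}$ is the $k$-fold concatenation power. Lexicographic order on words: $u<v$ iff either $v=u\otimes x$ with $x$ non-empty, or $u=x\otimes a\otimes u'$, $v=x\otimes b\otimes v'$ with letters $a<b$. A Lyndon word is a non-empty word $w$ such that $w=u\otimes v$ with $u,v\ne1$ implies $w<v$. $\mathrm{L}=\mathrm{Lyn}(S)$ is the set of Lyndon words. For $W\subseteq M^{\otimes}(S)$: $W_1=\{w\in W\mid w^{\langle p\rangle}=w\}$, $W_2=\{w\in W\mid w^{\langle p\rangle}\ne w\}$, $\mathrm{E}(W)=\{w\in W\mid w=w^{\langle p\rangle}\text{ or }w\ne u^{\langle p\rangle}\text{ for every }u\in M^{\otimes}(S)\}$, $\mathrm{T}(W)=\{w^{\otimes p^i}\mid w\in W,\ i\ge0\}$. Set $\mathrm{TL}=\mathrm{T}(\mathrm{L})$, $\mathrm{TL}_i=\mathrm{T}(\mathrm{L}_i)$, $\mathrm{TEL}=\mathrm{T}(\mathrm{E}(\mathrm{L}))$, $\mathrm{TEL}_i=\mathrm{T}(\mathrm{E}(\mathrm{L}_i))$ for $i=1,2$. For $S\in\mathcal{J}$, $\widetilde{\mathrm{TL}}_2=\{w-w^{\langle p\rangle}\mid w\in\mathrm{TL}_2\}\subset\mathrm{MS}_{\mathbb{F}_p,\lambda}(S)$. *)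

theory Defs
  imports
    "HOL-Algebra.Algebra"
    "HOL-Library.Poly_Mapping"
    "HOL-Library.Multiset"
    "Berlekamp_Zassenhaus.Finite_Field"
begin

section \<open>Algebras and their isomorphisms\<close>

text \<open>
  A \<open>'k\<close>-algebra is a record of type \<open>('k, 'm) module\<close> from HOL-Algebra (a ring record with a
  scalar multiplication), whose scalars are all elements of the type \<open>'k\<close>.
\<close>

definition alg_iso :: "('k, 'm) module \<Rightarrow> ('k, 'n) module \<Rightarrow> bool" (infix "\<cong>\<^sub>a" 50) where
  "A \<cong>\<^sub>a B \<longleftrightarrow> (\<exists>h \<in> ring_iso A B. \<forall>c. \<forall>x \<in> carrier A. h (c \<odot>\<^bsub>A\<^esub> x) = c \<odot>\<^bsub>B\<^esub> h x)"

definition quot_alg :: "('k, 'm) module \<Rightarrow> 'm set \<Rightarrow> ('k, 'm set) module" where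
  "quot_alg A I = ring.extend (A Quot I) (module.fields (\<lambda>c U. \<Union>x\<in>U. I +>\<^bsub>A\<^esub> (c \<odot>\<^bsub>A\<^esub> x)))"

definition scale :: "'k::comm_ring_1 \<Rightarrow> ('w \<Rightarrow>\<^sub>0 'k) \<Rightarrow> ('w \<Rightarrow>\<^sub>0 'k)" where
  "scale c f = Poly_Mapping.map (\<lambda>x. c * x) f"

definition bilin_ext ::
    "('w \<Rightarrow> 'w \<Rightarrow> ('w \<Rightarrow>\<^sub>0 'k::comm_ring_1)) \<Rightarrow> ('w \<Rightarrow>\<^sub>0 'k) \<Rightarrow> ('w \<Rightarrow>\<^sub>0 'k) \<Rightarrow> ('w \<Rightarrow>\<^sub>0 'k)" where
  "bilin_ext m f g =
     (\<Sum>u\<in>Poly_Mapping.keys f. \<Sum>v\<in>Poly_Mapping.keys g.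
        scale (Poly_Mapping.lookup f u * Poly_Mapping.lookup g v) (m u v))"

text \<open>The algebra whose underlying module is free on \<open>B\<close>, with product given on basis elements by
  \<open>m\<close> and with the basis element \<open>e\<close> as identity.\<close>

definition free_alg ::
    "'w set \<Rightarrow> ('w \<Rightarrow> 'w \<Rightarrow> ('w \<Rightarrow>\<^sub>0 'k::comm_ring_1)) \<Rightarrow> 'w \<Rightarrow> ('k, 'w \<Rightarrow>\<^sub>0 'k) module" where
  "free_alg B m e =
     \<lparr>carrier = {f. Poly_Mapping.keys f \<subseteq> B}, monoid.mult = bilin_ext m,
      one = Poly_Mapping.single e 1, ring.zero = 0, add = (+), module.smult = scale\<rparr>"

text \<open>
  The tensor product of modules is the free module on \<open>carrier A \<times> carrier B\<close> modulo the submodule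
  spanned by the bilinearity relations; its product is
  \<open>(a \<otimes> b) (a' \<otimes> b') = (a a') \<otimes> (b b')\<close>. That submodule is an ideal for this product.
\<close>

definition bilinearity_relations ::
    "('k::comm_ring_1, 'm) module \<Rightarrow> ('k, 'n) module \<Rightarrow> ('m \<times> 'n \<Rightarrow>\<^sub>0 'k) set" where
  "bilinearity_relations A B =
     (let t = (\<lambda>a b. Poly_Mapping.single (a, b) (1 :: 'k)) in
       {t (a \<oplus>\<^bsub>A\<^esub> a') b - t a b - t a' b | a a' b.
          a \<in> carrier A \<and> a' \<in> carrier A \<and> b \<in> carrier B} \<union>
       {t a (b \<oplus>\<^bsub>B\<^esub> b') - t a b - t a b' | a b b'.
          a \<in> carrier A \<and> b \<in> carrier B \<and> b' \<in> carrier B} \<union>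
       {t (c \<odot>\<^bsub>A\<^esub> a) b - scale c (t a b) | c a b. a \<in> carrier A \<and> b \<in> carrier B} \<union>
       {t a (c \<odot>\<^bsub>B\<^esub> b) - scale c (t a b) | c a b. a \<in> carrier A \<and> b \<in> carrier B})"

definition tensor_alg ::
    "('k::comm_ring_1, 'm) module \<Rightarrow> ('k, 'n) module \<Rightarrow> ('k, ('m \<times> 'n \<Rightarrow>\<^sub>0 'k) set) module"
    (infixr "\<otimes>\<^sub>a" 65) where
  "A \<otimes>\<^sub>a B =
     quot_alg
       (free_alg (carrier A \<times> carrier B)
          (\<lambda>(a, b) (a', b'). Poly_Mapping.single (a \<otimes>\<^bsub>A\<^esub> a', b \<otimes>\<^bsub>B\<^esub> b') 1)
          (\<one>\<^bsub>A\<^esub>, \<one>\<^bsub>B\<^esub>))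
       (Modules.module.span scale (bilinearity_relations A B))"

text \<open>
  Polynomials over \<open>'k\<close> in a set \<open>Y\<close> of variables: a monomial is a finitely supported exponent
  function \<open>'v \<Rightarrow>\<^sub>0 nat\<close>. The variable attached to \<open>y \<in> Y\<close> is \<open>pvar y\<close>.
\<close>

definition poly_alg :: "'v set \<Rightarrow> ('k::comm_ring_1, ('v \<Rightarrow>\<^sub>0 nat) \<Rightarrow>\<^sub>0 'k) module" where
  "poly_alg Y =
     \<lparr>carrier = {f. \<forall>m \<in> Poly_Mapping.keys f. Poly_Mapping.keys m \<subseteq> Y}, monoid.mult = (*),
      one = 1, ring.zero = 0, add = (+), module.smult = scale\<rparr>"

definition pvar :: "'v \<Rightarrow> (('v \<Rightarrow>\<^sub>0 nat) \<Rightarrow>\<^sub>0 'k::comm_ring_1)" where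
  "pvar y = Poly_Mapping.single (Poly_Mapping.single y 1) 1"

section \<open>Ordered abelian semigroups\<close>

text \<open>\<open>sgle\<close> is the reflexive order \<open>\<le>\<close> on the carrier, as a set of pairs.\<close>

record 'a ord_semigroup = "'a partial_object" +
  sgmult :: "'a \<Rightarrow> 'a \<Rightarrow> 'a"
  sgle :: "'a rel"

definition sgless :: "'a ord_semigroup \<Rightarrow> 'a rel" where
  "sgless S = sgle S - Id"

text \<open>There is no identity, so the power is meaningful for exponents \<open>n \<ge> 1\<close> only.\<close>

definition sgpow :: "'a ord_semigroup \<Rightarrow> 'a \<Rightarrow> nat \<Rightarrow> 'a" where
  "sgpow S g n = (sgmult S g ^^ (n - 1)) g"

definition abelian_semigroup :: "'a ord_semigroup \<Rightarrow> bool" where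
  "abelian_semigroup S \<longleftrightarrow>
     (\<forall>a \<in> carrier S. \<forall>b \<in> carrier S. sgmult S a b \<in> carrier S) \<and>
     (\<forall>a \<in> carrier S. \<forall>b \<in> carrier S. \<forall>c \<in> carrier S.
        sgmult S (sgmult S a b) c = sgmult S a (sgmult S b c)) \<and>
     (\<forall>a \<in> carrier S. \<forall>b \<in> carrier S. sgmult S a b = sgmult S b a)"

definition well_ordered_abelian_semigroup :: "'a ord_semigroup \<Rightarrow> bool" where
  "well_ordered_abelian_semigroup S \<longleftrightarrow> abelian_semigroup S \<and> well_order_on (carrier S) (sgle S)"

definition class_P :: "nat \<Rightarrow> 'a ord_semigroup \<Rightarrow> bool" where
  "class_P p S \<longleftrightarrow> well_ordered_abelian_semigroup S \<and>
     (\<forall>a \<in> carrier S. \<forall>b \<in> carrier S.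
        (b, a) \<in> sgless S \<longrightarrow> (sgpow S b p, sgpow S a p) \<in> sgless S) \<and>
     (\<forall>a \<in> carrier S. (a, sgpow S a p) \<in> sgle S)"

definition sg1 :: "nat \<Rightarrow> 'a ord_semigroup \<Rightarrow> 'a set" where
  "sg1 p S = {g \<in> carrier S. sgpow S g p = g}"

definition sg2 :: "nat \<Rightarrow> 'a ord_semigroup \<Rightarrow> 'a set" where
  "sg2 p S = carrier S - sg1 p S"

definition class_J :: "nat \<Rightarrow> 'a ord_semigroup \<Rightarrow> bool" where
  "class_J p S \<longleftrightarrow> well_ordered_abelian_semigroup S \<and>
     (\<forall>g \<in> carrier S. sgpow S g (p\<^sup>2) = sgpow S g p) \<and>
     (\<forall>g1 \<in> sg1 p S. \<forall>g2 \<in> sg2 p S. (g1, g2) \<in> sgless S)"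

text \<open>
  The free abelian semigroup on \<open>G\<close>, ordered by \<open>r\<close>, consists of the non-empty multisets on \<open>G\<close>.
  Its order is the graded lexicographic one: for \<open>M \<noteq> N\<close> of equal degree, \<open>M < N\<close> iff \<open>M\<close> has the
  smaller exponent at the largest generator whose exponents in \<open>M\<close> and \<open>N\<close> differ. In degree one
  this is the order \<open>r\<close> on \<open>G\<close>.
\<close>

definition deglex_less :: "'x set \<Rightarrow> 'x rel \<Rightarrow> 'x multiset \<Rightarrow> 'x multiset \<Rightarrow> bool" where
  "deglex_less G r M N \<longleftrightarrow> size M < size N \<or>
     (size M = size N \<and>
      (\<exists>x \<in> G. count M x < count N x \<and> (\<forall>y \<in> G. (x, y) \<in> r - Id \<longrightarrow> count M y = count N y)))"

definition free_ab_semigroup :: "'x set \<Rightarrow> 'x rel \<Rightarrow> 'x multiset ord_semigroup" where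
  "free_ab_semigroup G r =
     (let C = {M. M \<noteq> {#} \<and> set_mset M \<subseteq> G} in
      \<lparr>carrier = C, sgmult = (+),
       sgle = {(M, N). M \<in> C \<and> N \<in> C \<and> (M = N \<or> deglex_less G r M N)}\<rparr>)"

section \<open>The mixable shuffle algebra\<close>

definition prepend :: "'a \<Rightarrow> ('a list \<Rightarrow>\<^sub>0 'k::comm_ring_1) \<Rightarrow> ('a list \<Rightarrow>\<^sub>0 'k)" where
  "prepend a f = (\<Sum>w\<in>Poly_Mapping.keys f. Poly_Mapping.single (a # w) (Poly_Mapping.lookup f w))"

fun mixable_shuffle ::
    "'k::comm_ring_1 \<Rightarrow> 'a ord_semigroup \<Rightarrow> 'a list \<Rightarrow> 'a list \<Rightarrow> ('a list \<Rightarrow>\<^sub>0 'k)" where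
  "mixable_shuffle lam S [] v = Poly_Mapping.single v 1"
| "mixable_shuffle lam S u [] = Poly_Mapping.single u 1"
| "mixable_shuffle lam S (a # u) (b # v) =
     prepend a (mixable_shuffle lam S u (b # v)) +
     prepend b (mixable_shuffle lam S (a # u) v) +
     scale lam (prepend (sgmult S a b) (mixable_shuffle lam S u v))"

definition MS :: "'k::comm_ring_1 \<Rightarrow> 'a ord_semigroup \<Rightarrow> ('k, 'a list \<Rightarrow>\<^sub>0 'k) module" where
  "MS lam S = free_alg (lists (carrier S)) (mixable_shuffle lam S) []"

section \<open>Lyndon words\<close>

definition word_pow :: "nat \<Rightarrow> 'a ord_semigroup \<Rightarrow> 'a list \<Rightarrow> 'a list" where
  "word_pow p S w = map (\<lambda>g. sgpow S g p) w"

definition word_rep :: "'a list \<Rightarrow> nat \<Rightarrow> 'a list" where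
  "word_rep w k = concat (replicate k w)"

definition Lyn :: "'a ord_semigroup \<Rightarrow> 'a list set" where
  "Lyn S = {w \<in> lists (carrier S). w \<noteq> [] \<and>
     (\<forall>u v. w = u @ v \<and> u \<noteq> [] \<and> v \<noteq> [] \<longrightarrow> (w, v) \<in> lexord (sgless S))}"

definition part1 :: "nat \<Rightarrow> 'a ord_semigroup \<Rightarrow> 'a list set \<Rightarrow> 'a list set" where
  "part1 p S W = {w \<in> W. word_pow p S w = w}"

definition part2 :: "nat \<Rightarrow> 'a ord_semigroup \<Rightarrow> 'a list set \<Rightarrow> 'a list set" where
  "part2 p S W = {w \<in> W. word_pow p S w \<noteq> w}"

definition Ew :: "nat \<Rightarrow> 'a ord_semigroup \<Rightarrow> 'a list set \<Rightarrow> 'a list set" where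
  "Ew p S W = {w \<in> W. w = word_pow p S w \<or> (\<forall>u \<in> lists (carrier S). w \<noteq> word_pow p S u)}"

definition Tw :: "nat \<Rightarrow> 'a list set \<Rightarrow> 'a list set" where
  "Tw p W = {word_rep w (p ^ i) | w i. w \<in> W}"

definition TL1 :: "nat \<Rightarrow> 'a ord_semigroup \<Rightarrow> 'a list set" where
  "TL1 p S = Tw p (part1 p S (Lyn S))"

definition TL2 :: "nat \<Rightarrow> 'a ord_semigroup \<Rightarrow> 'a list set" where
  "TL2 p S = Tw p (part2 p S (Lyn S))"

definition TEL :: "nat \<Rightarrow> 'a ord_semigroup \<Rightarrow> 'a list set" where
  "TEL p S = Tw p (Ew p S (Lyn S))"

definition TEL1 :: "nat \<Rightarrow> 'a ord_semigroup \<Rightarrow> 'a list set" where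
  "TEL1 p S = Tw p (Ew p S (part1 p S (Lyn S)))"

definition TEL2 :: "nat \<Rightarrow> 'a ord_semigroup \<Rightarrow> 'a list set" where
  "TEL2 p S = Tw p (Ew p S (part2 p S (Lyn S)))"

definition TL2_tilde :: "nat \<Rightarrow> 'a ord_semigroup \<Rightarrow> ('a list \<Rightarrow>\<^sub>0 'k::comm_ring_1) set" where
  "TL2_tilde p S =
     {Poly_Mapping.single w 1 - Poly_Mapping.single (word_pow p S w) 1 | w. w \<in> TL2 p S}"

section \<open>The presented algebras\<close>

definition frob_quot ::
    "nat \<Rightarrow> 'v set \<Rightarrow> 'v set \<Rightarrow> ('k::comm_ring_1, (('v \<Rightarrow>\<^sub>0 nat) \<Rightarrow>\<^sub>0 'k) set) module" where
  "frob_quot p Y Z = quot_alg (poly_alg Y) (Idl\<^bsub>poly_alg Y\<^esub> {pvar z ^ p - pvar z | z. z \<in> Z})"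

definition nil_quot ::
    "nat \<Rightarrow> 'v set \<Rightarrow> ('k::comm_ring_1, (('v \<Rightarrow>\<^sub>0 nat) \<Rightarrow>\<^sub>0 'k) set) module" where
  "nil_quot p Y = quot_alg (poly_alg Y) (Idl\<^bsub>poly_alg Y\<^esub> {pvar y ^ p | y. y \<in> Y})"

end

theory Submission imports Defs begin

text \<open>
  Two facts about the mixable shuffle algebra carry the proof.

  The Frobenius map acts on words letterwise (\<open>word_frobenius\<close>). Group the terms of the \<open>p\<close>-th power
  of \<open>a \<otimes> f\<close> by their first letter, which is \<open>a ^ k\<close> when exactly \<open>k\<close> of the \<open>p\<close> factors
  contribute to it. Binomial coefficients kill all \<open>k < p\<close>; for \<open>k = p\<close> the coefficient is
  \<open>lam ^ (p - 1) = 1\<close> by Fermat's theorem, and what remains is \<open>a ^ p \<otimes> f ^ p\<close>.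

  Monomials in powers of Lyndon words form a basis (\<open>lyndon_monomial_basis\<close>). Words are compared
  by length and then lexicographically. Contraction of letters shortens words, so the leading word
  of a product is the one of the ordinary shuffle product. As Radford found, it is obtained by
  merging the two Lyndon factorizations, and its coefficient is a product of binomial coefficients
  that counts the interleavings of equal factors (\<open>ms_leading\<close>). Choose for every \<open>v\<close> in \<open>TL\<close> an
  element \<open>x v\<close> with leading word \<open>v\<close>. Multiplication by \<open>x v\<close> for \<open>v\<close> the \<open>p ^ i\<close>-fold repetition
  of a Lyndon word \<open>l\<close> adds \<open>p ^ i\<close> to the multiplicity of \<open>l\<close> in the leading word. By Lucas'
  theorem the coefficient that arises is non-zero as long as the base \<open>p\<close> digit at position \<open>i\<close>
  does not overflow. Hence each monomial with all exponents below \<open>p\<close> has a leading word whose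
  multiplicities have the exponents as their digits, and every word occurs exactly once.

  For a semigroup in the class J take \<open>x v = v\<close> for \<open>v\<close> in \<open>TL1\<close> and \<open>x v = v - v ^ p\<close> for \<open>v\<close> in
  \<open>TL2\<close>. The latter has leading word \<open>v\<close>, because \<open>p\<close>-th powers of letters are fixed by the
  Frobenius map and hence smaller than the letters that are not fixed. Then \<open>x v ^ p\<close> is \<open>x v\<close> or \<open>0\<close>,
  and the basis consists of the monomials that represent a basis of the presented algebra.

  For a semigroup in the class P, taking \<open>p\<close>-th powers of letters is strictly monotone and
  increasing. So it preserves Lyndon words, and \<open>TL\<close> falls into Frobenius orbits: fixed words, and
  infinite orbits starting at a word of \<open>TEL2\<close>. Along an infinite orbit \<open>e, e ^ p, e ^ (p\<^sup>2), \<dots>\<close> the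
  reduced monomials are, again by base \<open>p\<close> expansion, the powers of \<open>e\<close>. This turns the basis into
  the monomials in \<open>TEL\<close> whose exponents are below \<open>p\<close> on \<open>TEL1\<close> (\<open>TEL_basis\<close>). In a free abelian
  semigroup \<open>p\<close>-th powers multiply the degree by \<open>p\<close>, so that \<open>TEL1\<close> is empty.

  The tensor decompositions follow by splitting the variables: if products of spanning families of
  two algebras form a basis of a third, then the latter is their tensor product (\<open>tensor_iso\<close>).
\<close>

section \<open>Linear extension of maps on basis elements\<close>

abbreviation lk where "lk \<equiv> Poly_Mapping.lookup"
abbreviation ks where "ks \<equiv> Poly_Mapping.keys"
abbreviation single where "single \<equiv> Poly_Mapping.single"

lemma lookup_scale [simp]: "lk (scale c f) x = c * lk f x"
  unfolding scale_def by (transfer) (auto simp: when_def)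

lemma keys_scale_subset: "ks (scale c f) \<subseteq> ks f"
  by (auto simp: in_keys_iff)

global_interpretation scale_module: Modules.module "scale :: 'k::comm_ring_1 \<Rightarrow> ('w \<Rightarrow>\<^sub>0 'k) \<Rightarrow> _"
  by unfold_locales (auto intro!: poly_mapping_eqI simp: lookup_add algebra_simps)

lemma scale_zero [simp]: "scale 0 f = 0" "scale c 0 = 0"
  by (auto intro!: poly_mapping_eqI)

lemma scale_one [simp]: "scale 1 f = f"
  by (auto intro!: poly_mapping_eqI)

lemma scale_scale [simp]: "scale c (scale d f) = scale (c * d) f"
  by (auto intro!: poly_mapping_eqI simp: mult.assoc)

lemma scale_add: "scale c (f + g) = scale c f + scale c g"
  by (rule scale_module.scale_right_distrib)

lemma scale_add_left: "scale (c + d) f = scale c f + scale d f"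
  by (rule scale_module.scale_left_distrib)

lemma scale_sum: "scale c (sum f A) = (\<Sum>a\<in>A. scale c (f a))"
  by (rule scale_module.scale_sum_right)

lemma scale_single [simp]: "scale c (single u d) = single u (c * d)"
  by (auto intro!: poly_mapping_eqI simp: lookup_single when_def)

definition lin :: "('u \<Rightarrow> ('w \<Rightarrow>\<^sub>0 'k::comm_ring_1)) \<Rightarrow> ('u \<Rightarrow>\<^sub>0 'k) \<Rightarrow> ('w \<Rightarrow>\<^sub>0 'k)" where
  "lin b t = (\<Sum>u\<in>ks t. scale (lk t u) (b u))"

lemma lin_superset:
  assumes "finite A" "ks t \<subseteq> A"
  shows "lin b t = (\<Sum>u\<in>A. scale (lk t u) (b u))"
  unfolding lin_def using assms
  by (intro sum.mono_neutral_left) (auto simp: in_keys_iff)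

lemma lin_add: "lin b (s + t) = lin b s + lin b t"
proof -
  let ?A = "ks s \<union> ks t"
  have "lin b (s + t) = (\<Sum>u\<in>?A. scale (lk (s + t) u) (b u))"
    by (rule lin_superset) (auto dest: subsetD[OF Poly_Mapping.keys_add])
  also have "\<dots> = (\<Sum>u\<in>?A. scale (lk s u) (b u)) + (\<Sum>u\<in>?A. scale (lk t u) (b u))"
    by (simp add: lookup_add scale_add_left sum.distrib)
  finally show ?thesis by (simp add: lin_superset[of ?A])
qed

lemma lin_scale: "lin b (scale c t) = scale c (lin b t)"
  by (subst lin_superset[of "ks t"]) (auto simp: keys_scale_subset lin_def scale_sum)

lemma lin_zero [simp]: "lin b 0 = 0"
  by (simp add: lin_def)

lemma lin_single [simp]: "lin b (single u c) = scale c (b u)"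
  by (subst lin_superset[of "{u}"]) auto

lemma lin_diff: "lin b (s - t) = lin b s - lin b t"
  using lin_add[of b "s - t" t] by simp

lemma lin_sum: "lin b (sum f A) = (\<Sum>a\<in>A. lin b (f a))"
  by (induction A rule: infinite_finite_induct) (auto simp: lin_add)

lemma lin_cong: "(\<And>u. u \<in> ks t \<Longrightarrow> b u = c u) \<Longrightarrow> lin b t = lin c t"
  by (simp add: lin_def)

lemma lin_single_id [simp]: "lin (\<lambda>u. single u 1) t = t"
proof (rule poly_mapping_eqI)
  fix k show "lk (lin (\<lambda>u. single u 1) t) k = lk t k"
  proof -
    have "lk (lin (\<lambda>u. single u 1) t) k = (\<Sum>u\<in>ks t. if u = k then lk t u else 0)"
      unfolding lin_def lookup_sum by (intro sum.cong) (auto simp: lookup_single when_def)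
    then show ?thesis by (simp add: in_keys_iff)
  qed
qed

lemma lin_lin: "lin b (lin c t) = lin (\<lambda>u. lin b (c u)) t"
  by (simp add: lin_def[of c] lin_def[of "\<lambda>u. lin b (c u)"] lin_sum lin_scale)

lemma lin_fun_add: "lin (\<lambda>u. b u + c u) t = lin b t + lin c t"
  by (simp add: lin_def scale_add sum.distrib)

lemma lin_fun_scale: "lin (\<lambda>u. scale d (b u)) t = scale d (lin b t)"
  by (simp add: lin_def scale_sum mult.commute)

lemma lin_fun_zero [simp]: "lin (\<lambda>u. 0) t = 0"
  by (simp add: lin_def)

lemma lookup_lin: "lk (lin b t) w = (\<Sum>u\<in>ks t. lk t u * lk (b u) w)"
  by (simp add: lin_def lookup_sum)

lemma keys_lin: "ks (lin b t) \<subseteq> (\<Union>u\<in>ks t. ks (b u))"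
  unfolding lin_def by (rule order_trans[OF keys_sum]) (intro UN_mono keys_scale_subset order_refl)

lemma keys_subset_add: "ks f \<subseteq> B \<Longrightarrow> ks g \<subseteq> B \<Longrightarrow> ks (f + g) \<subseteq> B"
  by (rule order_trans[OF Poly_Mapping.keys_add]) (rule Un_least)

lemma keys_subset_lin: "(\<And>u. u \<in> ks t \<Longrightarrow> ks (b u) \<subseteq> B) \<Longrightarrow> ks (lin b t) \<subseteq> B"
  by (rule order_trans[OF keys_lin]) (rule UN_least)

lemma keys_uminus [simp]: "ks (- f) = ks (f :: 'w \<Rightarrow>\<^sub>0 'k::ab_group_add)"
  by (auto simp: in_keys_iff)

text \<open>The form in which linearity arguments are run: both sides of an identity are additive, so it
  is enough to compare them on multiples of basis elements.\<close>

lemma keys_induct [consumes 1, case_names zero add]: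
  fixes f :: "'u \<Rightarrow>\<^sub>0 'k::comm_ring_1"
  assumes "ks f \<subseteq> B"
    and zero: "P 0"
    and add: "\<And>u c g. u \<in> B \<Longrightarrow> ks g \<subseteq> B \<Longrightarrow> P g \<Longrightarrow> P (single u c + g)"
  shows "P f"
proof -
  have "P (\<Sum>u\<in>A. single u (lk f u)) \<and> ks (\<Sum>u\<in>A. single u (lk f u)) \<subseteq> B"
    if "finite A" "A \<subseteq> B" for A
    using that
    by (induction A)
      (auto simp: zero intro!: add dest!: subsetD[OF Poly_Mapping.keys_add] split: if_splits)
  moreover have "(\<Sum>u\<in>ks f. single u (lk f u)) = f"
    using lin_single_id[of f] unfolding lin_def by simp
  ultimately show ?thesis using assms(1) by (metis finite_keys)
qed

lemma bilin_ext_lin: "bilin_ext m f g = lin (\<lambda>u. lin (m u) g) f"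
  by (simp add: bilin_ext_def lin_def scale_sum)

lemma bilin_ext_add_left: "bilin_ext m (f + f') g = bilin_ext m f g + bilin_ext m f' g"
  and bilin_ext_add_right: "bilin_ext m f (g + g') = bilin_ext m f g + bilin_ext m f g'"
  and bilin_ext_scale_left: "bilin_ext m (scale c f) g = scale c (bilin_ext m f g)"
  and bilin_ext_scale_right: "bilin_ext m f (scale c g) = scale c (bilin_ext m f g)"
  and bilin_ext_zero [simp]: "bilin_ext m 0 g = 0" "bilin_ext m f 0 = 0"
  and bilin_ext_single [simp]: "bilin_ext m (single u c) g = scale c (lin (m u) g)"
  by (simp_all add: bilin_ext_lin lin_add lin_fun_add lin_scale lin_fun_scale)

lemma keys_bilin_ext:
  assumes "\<And>u v. u \<in> ks f \<Longrightarrow> v \<in> ks g \<Longrightarrow> ks (m u v) \<subseteq> B"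
  shows "ks (bilin_ext m f g) \<subseteq> B"
  unfolding bilin_ext_lin by (intro keys_subset_lin assms)

lemma bilin_ext_lin_left: "bilin_ext m (lin b t) g = lin (\<lambda>u. bilin_ext m (b u) g) t"
  by (simp add: bilin_ext_lin lin_lin)

lemma bilin_ext_lin_right: "bilin_ext m f (lin b t) = lin (\<lambda>u. bilin_ext m f (b u)) t"
proof -
  have "bilin_ext m f (lin b t) = (\<Sum>u\<in>ks t. scale (lk t u) (bilin_ext m f (b u)))"
    if "finite (ks t)" for t :: "'c \<Rightarrow>\<^sub>0 'b"
  proof -
    have "bilin_ext m f (\<Sum>u\<in>A. scale (lk t u) (b u)) = (\<Sum>u\<in>A. scale (lk t u) (bilin_ext m f (b u)))"
      if "finite A" for A
      using that by induction (auto simp: bilin_ext_add_right bilin_ext_scale_right)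
    from this[of "ks t"] show ?thesis by (simp add: lin_def)
  qed
  then show ?thesis by (simp add: lin_def)
qed

section \<open>Algebras, quotients and tensor products\<close>

text \<open>The compatibility of scalars with sums and products that lets the algebra structure descend to
  quotients by ideals.\<close>

locale kalg = cring A for A :: "('k::comm_ring_1, 'm) module" (structure) +
  assumes smult_closed [simp, intro]: "x \<in> carrier A \<Longrightarrow> c \<odot>\<^bsub>A\<^esub> x \<in> carrier A"
    and smult_add: "x \<in> carrier A \<Longrightarrow> y \<in> carrier A \<Longrightarrow>
      c \<odot>\<^bsub>A\<^esub> (x \<oplus>\<^bsub>A\<^esub> y) = (c \<odot>\<^bsub>A\<^esub> x) \<oplus>\<^bsub>A\<^esub> (c \<odot>\<^bsub>A\<^esub> y)"
    and smult_mult: "x \<in> carrier A \<Longrightarrow> y \<in> carrier A \<Longrightarrow>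
      c \<odot>\<^bsub>A\<^esub> (x \<otimes>\<^bsub>A\<^esub> y) = (c \<odot>\<^bsub>A\<^esub> x) \<otimes>\<^bsub>A\<^esub> y"

lemma free_alg_simps [simp]:
  "carrier (free_alg B m e) = {f. ks f \<subseteq> B}"
  "x \<otimes>\<^bsub>free_alg B m e\<^esub> y = bilin_ext m x y"
  "\<one>\<^bsub>free_alg B m e\<^esub> = single e 1"
  "\<zero>\<^bsub>free_alg B m e\<^esub> = 0"
  "x \<oplus>\<^bsub>free_alg B m e\<^esub> y = x + y"
  "c \<odot>\<^bsub>free_alg B m e\<^esub> x = scale c x"
  by (simp_all add: free_alg_def)

lemma free_alg_kalg:
  fixes m :: "'w \<Rightarrow> 'w \<Rightarrow> ('w \<Rightarrow>\<^sub>0 'k::comm_ring_1)"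
  assumes e: "e \<in> B"
    and closed: "\<And>u v. u \<in> B \<Longrightarrow> v \<in> B \<Longrightarrow> ks (m u v) \<subseteq> B"
    and unit: "\<And>u. u \<in> B \<Longrightarrow> m e u = single u 1"
    and comm: "\<And>u v. u \<in> B \<Longrightarrow> v \<in> B \<Longrightarrow> m u v = m v u"
    and assoc: "\<And>u v w. u \<in> B \<Longrightarrow> v \<in> B \<Longrightarrow> w \<in> B \<Longrightarrow>
      lin (\<lambda>x. m x w) (m u v) = lin (m u) (m v w)"
  shows "kalg (free_alg B m e)"
proof -
  let ?A = "free_alg B m e :: ('k, 'w \<Rightarrow>\<^sub>0 'k) module"
  have cl: "ks (bilin_ext m f g) \<subseteq> B" if "ks f \<subseteq> B" "ks g \<subseteq> B" for f g
    using that by (intro keys_bilin_ext closed) auto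
  have com: "bilin_ext m f g = bilin_ext m g f" if "ks f \<subseteq> B" "ks g \<subseteq> B" for f g
    using that(1)
  proof (induction f rule: keys_induct)
    case (add u c f)
    have "bilin_ext m (single u c) g = bilin_ext m g (single u c)"
      using that(2)
    proof (induction g rule: keys_induct)
      case (add v d g)
      then show ?case using \<open>u \<in> B\<close>
        by (simp add: bilin_ext_add_right bilin_ext_add_left comm[of u v] lin_add scale_add mult.commute)
    qed simp
    with add show ?case by (simp add: bilin_ext_add_right bilin_ext_add_left)
  qed simp
  have uni: "bilin_ext m (single e 1) f = f" if "ks f \<subseteq> B" for f
  proof -
    have "lin (m e) f = lin (\<lambda>u. single u 1) f"
      using that unit by (intro lin_cong) auto
    then show ?thesis by simp
  qed
  have ass: "bilin_ext m (bilin_ext m f g) h = bilin_ext m f (bilin_ext m g h)"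
    if "ks f \<subseteq> B" "ks g \<subseteq> B" "ks h \<subseteq> B" for f g h
    using that(1)
  proof (induction f rule: keys_induct)
    case (add u c f)
    note f = this
    have "bilin_ext m (lin (m u) g) h = lin (m u) (bilin_ext m g h)"
      using that(2)
    proof (induction g rule: keys_induct)
      case (add v d g)
      have "bilin_ext m (m u v) h = lin (m u) (lin (m v) h)"
        using that(3)
      proof (induction h rule: keys_induct)
        case (add w b h)
        have "bilin_ext m (m u v) (single w b) = scale b (lin (\<lambda>x. m x w) (m u v))"
          by (simp add: bilin_ext_lin lin_fun_scale)
        also have "\<dots> = scale b (lin (m u) (m v w))"
          using add f \<open>v \<in> B\<close> by (simp add: assoc)
        finally show ?case using add by (simp add: bilin_ext_add_right lin_add lin_scale)
      qed simp
      with add show ?case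
        by (simp add: bilin_ext_add_left bilin_ext_scale_left lin_add lin_scale)
    qed simp
    with f show ?case by (simp add: bilin_ext_add_left bilin_ext_scale_left)
  qed simp
  have "abelian_group ?A"
  proof (rule abelian_groupI)
    fix x assume "x \<in> carrier ?A"
    then show "\<exists>y\<in>carrier ?A. y \<oplus>\<^bsub>?A\<^esub> x = \<zero>\<^bsub>?A\<^esub>"
      by (intro bexI[of _ "- x"]) simp_all
  qed (simp_all add: keys_subset_add add_ac)
  moreover have "comm_monoid ?A"
  proof (rule comm_monoidI)
    fix x y z assume "x \<in> carrier ?A" "y \<in> carrier ?A" "z \<in> carrier ?A"
    then show "x \<otimes>\<^bsub>?A\<^esub> y \<otimes>\<^bsub>?A\<^esub> z = x \<otimes>\<^bsub>?A\<^esub> (y \<otimes>\<^bsub>?A\<^esub> z)"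
      using ass by simp
  next
    fix x y assume "x \<in> carrier ?A" "y \<in> carrier ?A"
    then show "x \<otimes>\<^bsub>?A\<^esub> y = y \<otimes>\<^bsub>?A\<^esub> x" "x \<otimes>\<^bsub>?A\<^esub> y \<in> carrier ?A"
      using com[of x y] cl[of x y] by simp_all
  next
    fix x assume "x \<in> carrier ?A"
    then show "\<one>\<^bsub>?A\<^esub> \<otimes>\<^bsub>?A\<^esub> x = x" using uni[of x] by simp
  qed (simp add: e)
  ultimately have "cring ?A"
    by (intro cringI) (auto simp: bilin_ext_add_left)
  then show ?thesis
    by (intro kalg.intro kalg_axioms.intro)
      (auto simp: scale_add bilin_ext_scale_left dest!: subsetD[OF keys_scale_subset])
qed

definition alg_hom :: "('k, 'm) module \<Rightarrow> ('k, 'n) module \<Rightarrow> ('m \<Rightarrow> 'n) set" where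
  "alg_hom A C = {h \<in> Ring.ring_hom A C. \<forall>c. \<forall>x \<in> carrier A. h (c \<odot>\<^bsub>A\<^esub> x) = c \<odot>\<^bsub>C\<^esub> h x}"

lemma alg_isoI:
  assumes "h \<in> alg_hom A B" "bij_betw h (carrier A) (carrier B)"
  shows "A \<cong>\<^sub>a B"
  using assms unfolding alg_iso_def alg_hom_def ring_iso_def by auto

lemma alg_iso_sym:
  assumes "kalg A" "A \<cong>\<^sub>a B" shows "B \<cong>\<^sub>a A"
proof -
  interpret A: kalg A by fact
  from assms(2) obtain h where h: "h \<in> ring_iso A B"
    "\<And>c x. x \<in> carrier A \<Longrightarrow> h (c \<odot>\<^bsub>A\<^esub> x) = c \<odot>\<^bsub>B\<^esub> h x"
    unfolding alg_iso_def by auto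
  let ?g = "inv_into (carrier A) h"
  have bij: "bij_betw h (carrier A) (carrier B)" using h by (auto simp: ring_iso_def)
  have "?g \<in> ring_iso B A" using h(1) A.ring_axioms by (simp add: ring_iso_set_sym)
  moreover have "?g (c \<odot>\<^bsub>B\<^esub> y) = c \<odot>\<^bsub>A\<^esub> ?g y" if "y \<in> carrier B" for c y
  proof -
    from that bij obtain x where x: "x \<in> carrier A" "y = h x" by (auto simp: bij_betw_def)
    then show ?thesis using h(2)[of x c] bij
      by (metis A.smult_closed bij_betw_inv_into_left)
  qed
  ultimately show ?thesis unfolding alg_iso_def by blast
qed

lemma alg_iso_trans:
  assumes "A \<cong>\<^sub>a B" "B \<cong>\<^sub>a C" shows "A \<cong>\<^sub>a C"
proof -
  from assms obtain h g where h: "h \<in> ring_iso A B" "\<And>c x. x \<in> carrier A \<Longrightarrow> h (c \<odot>\<^bsub>A\<^esub> x) = c \<odot>\<^bsub>B\<^esub> h x"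
    and g: "g \<in> ring_iso B C" "\<And>c x. x \<in> carrier B \<Longrightarrow> g (c \<odot>\<^bsub>B\<^esub> x) = c \<odot>\<^bsub>C\<^esub> g x"
    unfolding alg_iso_def by auto
  have "g \<circ> h \<in> ring_iso A C" using h(1) g(1) by (rule ring_iso_set_trans)
  moreover have "(g \<circ> h) (c \<odot>\<^bsub>A\<^esub> x) = c \<odot>\<^bsub>C\<^esub> (g \<circ> h) x" if "x \<in> carrier A" for c x
    using h(2)[OF that] g(2)[of "h x"] h(1) that by (auto simp: ring_iso_def bij_betw_def)
  ultimately show ?thesis unfolding alg_iso_def by blast
qed

lemma quot_alg_simps:
  "carrier (quot_alg A I) = a_rcosets\<^bsub>A\<^esub> I"
  "U \<otimes>\<^bsub>quot_alg A I\<^esub> V = rcoset_mult A I U V"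
  "U \<oplus>\<^bsub>quot_alg A I\<^esub> V = U <+>\<^bsub>A\<^esub> V"
  "\<one>\<^bsub>quot_alg A I\<^esub> = I +>\<^bsub>A\<^esub> \<one>\<^bsub>A\<^esub>"
  "\<zero>\<^bsub>quot_alg A I\<^esub> = I"
  "c \<odot>\<^bsub>quot_alg A I\<^esub> U = (\<Union>x\<in>U. I +>\<^bsub>A\<^esub> (c \<odot>\<^bsub>A\<^esub> x))"
  by (simp_all add: quot_alg_def ring.extend_def module.fields_def FactRing_def)

lemma (in kalg) quot_carrier:
  "carrier (quot_alg A I) = (\<lambda>x. I +> x) ` carrier A"
  by (auto simp: quot_alg_simps A_RCOSETS_def RCOSETS_def a_r_coset_def)

lemma (in kalg) smult_ideal:
  assumes "ideal I A" "i \<in> I" shows "c \<odot>\<^bsub>A\<^esub> i \<in> I"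
proof -
  interpret ideal I A by fact
  have i: "i \<in> carrier A" using assms a_Hcarr by auto
  have "c \<odot>\<^bsub>A\<^esub> (\<one> \<otimes> i) = (c \<odot>\<^bsub>A\<^esub> \<one>) \<otimes> i" using i by (intro smult_mult) auto
  also have "\<dots> \<in> I" using assms by (intro I_l_closed) auto
  finally show ?thesis using i by simp
qed

lemma (in kalg) quot_smult:
  assumes "ideal I A" "x \<in> carrier A"
  shows "c \<odot>\<^bsub>quot_alg A I\<^esub> (I +> x) = I +> (c \<odot>\<^bsub>A\<^esub> x)"
proof -
  interpret I: ideal I A by fact
  have "I +> (c \<odot>\<^bsub>A\<^esub> y) = I +> (c \<odot>\<^bsub>A\<^esub> x)" if "y \<in> I +> x" for y
  proof -
    from that obtain i where i: "i \<in> I" "y = i \<oplus> x" by (auto simp: a_r_coset_def')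
    have "c \<odot>\<^bsub>A\<^esub> y = (c \<odot>\<^bsub>A\<^esub> i) \<oplus> (c \<odot>\<^bsub>A\<^esub> x)"
      using i assms by (simp add: smult_add I.a_Hcarr)
    also have "\<dots> \<in> I +> (c \<odot>\<^bsub>A\<^esub> x)"
      using smult_ideal[OF assms(1) i(1)] by (auto simp: a_r_coset_def')
    finally show ?thesis using assms I.a_repr_independence'[of _ "c \<odot>\<^bsub>A\<^esub> x"] by simp
  qed
  moreover have "I +> x \<noteq> {}" using assms I.a_rcos_self by blast
  ultimately show ?thesis by (auto simp: quot_alg_simps)
qed

lemma cring_extend:
  assumes "cring R" shows "cring (ring.extend R (ext :: 'x))"
proof -
  interpret R: cring R by fact
  let ?R = "ring.extend R ext"
  have [simp]: "carrier ?R = carrier R" "\<And>x y. x \<otimes>\<^bsub>?R\<^esub> y = x \<otimes>\<^bsub>R\<^esub> y"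
    "\<And>x y. x \<oplus>\<^bsub>?R\<^esub> y = x \<oplus>\<^bsub>R\<^esub> y" "\<one>\<^bsub>?R\<^esub> = \<one>\<^bsub>R\<^esub>" "\<zero>\<^bsub>?R\<^esub> = \<zero>\<^bsub>R\<^esub>"
    by (simp_all add: ring.extend_def)
  have "abelian_group ?R"
  proof (rule abelian_groupI)
    fix x assume "x \<in> carrier ?R"
    then show "\<exists>y\<in>carrier ?R. y \<oplus>\<^bsub>?R\<^esub> x = \<zero>\<^bsub>?R\<^esub>"
      by (intro bexI[of _ "\<ominus>\<^bsub>R\<^esub> x"]) (simp_all add: R.l_neg)
  qed (simp_all add: R.a_ac)
  moreover have "comm_monoid ?R"
    by (rule comm_monoidI) (simp_all add: R.m_ac)
  ultimately show ?thesis
    by (rule cringI) (simp add: R.l_distr)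
qed

lemma (in kalg) quot_kalg:
  assumes "ideal I A" shows "kalg (quot_alg A I)"
proof -
  interpret I: ideal I A by fact
  have "cring (A Quot I)" by (rule I.quotient_is_cring) (rule is_cring)
  then have cr: "cring (quot_alg A I)"
    unfolding quot_alg_def by (rule cring_extend)
  have mult: "rcoset_mult A I (I +> x) (I +> y) = I +> (x \<otimes> y)"
    if "x \<in> carrier A" "y \<in> carrier A" for x y using that by (rule I.rcoset_mult_add)
  have add: "(I +> x) <+> (I +> y) = I +> (x \<oplus> y)"
    if "x \<in> carrier A" "y \<in> carrier A" for x y using that by (rule I.a_rcos_sum)
  show ?thesis
  proof (intro kalg.intro kalg_axioms.intro cr)
    fix x y c assume "x \<in> carrier (quot_alg A I)" "y \<in> carrier (quot_alg A I)"
    then obtain a b where "a \<in> carrier A" "x = I +> a" "b \<in> carrier A" "y = I +> b"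
      by (auto simp: quot_carrier)
    then show "c \<odot>\<^bsub>quot_alg A I\<^esub> (x \<oplus>\<^bsub>quot_alg A I\<^esub> y) =
        (c \<odot>\<^bsub>quot_alg A I\<^esub> x) \<oplus>\<^bsub>quot_alg A I\<^esub> (c \<odot>\<^bsub>quot_alg A I\<^esub> y)"
      "c \<odot>\<^bsub>quot_alg A I\<^esub> (x \<otimes>\<^bsub>quot_alg A I\<^esub> y) = (c \<odot>\<^bsub>quot_alg A I\<^esub> x) \<otimes>\<^bsub>quot_alg A I\<^esub> y"
      by (simp_all add: quot_smult assms quot_alg_simps(2,3) mult add smult_add smult_mult)
  qed (auto simp: quot_carrier quot_smult assms)
qed

lemma (in kalg) quot_hom:
  fixes C :: "('k, 'n) module"
  assumes I: "ideal I A" and C: "kalg C" and h: "h \<in> alg_hom A C"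
    and ker: "\<forall>x \<in> I. h x = \<zero>\<^bsub>C\<^esub>"
  shows "\<exists>f \<in> alg_hom (quot_alg A I) C. \<forall>x \<in> carrier A. f (I +> x) = h x"
proof -
  interpret I: ideal I A by fact
  interpret C: kalg C by fact
  have hr: "h \<in> Ring.ring_hom A C" and hs: "\<And>c x. x \<in> carrier A \<Longrightarrow> h (c \<odot>\<^bsub>A\<^esub> x) = c \<odot>\<^bsub>C\<^esub> h x"
    using h by (auto simp: alg_hom_def)
  define f where "f U = the_elem (h ` U)" for U
  have f: "f (I +> x) = h x" if x: "x \<in> carrier A" for x
  proof -
    have const: "h y = h x" if "y \<in> I +> x" for y
    proof -
      from that obtain i where "i \<in> I" "y = i \<oplus> x" by (auto simp: a_r_coset_def')
      then show ?thesis using x bspec[OF ker, of i] I.a_Hcarr[of i]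
        by (simp add: ring_hom_add[OF hr] ring_hom_closed[OF hr])
    qed
    have "h ` (I +> x) \<subseteq> {h x}"
    proof (rule image_subsetI)
      fix y assume "y \<in> I +> x"
      then have "h y = h x" by (rule const)
      then show "h y \<in> {h x}" by simp
    qed
    moreover have "h x \<in> h ` (I +> x)" using x by (intro imageI I.a_rcos_self)
    ultimately have "h ` (I +> x) = {h x}" by (intro equalityI) simp_all
    then show ?thesis by (simp add: f_def)
  qed
  have "f \<in> Ring.ring_hom (quot_alg A I) C"
  proof (rule ring_hom_memI)
    fix U V assume "U \<in> carrier (quot_alg A I)" "V \<in> carrier (quot_alg A I)"
    then obtain x y where xy: "x \<in> carrier A" "U = I +> x" "y \<in> carrier A" "V = I +> y"
      by (auto simp: quot_carrier)
    then show "f U \<in> carrier C" "f (U \<otimes>\<^bsub>quot_alg A I\<^esub> V) = f U \<otimes>\<^bsub>C\<^esub> f V"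
      "f (U \<oplus>\<^bsub>quot_alg A I\<^esub> V) = f U \<oplus>\<^bsub>C\<^esub> f V"
      by (simp_all add: f quot_alg_simps(2,3) I.rcoset_mult_add I.a_rcos_sum
        ring_hom_closed[OF hr] ring_hom_mult[OF hr] ring_hom_add[OF hr])
  qed (simp add: quot_alg_simps(4) f ring_hom_one[OF hr])
  moreover have "f (c \<odot>\<^bsub>quot_alg A I\<^esub> U) = c \<odot>\<^bsub>C\<^esub> f U" if "U \<in> carrier (quot_alg A I)" for c U
    using that by (auto simp: quot_carrier quot_smult I f hs)
  ultimately have "f \<in> alg_hom (quot_alg A I) C" by (auto simp: alg_hom_def)
  with f show ?thesis by (intro bexI[of _ f] ballI)
qed

text \<open>First isomorphism theorem. That \<open>I\<close> is an ideal belongs to the conclusion because the tensor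
  product is a quotient by a linear span.\<close>

lemma (in kalg) quot_iso:
  fixes C :: "('k, 'n) module"
  assumes C: "kalg C" and h: "h \<in> alg_hom A C" and surj: "carrier C \<subseteq> h ` carrier A"
    and ker: "I = {x \<in> carrier A. h x = \<zero>\<^bsub>C\<^esub>}"
  shows "ideal I A" "quot_alg A I \<cong>\<^sub>a C"
proof -
  interpret C: kalg C by fact
  have hr: "h \<in> Ring.ring_hom A C" using h by (auto simp: alg_hom_def)
  interpret h: ring_hom_ring A C h
    by (intro ring_hom_ringI2 hr) unfold_locales
  have "I = a_kernel A C h" unfolding ker a_kernel_def' ..
  then show I: "ideal I A" using h.kernel_is_ideal by (simp only:)
  interpret I: ideal I A by fact
  have ker0: "\<forall>x \<in> I. h x = \<zero>\<^bsub>C\<^esub>" unfolding ker by simp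
  obtain f where f: "f \<in> alg_hom (quot_alg A I) C"
    and "\<forall>x \<in> carrier A. f (I +> x) = h x"
    using quot_hom[OF I C h ker0] by (elim bexE)
  then have fx: "f (I +> x) = h x" if "x \<in> carrier A" for x using that by (elim bspec)
  have "inj_on f (carrier (quot_alg A I))"
  proof (rule inj_onI)
    fix U V assume "U \<in> carrier (quot_alg A I)" "V \<in> carrier (quot_alg A I)" and e: "f U = f V"
    then obtain x y where xy: "x \<in> carrier A" "U = I +> x" "y \<in> carrier A" "V = I +> y"
      by (auto simp: quot_carrier)
    have "h x = h y" using e unfolding xy(2,4) fx[OF xy(1)] fx[OF xy(3)] .
    moreover have "h (x \<ominus> y) = h x \<oplus>\<^bsub>C\<^esub> \<ominus>\<^bsub>C\<^esub> h y"
      unfolding a_minus_def using xy(1,3) by (simp only: h.hom_add a_inv_closed h.hom_a_inv)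
    ultimately have "h (x \<ominus> y) = \<zero>\<^bsub>C\<^esub>"
      using xy(3) by (simp only: C.r_neg h.hom_closed)
    then have "x \<ominus> y \<in> I" using xy(1,3) unfolding ker by simp
    then show "U = V"
      unfolding xy(2,4) using quotient_eq_iff_same_a_r_cos[OF I xy(1,3)] by simp
  qed
  moreover have "f ` carrier (quot_alg A I) = carrier C"
  proof -
    have "f ` carrier (quot_alg A I) = h ` carrier A"
      unfolding quot_carrier image_image by (rule image_cong) (simp_all add: fx)
    moreover have "h ` carrier A \<subseteq> carrier C" using ring_hom_closed[OF hr] by (rule image_subsetI)
    ultimately show ?thesis using surj by simp
  qed
  ultimately show "quot_alg A I \<cong>\<^sub>a C" by (intro alg_isoI[OF f] bij_betw_imageI)
qed

text \<open>Spans formed with the operations of the algebra: its carrier is a subset of a type, on which no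
  module structure is given.\<close>

inductive_set lspan :: "('k, 'm) module \<Rightarrow> 'm set \<Rightarrow> 'm set" for A V where
  zero: "\<zero>\<^bsub>A\<^esub> \<in> lspan A V"
| add: "x \<in> V \<Longrightarrow> y \<in> lspan A V \<Longrightarrow> (c \<odot>\<^bsub>A\<^esub> x) \<oplus>\<^bsub>A\<^esub> y \<in> lspan A V"

lemma (in kalg) lspan_closed: "x \<in> lspan A V \<Longrightarrow> V \<subseteq> carrier A \<Longrightarrow> x \<in> carrier A"
  by (induction rule: lspan.induct) auto

lemma alg_homD:
  assumes "h \<in> alg_hom A C"
  shows "h \<in> Ring.ring_hom A C" "x \<in> carrier A \<Longrightarrow> h (c \<odot>\<^bsub>A\<^esub> x) = c \<odot>\<^bsub>C\<^esub> h x"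
    "x \<in> carrier A \<Longrightarrow> h x \<in> carrier C"
    "x \<in> carrier A \<Longrightarrow> y \<in> carrier A \<Longrightarrow> h (x \<otimes>\<^bsub>A\<^esub> y) = h x \<otimes>\<^bsub>C\<^esub> h y"
    "x \<in> carrier A \<Longrightarrow> y \<in> carrier A \<Longrightarrow> h (x \<oplus>\<^bsub>A\<^esub> y) = h x \<oplus>\<^bsub>C\<^esub> h y"
    "h \<one>\<^bsub>A\<^esub> = \<one>\<^bsub>C\<^esub>"
  using assms unfolding alg_hom_def Ring.ring_hom_def by (blast, simp_all add: Pi_iff)

abbreviation tensor_basis_mult where
  "tensor_basis_mult A B \<equiv>
     (\<lambda>(a, b) (a', b'). single (a \<otimes>\<^bsub>A\<^esub> a', b \<otimes>\<^bsub>B\<^esub> b') 1)"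

text \<open>The algebra of which the tensor product is a quotient.\<close>

lemma tensor_cover_kalg:
  fixes A :: "('k::comm_ring_1, 'm) module" and B :: "('k, 'n) module"
  assumes "kalg A" "kalg B"
  shows "kalg (free_alg (carrier A \<times> carrier B) (tensor_basis_mult A B) (\<one>\<^bsub>A\<^esub>, \<one>\<^bsub>B\<^esub>) ::
    ('k, 'm \<times> 'n \<Rightarrow>\<^sub>0 'k) module)"
proof -
  interpret A: kalg A by fact
  interpret B: kalg B by fact
  show ?thesis
  proof (rule free_alg_kalg, goal_cases)
    case 1 then show ?case by simp
  next
    case (2 u v) then show ?case by (simp add: split_beta mem_Times_iff)
  next
    case (3 u) then show ?case by (cases u) simp
  next
    case (4 u v) then show ?case by (cases u; cases v) (simp add: A.m_comm B.m_comm)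
  next
    case (5 u v w) then show ?case
      by (cases u; cases v; cases w) (simp add: A.m_assoc B.m_assoc)
  qed
qed

text \<open>How tensor products are recognised: if products of images of spanning families of \<open>A\<close> and
  \<open>B\<close> form a basis of a commutative algebra, then the product map to that algebra has no kernel
  beyond the bilinearity relations. Modulo these relations every element of the cover is a
  combination of the symbols \<open>(iA i, iB j)\<close>, and on such combinations the product map is
  injective.\<close>

lemma tensor_iso:
  fixes A :: "('k::comm_ring_1, 'm) module" and B :: "('k, 'n) module"
    and mC :: "'w \<Rightarrow> 'w \<Rightarrow> ('w \<Rightarrow>\<^sub>0 'k)" and iA :: "'i \<Rightarrow> 'm" and iB :: "'j \<Rightarrow> 'n"
  assumes A: "kalg A" and B: "kalg B" and C: "kalg (free_alg W mC e)"
    and f: "f \<in> alg_hom A (free_alg W mC e)" and g: "g \<in> alg_hom B (free_alg W mC e)"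
    and iA: "\<And>i. i \<in> I \<Longrightarrow> iA i \<in> carrier A" "carrier A \<subseteq> lspan A (iA ` I)"
    and iB: "\<And>j. j \<in> J \<Longrightarrow> iB j \<in> carrier B" "carrier B \<subseteq> lspan B (iB ` J)"
    and inj: "\<And>t. ks t \<subseteq> I \<times> J \<Longrightarrow>
      lin (\<lambda>(i, j). bilin_ext mC (f (iA i)) (g (iB j))) t = 0 \<Longrightarrow> t = 0"
    and surj: "\<And>z. ks z \<subseteq> W \<Longrightarrow>
      \<exists>t. ks t \<subseteq> I \<times> J \<and> lin (\<lambda>(i, j). bilin_ext mC (f (iA i)) (g (iB j))) t = z"
  shows "free_alg W mC e \<cong>\<^sub>a A \<otimes>\<^sub>a B"
proof -
  let ?C = "free_alg W mC e"
  interpret A: kalg A by fact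
  interpret B: kalg B by fact
  interpret C: kalg ?C by fact
  let ?m = "tensor_basis_mult A B :: _ \<Rightarrow> _ \<Rightarrow> ('m \<times> 'n \<Rightarrow>\<^sub>0 'k)"
  let ?P = "free_alg (carrier A \<times> carrier B) ?m (\<one>\<^bsub>A\<^esub>, \<one>\<^bsub>B\<^esub>) :: ('k, 'm \<times> 'n \<Rightarrow>\<^sub>0 'k) module"
  interpret P: kalg ?P by (rule tensor_cover_kalg[OF A B])
  define \<phi> where "\<phi> = (\<lambda>(a, b). bilin_ext mC (f a) (g b))"
  define t where "t a b = single (a, b) (1 :: 'k)" for a :: 'm and b :: 'n
  have fc: "ks (f a) \<subseteq> W" if "a \<in> carrier A" for a using alg_homD(3)[OF f that] by simp
  have gc: "ks (g b) \<subseteq> W" if "b \<in> carrier B" for b using alg_homD(3)[OF g that] by simp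
  have Cc: "ks (bilin_ext mC x y) \<subseteq> W" if "ks x \<subseteq> W" "ks y \<subseteq> W" for x y
    using C.m_closed[of x y] that by simp
  have \<phi>c: "ks (\<phi> u) \<subseteq> W" if "u \<in> carrier A \<times> carrier B" for u
    using that by (cases u) (simp add: \<phi>_def Cc fc gc)
  have C4: "(x \<otimes>\<^bsub>?C\<^esub> x') \<otimes>\<^bsub>?C\<^esub> (y \<otimes>\<^bsub>?C\<^esub> y') = (x \<otimes>\<^bsub>?C\<^esub> y) \<otimes>\<^bsub>?C\<^esub> (x' \<otimes>\<^bsub>?C\<^esub> y')"
    if "x \<in> carrier ?C" "x' \<in> carrier ?C" "y \<in> carrier ?C" "y' \<in> carrier ?C" for x x' y y'
    using that by (simp only: C.m_ac C.m_closed)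
  have \<phi>m: "lin \<phi> (?m u v) = bilin_ext mC (\<phi> u) (\<phi> v)"
    if uv: "u \<in> carrier A \<times> carrier B" "v \<in> carrier A \<times> carrier B" for u v
  proof -
    obtain a b a' b' where u: "u = (a, b)" "a \<in> carrier A" "b \<in> carrier B"
      and v: "v = (a', b')" "a' \<in> carrier A" "b' \<in> carrier B" using uv by auto
    have "bilin_ext mC (bilin_ext mC (f a) (f a')) (bilin_ext mC (g b) (g b')) =
      bilin_ext mC (bilin_ext mC (f a) (g b)) (bilin_ext mC (f a') (g b'))"
      using C4[of "f a" "f a'" "g b" "g b'"] fc[OF u(2)] fc[OF v(2)] gc[OF u(3)] gc[OF v(3)] by simp
    then show ?thesis
      using alg_homD(4)[OF f u(2) v(2)] alg_homD(4)[OF g u(3) v(3)] by (simp add: u(1) v(1) \<phi>_def)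
  qed
  have hom: "lin \<phi> \<in> alg_hom ?P ?C"
  proof -
    have "lin \<phi> (bilin_ext ?m x y) = bilin_ext mC (lin \<phi> x) (lin \<phi> y)"
      if x: "ks x \<subseteq> carrier A \<times> carrier B" and y: "ks y \<subseteq> carrier A \<times> carrier B" for x y
    proof -
      have "lin \<phi> (bilin_ext ?m x y) = lin (\<lambda>u. lin (\<lambda>v. lin \<phi> (?m u v)) y) x"
        by (simp only: bilin_ext_lin lin_lin)
      also have "\<dots> = lin (\<lambda>u. lin (\<lambda>v. bilin_ext mC (\<phi> u) (\<phi> v)) y) x"
        by (intro lin_cong \<phi>m subsetD[OF x] subsetD[OF y])
      also have "\<dots> = bilin_ext mC (lin \<phi> x) (lin \<phi> y)"
        by (subst bilin_ext_lin_left) (simp only: bilin_ext_lin_right)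
      finally show ?thesis .
    qed
    moreover have "lin \<phi> (single (\<one>\<^bsub>A\<^esub>, \<one>\<^bsub>B\<^esub>) 1) = single e 1"
      using alg_homD(6)[OF f] alg_homD(6)[OF g] C.l_one[of "single e 1"] C.one_closed
      by (simp add: \<phi>_def)
    moreover have "ks (lin \<phi> x) \<subseteq> W" if "ks x \<subseteq> carrier A \<times> carrier B" for x
      using that by (intro keys_subset_lin \<phi>c) (rule subsetD)
    ultimately show ?thesis
      unfolding alg_hom_def by (intro CollectI conjI ring_hom_memI allI ballI) (simp_all add: lin_add lin_scale)
  qed
  let ?R = "bilinearity_relations A B"
  let ?T = "(\<lambda>(i, j). t (iA i) (iB j)) ` (I \<times> J)"
  \<comment> \<open>\<open>D\<close> turns out to be the whole cover, by induction over the spans in \<open>B\<close> and then in \<open>A\<close>.\<close>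
  define D where "D = scale_module.span (?R \<union> ?T)"
  have R1: "t (a \<oplus>\<^bsub>A\<^esub> a') b - t a b - t a' b \<in> ?R"
    if "a \<in> carrier A" "a' \<in> carrier A" "b \<in> carrier B" for a a' b
    unfolding bilinearity_relations_def Let_def t_def using that by blast
  have R2: "t a (b \<oplus>\<^bsub>B\<^esub> b') - t a b - t a b' \<in> ?R"
    if "a \<in> carrier A" "b \<in> carrier B" "b' \<in> carrier B" for a b b'
    unfolding bilinearity_relations_def Let_def t_def using that by blast
  have R3: "t (c \<odot>\<^bsub>A\<^esub> a) b - scale c (t a b) \<in> ?R"
    if "a \<in> carrier A" "b \<in> carrier B" for a b c
    unfolding bilinearity_relations_def Let_def t_def using that by blast
  have R4: "t a (c \<odot>\<^bsub>B\<^esub> b) - scale c (t a b) \<in> ?R"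
    if "a \<in> carrier A" "b \<in> carrier B" for a b c
    unfolding bilinearity_relations_def Let_def t_def using that by blast
  have RD: "x \<in> D" if "x \<in> ?R" for x using that unfolding D_def by (intro scale_module.span_base) simp
  note Dadd = scale_module.span_add[of _ "?R \<union> ?T", folded D_def]
  note Dscale = scale_module.span_scale[of _ "?R \<union> ?T", folded D_def]
  note Dneg = scale_module.span_neg[of _ "?R \<union> ?T", folded D_def]
  have sD: "x \<in> D" if "x - y - z \<in> D" "y \<in> D" "z \<in> D" for x y z
    using Dadd[OF Dadd[OF that(1,2)] that(3)] by simp
  have cD: "x \<in> D" if "x - scale c y \<in> D" "y \<in> D" for x y c
    using Dadd[OF that(1) Dscale[OF that(2), of c]] by simp
  have step: "t (iA i) b \<in> D" if i: "i \<in> I" and "b \<in> lspan B (iB ` J)" for i b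
    using that(2)
  proof (induction rule: lspan.induct)
    case zero
    have "t (iA i) \<zero>\<^bsub>B\<^esub> - t (iA i) \<zero>\<^bsub>B\<^esub> - t (iA i) \<zero>\<^bsub>B\<^esub> \<in> D"
      using RD[OF R2[OF iA(1)[OF i] B.zero_closed B.zero_closed]] by simp
    from Dneg[OF this] show ?case by simp
  next
    case (add x y c)
    then obtain j where j: "j \<in> J" "x = iB j" by blast
    have y: "y \<in> carrier B" using add iB(1) by (intro B.lspan_closed) blast+
    have "t (iA i) (iB j) \<in> D" unfolding D_def
      using i j by (intro scale_module.span_base UnI2 image_eqI[of _ _ "(i, j)"]) simp_all
    then have "t (iA i) (c \<odot>\<^bsub>B\<^esub> x) \<in> D"
      using cD[OF RD[OF R4[OF iA(1)[OF i] iB(1)[OF j(1)]]]] j(2) by simp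
    then show ?case
      using j(2) by (intro sD[OF RD[OF R2[OF iA(1)[OF i] _ y]] _ add.IH]) (simp_all add: iB(1)[OF j(1)])
  qed
  have tD: "t a b \<in> D" if "a \<in> lspan A (iA ` I)" and b: "b \<in> carrier B" for a b
    using that(1)
  proof (induction rule: lspan.induct)
    case zero
    have "t \<zero>\<^bsub>A\<^esub> b - t \<zero>\<^bsub>A\<^esub> b - t \<zero>\<^bsub>A\<^esub> b \<in> D"
      using RD[OF R1[OF A.zero_closed A.zero_closed b]] by simp
    from Dneg[OF this] show ?case by simp
  next
    case (add x y c)
    then obtain i where i: "i \<in> I" "x = iA i" by blast
    have y: "y \<in> carrier A" using add iA(1) by (intro A.lspan_closed) blast+
    have "t (iA i) b \<in> D" using i(1) b iB(2) by (intro step) blast+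
    then have "t (c \<odot>\<^bsub>A\<^esub> x) b \<in> D"
      using cD[OF RD[OF R3[OF iA(1)[OF i(1)] b]]] i(2) by simp
    then show ?case
      using i(2) by (intro sD[OF RD[OF R1[OF _ y b]] _ add.IH]) (simp_all add: iA(1)[OF i(1)])
  qed
  have PD: "x \<in> D" if "ks x \<subseteq> carrier A \<times> carrier B" for x
    using that
  proof (induction rule: keys_induct)
    case zero
    then show ?case unfolding D_def by (rule scale_module.span_zero)
  next
    case (add u c x)
    obtain a b where u: "u = (a, b)" "a \<in> carrier A" "b \<in> carrier B" using add by auto
    have "t a b \<in> D" using u iA(2) by (intro tD) blast+
    from Dscale[OF this, of c] have "single u c \<in> D" by (simp add: t_def u(1))
    with add.IH show ?case by (intro Dadd)
  qed
  have subr: "scale_module.span ?R \<subseteq> {x. ks x \<subseteq> carrier A \<times> carrier B \<and> lin \<phi> x = 0}"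
    proof (rule scale_module.span_minimal)
      have tk: "ks (t a b) \<subseteq> carrier A \<times> carrier B" if "a \<in> carrier A" "b \<in> carrier B" for a b
        using that by (simp add: t_def)
      have tphi: "lin \<phi> (t a b) = bilin_ext mC (f a) (g b)" for a b by (simp add: t_def \<phi>_def)
      have km: "ks (x - y) \<subseteq> K" if "ks x \<subseteq> K" "ks y \<subseteq> K" for x y :: "'m \<times> 'n \<Rightarrow>\<^sub>0 'k" and K
        using keys_subset_add[of x K "- y"] that by simp
      have sk: "ks (scale c x) \<subseteq> K" if "ks x \<subseteq> K" for x :: "'m \<times> 'n \<Rightarrow>\<^sub>0 'k" and K c
        using keys_scale_subset that by (rule order_trans)
      note fa = alg_homD(5)[OF f, simplified] and ga = alg_homD(5)[OF g, simplified]
      note fs = alg_homD(2)[OF f, simplified] and gs = alg_homD(2)[OF g, simplified]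
      show "?R \<subseteq> {x. ks x \<subseteq> carrier A \<times> carrier B \<and> lin \<phi> x = 0}"
        unfolding bilinearity_relations_def Let_def t_def[symmetric]
        by (intro Un_least subsetI CollectI; elim CollectE exE conjE; hypsubst)
          (simp_all add: km sk tk lin_diff lin_scale tphi fa ga fs gs bilin_ext_add_left
            bilin_ext_add_right bilin_ext_scale_left bilin_ext_scale_right)
      show "scale_module.subspace {x. ks x \<subseteq> carrier A \<times> carrier B \<and> lin \<phi> x = 0}"
        by (rule scale_module.subspaceI) (simp_all add: keys_subset_add sk lin_add lin_scale)
    qed
  have ker: "scale_module.span ?R = {x \<in> carrier ?P. lin \<phi> x = \<zero>\<^bsub>?C\<^esub>}"
  proof (intro equalityI subsetI)
    fix x assume "x \<in> scale_module.span ?R"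
    with subr have "x \<in> {x. ks x \<subseteq> carrier A \<times> carrier B \<and> lin \<phi> x = 0}" by (rule subsetD)
    then show "x \<in> {x \<in> carrier ?P. lin \<phi> x = \<zero>\<^bsub>?C\<^esub>}" by simp
  next
    fix x assume "x \<in> {x \<in> carrier ?P. lin \<phi> x = \<zero>\<^bsub>?C\<^esub>}"
    then have x: "ks x \<subseteq> carrier A \<times> carrier B" "lin \<phi> x = 0" by simp_all
    from PD[OF x(1)] obtain r s where rs: "x = r + s" "r \<in> scale_module.span ?R" "s \<in> scale_module.span ?T"
      unfolding D_def scale_module.span_Un by blast
    have "scale_module.span ?T \<subseteq> {s. \<exists>d. ks d \<subseteq> I \<times> J \<and> s = lin (\<lambda>(i, j). t (iA i) (iB j)) d}"
      (is "_ \<subseteq> ?L")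
    proof (rule scale_module.span_minimal)
      show "?T \<subseteq> ?L"
      proof (rule image_subsetI)
        fix u assume "u \<in> I \<times> J"
        then show "(\<lambda>(i, j). t (iA i) (iB j)) u \<in> ?L"
          by (intro CollectI exI[of _ "single u 1"]) simp
      qed
      show "scale_module.subspace ?L"
      proof (rule scale_module.subspaceI)
        show "0 \<in> ?L" by (intro CollectI exI[of _ 0]) simp
      next
        fix x y assume "x \<in> ?L" "y \<in> ?L"
        then obtain d d' where "ks d \<subseteq> I \<times> J" "x = lin (\<lambda>(i, j). t (iA i) (iB j)) d"
          "ks d' \<subseteq> I \<times> J" "y = lin (\<lambda>(i, j). t (iA i) (iB j)) d'" by blast
        then show "x + y \<in> ?L" by (intro CollectI exI[of _ "d + d'"]) (simp add: keys_subset_add lin_add)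
      next
        fix c x assume "x \<in> ?L"
        then obtain d where "ks d \<subseteq> I \<times> J" "x = lin (\<lambda>(i, j). t (iA i) (iB j)) d" by blast
        then show "scale c x \<in> ?L"
          by (intro CollectI exI[of _ "scale c d"]) (simp add: order_trans[OF keys_scale_subset] lin_scale)
      qed
    qed
    with rs(3) obtain d where d: "ks d \<subseteq> I \<times> J" "s = lin (\<lambda>(i, j). t (iA i) (iB j)) d" by blast
    have "lin \<phi> r = 0" using subsetD[OF subr rs(2)] by simp
    then have "lin \<phi> s = 0" using x(2) rs(1) by (simp add: lin_add)
    moreover have "lin \<phi> s = lin (\<lambda>(i, j). bilin_ext mC (f (iA i)) (g (iB j))) d"
      unfolding d(2) lin_lin by (intro lin_cong) (simp add: split_beta t_def \<phi>_def)
    ultimately have "d = 0" using inj[OF d(1)] by simp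
    then show "x \<in> scale_module.span ?R" using rs d by simp
  qed
  have "carrier ?C \<subseteq> lin \<phi> ` carrier ?P"
  proof
    fix z assume "z \<in> carrier ?C"
    then obtain d where d: "ks d \<subseteq> I \<times> J" "lin (\<lambda>(i, j). bilin_ext mC (f (iA i)) (g (iB j))) d = z"
      using surj[of z] by auto
    let ?x = "lin (\<lambda>(i, j). t (iA i) (iB j)) d"
    have "lin \<phi> ?x = z"
      unfolding d(2)[symmetric] lin_lin by (intro lin_cong) (simp add: split_beta t_def \<phi>_def)
    moreover have "ks ?x \<subseteq> carrier A \<times> carrier B"
    proof (rule keys_subset_lin)
      fix u assume "u \<in> ks d"
      then have "fst u \<in> I" "snd u \<in> J" using d(1) by auto
      then show "ks ((\<lambda>(i, j). t (iA i) (iB j)) u) \<subseteq> carrier A \<times> carrier B"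
        by (simp add: split_beta t_def iA(1) iB(1))
    qed
    ultimately show "z \<in> lin \<phi> ` carrier ?P" by (intro image_eqI[of _ _ ?x]) simp_all
  qed
  note iso = P.quot_iso[OF C hom this ker]
  show ?thesis
    unfolding tensor_alg_def by (rule alg_iso_sym[OF P.quot_kalg[OF iso(1)] iso(2)])
qed

section \<open>Presented polynomial algebras\<close>

lemma poly_alg_simps [simp]:
  "carrier (poly_alg Y) = {f. ks f \<subseteq> {m. ks m \<subseteq> Y}}"
  "x \<otimes>\<^bsub>poly_alg Y\<^esub> y = x * y" "\<one>\<^bsub>poly_alg Y\<^esub> = 1" "\<zero>\<^bsub>poly_alg Y\<^esub> = 0"
  "x \<oplus>\<^bsub>poly_alg Y\<^esub> y = x + y" "c \<odot>\<^bsub>poly_alg Y\<^esub> x = scale c x"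
  by (auto simp: poly_alg_def)

lemma scale_mult: "scale c (f * g) = scale c f * (g :: ('v \<Rightarrow>\<^sub>0 nat) \<Rightarrow>\<^sub>0 'k::comm_ring_1)"
  unfolding scale_def mult_map_scale_conv_mult by (simp add: mult.assoc)

lemma poly_alg_kalg: "kalg (poly_alg Y :: ('k::comm_ring_1, ('v \<Rightarrow>\<^sub>0 nat) \<Rightarrow>\<^sub>0 'k) module)"
proof -
  let ?A = "poly_alg Y :: ('k, ('v \<Rightarrow>\<^sub>0 nat) \<Rightarrow>\<^sub>0 'k) module"
  have mult: "x * y \<in> carrier ?A" if "x \<in> carrier ?A" "y \<in> carrier ?A" for x y
  proof -
    have "ks m \<subseteq> Y" if "m \<in> ks (x * y)" for m
    proof -
      from that keys_mult[of x y] obtain a b where ab: "m = a + b" "a \<in> ks x" "b \<in> ks y" by blast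
      then have "ks a \<subseteq> Y" "ks b \<subseteq> Y" using \<open>x \<in> _\<close> \<open>y \<in> _\<close> by auto
      then show ?thesis unfolding ab(1) by (rule keys_subset_add)
    qed
    then show ?thesis by auto
  qed
  have add: "x + y \<in> carrier ?A" if "x \<in> carrier ?A" "y \<in> carrier ?A" for x y
    using that by (simp add: keys_subset_add)
  have "abelian_group ?A"
  proof (rule abelian_groupI)
    fix x assume "x \<in> carrier ?A"
    then show "\<exists>y\<in>carrier ?A. y \<oplus>\<^bsub>?A\<^esub> x = \<zero>\<^bsub>?A\<^esub>"
      by (intro bexI[of _ "- x"]) simp_all
  next
    fix x y assume "x \<in> carrier ?A" "y \<in> carrier ?A"
    then show "x \<oplus>\<^bsub>?A\<^esub> y \<in> carrier ?A" using add by simp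
  qed (simp_all add: add_ac)
  moreover have "comm_monoid ?A"
  proof (rule comm_monoidI)
    fix x y assume "x \<in> carrier ?A" "y \<in> carrier ?A"
    then show "x \<otimes>\<^bsub>?A\<^esub> y \<in> carrier ?A" using mult by simp
  qed (simp_all add: mult_ac)
  ultimately have "cring ?A"
    by (intro cringI) (simp_all add: distrib_right)
  moreover have "scale c x \<in> carrier ?A" if "x \<in> carrier ?A" for c x
    using that by (simp add: order_trans[OF keys_scale_subset])
  ultimately show ?thesis
    by (intro kalg.intro kalg_axioms.intro) (simp_all add: scale_add scale_mult)
qed

lemma pvar_power: "pvar z ^ n = single (single z n) (1 :: 'k::comm_ring_1)"
  by (induction n) (simp_all add: pvar_def mult_single single_add[symmetric])

lemma power_relation_single:
  "pvar z ^ p - scale c (pvar z) =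
    single (single z p) 1 - single (single z 1) (c :: 'k::comm_ring_1)"
  unfolding pvar_power by (simp add: pvar_def)

definition mon_eval :: "('k, 'c) module \<Rightarrow> ('v \<Rightarrow> 'c) \<Rightarrow> ('v \<Rightarrow>\<^sub>0 nat) \<Rightarrow> 'c" where
  "mon_eval A x m = finprod A (\<lambda>v. x v [^]\<^bsub>A\<^esub> lk m v) (ks m)"

context kalg begin

lemma mon_eval_superset:
  assumes "finite F" "ks m \<subseteq> F" "\<And>v. v \<in> F \<Longrightarrow> x v \<in> carrier A"
  shows "mon_eval A x m = finprod A (\<lambda>v. x v [^] lk m v) F"
  unfolding mon_eval_def
  by (rule finprod_mono_neutral_cong_left) (use assms in \<open>simp_all add: in_keys_iff Pi_iff\<close>)

lemma mon_eval_closed [simp]: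
  assumes "\<And>v. v \<in> ks m \<Longrightarrow> x v \<in> carrier A"
  shows "mon_eval A x m \<in> carrier A"
  unfolding mon_eval_def by (rule finprod_closed) (simp add: assms)

lemma mon_eval_add:
  assumes "\<And>v. v \<in> Y \<Longrightarrow> x v \<in> carrier A" "ks m \<subseteq> Y" "ks n \<subseteq> Y"
  shows "mon_eval A x (m + n) = mon_eval A x m \<otimes> mon_eval A x n"
proof -
  let ?F = "ks m \<union> ks n"
  have x: "x v \<in> carrier A" if "v \<in> ?F" for v using that assms by blast
  have "mon_eval A x (m + n) = finprod A (\<lambda>v. x v [^] lk (m + n) v) ?F"
    by (rule mon_eval_superset) (simp_all add: Poly_Mapping.keys_add x)
  also have "\<dots> = finprod A (\<lambda>v. x v [^] lk m v \<otimes> x v [^] lk n v) ?F"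
    by (rule finprod_cong') (simp_all add: x Pi_iff lookup_add nat_pow_mult)
  also have "\<dots> = finprod A (\<lambda>v. x v [^] lk m v) ?F \<otimes> finprod A (\<lambda>v. x v [^] lk n v) ?F"
    by (rule finprod_multf) (simp_all add: x Pi_iff)
  also have "\<dots> = mon_eval A x m \<otimes> mon_eval A x n"
    using mon_eval_superset[of ?F m x] mon_eval_superset[of ?F n x] x by simp
  finally show ?thesis .
qed

lemma mon_eval_zero [simp]: "mon_eval A x 0 = \<one>"
  by (simp add: mon_eval_def)

lemma mon_eval_single:
  assumes "x v \<in> carrier A"
  shows "mon_eval A x (single v n) = x v [^] n"
proof -
  have "mon_eval A x (single v n) = finprod A (\<lambda>u. x u [^] lk (single v n) u) {v}"
    by (rule mon_eval_superset) (simp_all add: assms)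
  also have "\<dots> = x v [^] n" using assms by simp
  finally show ?thesis .
qed

end

lemma lin_mon_eval_hom:
  fixes mC :: "'w \<Rightarrow> 'w \<Rightarrow> ('w \<Rightarrow>\<^sub>0 'k::comm_ring_1)"
  assumes C: "kalg (free_alg W mC e)" and x: "\<And>v. v \<in> Y \<Longrightarrow> ks (x v) \<subseteq> W"
  shows "lin (mon_eval (free_alg W mC e) x) \<in> alg_hom (poly_alg Y) (free_alg W mC e)"
proof -
  let ?C = "free_alg W mC e"
  interpret C: kalg ?C by fact
  let ?b = "mon_eval ?C x"
  have xC: "x v \<in> carrier ?C" if "v \<in> Y" for v using x[OF that] by simp
  have b: "ks (?b m) \<subseteq> W" if "ks m \<subseteq> Y" for m
    using C.mon_eval_closed[of m x] xC that by (simp add: subsetD)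
  have "lin ?b (f * g) = bilin_ext mC (lin ?b f) (lin ?b g)"
    if f: "f \<in> carrier (poly_alg Y)" and g: "g \<in> carrier (poly_alg Y)" for f g
  proof -
    have "ks f \<subseteq> {m. ks m \<subseteq> Y}" using f by simp
    then show ?thesis
    proof (induction f rule: keys_induct)
      case (add m c f)
      have "ks g \<subseteq> {m. ks m \<subseteq> Y}" using g by auto
      then have "lin ?b (single m c * g) = scale c (bilin_ext mC (?b m) (lin ?b g))"
      proof (induction g rule: keys_induct)
        case (add n d g)
        have "?b (m + n) = bilin_ext mC (?b m) (?b n)"
          using C.mon_eval_add[of Y x m n, OF xC] \<open>m \<in> _\<close> \<open>n \<in> _\<close> by simp
        with add.IH show ?case
          by (simp add: distrib_left mult_single lin_add bilin_ext_add_right bilin_ext_scale_right scale_add)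
      qed simp
      with add.IH show ?case
        by (simp add: distrib_right lin_add bilin_ext_add_left bilin_ext_scale_left)
    qed simp
  qed
  moreover have "lin ?b 1 = single e 1"
  proof -
    have "lin ?b (single 0 1) = single e 1"
      by (simp only: lin_single scale_one C.mon_eval_zero free_alg_simps)
    then show ?thesis by (simp only: single_one)
  qed
  moreover have "ks (lin ?b f) \<subseteq> W" if "f \<in> carrier (poly_alg Y)" for f
    using that by (intro keys_subset_lin b) auto
  ultimately show ?thesis
    unfolding alg_hom_def
    by (intro CollectI conjI ring_hom_memI allI ballI) (simp_all add: lin_add lin_scale)
qed

definition mdeg :: "('v \<Rightarrow>\<^sub>0 nat) \<Rightarrow> nat" where
  "mdeg m = (\<Sum>v\<in>ks m. lk m v)"

lemma mdeg_add: "mdeg (m + n) = mdeg m + mdeg n"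
  unfolding mdeg_def by (rule setsum_keys_plus_distrib) simp_all

lemma mdeg_single [simp]: "mdeg (single v n) = n"
  by (simp add: mdeg_def)

lemma lookup_le_split:
  fixes m :: "'v \<Rightarrow>\<^sub>0 nat"
  assumes "k \<le> lk m v"
  obtains m' where "m = m' + single v k" "ks m' \<subseteq> ks m"
proof
  show "m = (m - single v k) + single v k"
    using assms by (intro poly_mapping_eqI) (auto simp: lookup_add lookup_minus lookup_single when_def)
  show "ks (m - single v k) \<subseteq> ks m"
    by (intro subsetI) (simp add: in_keys_iff lookup_minus)
qed

text \<open>The monomials that represent a basis once a power \<open>z ^ p\<close> with \<open>z \<in> Z\<close> can be traded for
  a multiple of \<open>z\<close>.\<close>

definition reduced :: "nat \<Rightarrow> 'v set \<Rightarrow> 'v set \<Rightarrow> ('v \<Rightarrow>\<^sub>0 nat) set" where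
  "reduced p Y Z = {m. ks m \<subseteq> Y \<and> (\<forall>z \<in> Z. lk m z < p)}"

lemma poly_alg_minus:
  assumes "f \<in> carrier (poly_alg Y)" "g \<in> carrier (poly_alg Y)"
  shows "f \<ominus>\<^bsub>poly_alg Y\<^esub> g = f - g"
proof -
  interpret P: kalg "poly_alg Y" by (rule poly_alg_kalg)
  have "\<ominus>\<^bsub>poly_alg Y\<^esub> g = - g" using assms by (intro P.minus_equality) simp_all
  then show ?thesis by (simp add: a_minus_def)
qed

text \<open>Each use of a relation lowers the degree of a monomial since \<open>p \<ge> 2\<close>.\<close>

lemma reduce_mod_ideal:
  fixes cz :: "'v \<Rightarrow> 'k::comm_ring_1"
  assumes p: "2 \<le> p" and I: "ideal I (poly_alg Y)"
    and rel: "\<And>z. z \<in> Z \<Longrightarrow> pvar z ^ p - scale (cz z) (pvar z) \<in> I"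
    and f: "f \<in> carrier (poly_alg Y)"
  shows "\<exists>g. ks g \<subseteq> reduced p Y Z \<and> f - g \<in> I"
proof -
  interpret P: kalg "poly_alg Y :: ('k, _) module" by (rule poly_alg_kalg)
  interpret I: ideal I "poly_alg Y" by fact
  have I0: "0 \<in> I" using I.zero_closed by simp
  have Iadd: "x + y \<in> I" if "x \<in> I" "y \<in> I" for x y using I.a_closed[OF that] by simp
  have Iscale: "scale c x \<in> I" if "x \<in> I" for x c using P.smult_ideal[OF I that, of c] by simp
  have sdiff: "scale c (x - y) = scale c x - scale c y" for c and x y :: "('v \<Rightarrow>\<^sub>0 nat) \<Rightarrow>\<^sub>0 'k"
    by (rule scale_module.scale_right_diff_distrib)
  have mono: "\<exists>g. ks g \<subseteq> reduced p Y Z \<and> single m 1 - g \<in> I" if "ks m \<subseteq> Y" for m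
    using that
  proof (induction "mdeg m" arbitrary: m rule: less_induct)
    case less
    show ?case
    proof (cases "m \<in> reduced p Y Z")
      case True
      then show ?thesis using I0 by (intro exI[of _ "single m 1"]) simp
    next
      case False
      then obtain z where z: "z \<in> Z" "p \<le> lk m z" using less.prems by (auto simp: reduced_def not_less)
      from z(2) obtain m' where m': "m = m' + single z p" "ks m' \<subseteq> ks m"
        by (rule lookup_le_split)
      have zY: "z \<in> Y" using z p less.prems by (auto simp: in_keys_iff)
      let ?n = "m' + single z 1"
      have "ks ?n \<subseteq> Y" using m'(2) less.prems zY by (intro keys_subset_add) auto
      moreover have "mdeg ?n < mdeg m" using p by (simp add: m'(1) mdeg_add)
      ultimately obtain g where g: "ks g \<subseteq> reduced p Y Z" "single ?n 1 - g \<in> I"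
        using less.hyps by blast
      have "(single m' 1 :: _ \<Rightarrow>\<^sub>0 'k) \<in> carrier (poly_alg Y)" using m'(2) less.prems by simp
      from I.I_l_closed[OF rel[OF z(1)] this]
      have "single m 1 - scale (cz z) (single ?n 1) \<in> I"
        by (simp add: power_relation_single right_diff_distrib mult_single m'(1))
      from Iadd[OF this Iscale[OF g(2), of "cz z"]]
      have "single m 1 - scale (cz z) g \<in> I" by (simp add: sdiff)
      then show ?thesis
        by (intro exI[of _ "scale (cz z) g"] conjI order_trans[OF keys_scale_subset g(1)])
    qed
  qed
  have "ks f \<subseteq> {m. ks m \<subseteq> Y}" using f by auto
  then show ?thesis
  proof (induction f rule: keys_induct)
    case zero
    show ?case using I0 by (intro exI[of _ 0]) simp
  next
    case (add m c f)
    from add.IH obtain g where g: "ks g \<subseteq> reduced p Y Z" "f - g \<in> I" by (elim exE conjE)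
    from mono[of m] add.hyps obtain h where h: "ks h \<subseteq> reduced p Y Z" "single m 1 - h \<in> I"
      by auto
    have "scale c (single m 1 - h) + (f - g) \<in> I" by (intro Iadd Iscale h g)
    then have "(single m c + f) - (scale c h + g) \<in> I" by (simp add: sdiff algebra_simps)
    then show ?case
      by (intro exI[of _ "scale c h + g"] conjI keys_subset_add order_trans[OF keys_scale_subset h(1)] g)
  qed
qed

lemma reduced_carrier: "ks g \<subseteq> reduced p Y Z \<Longrightarrow> g \<in> carrier (poly_alg Y)"
  by (auto simp: reduced_def)

lemma quot_lspan_reduced:
  fixes cz :: "'v \<Rightarrow> 'k::comm_ring_1"
  assumes p: "2 \<le> p" and I: "ideal I (poly_alg Y)"
    and rel: "\<And>z. z \<in> Z \<Longrightarrow> pvar z ^ p - scale (cz z) (pvar z) \<in> I"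
  shows "carrier (quot_alg (poly_alg Y) I) \<subseteq>
    lspan (quot_alg (poly_alg Y) I) ((\<lambda>m. I +>\<^bsub>poly_alg Y\<^esub> single m 1) ` reduced p Y Z)"
    (is "_ \<subseteq> lspan ?Q ?B")
proof
  interpret P: kalg "poly_alg Y :: ('k, _) module" by (rule poly_alg_kalg)
  interpret I: ideal I "poly_alg Y" by fact
  fix U assume "U \<in> carrier ?Q"
  then obtain f where f: "f \<in> carrier (poly_alg Y)" "U = I +>\<^bsub>poly_alg Y\<^esub> f"
    unfolding P.quot_carrier by blast
  obtain g where g: "ks g \<subseteq> reduced p Y Z" "f - g \<in> I"
    using reduce_mod_ideal[OF p I rel f(1)] by blast
  have gc: "g \<in> carrier (poly_alg Y)" using g(1) by (rule reduced_carrier)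
  have "U = I +>\<^bsub>poly_alg Y\<^esub> g"
    unfolding f(2) using P.quotient_eq_iff_same_a_r_cos[OF I f(1) gc] poly_alg_minus[OF f(1) gc] g(2) by simp
  also have "I +>\<^bsub>poly_alg Y\<^esub> g \<in> lspan ?Q ?B"
    using g(1)
  proof (induction g rule: keys_induct)
    case zero
    have "I +>\<^bsub>poly_alg Y\<^esub> \<zero>\<^bsub>poly_alg Y\<^esub> = \<zero>\<^bsub>?Q\<^esub>"
      using P.a_rcos_zero[OF I I.zero_closed] by (simp add: quot_alg_simps)
    then show ?case using lspan.zero[of ?Q ?B] by simp
  next
    case (add m c g)
    let ?m = "single m 1 :: _ \<Rightarrow>\<^sub>0 'k"
    have m: "?m \<in> carrier (poly_alg Y)" using add.hyps by (intro reduced_carrier[of _ p Y Z]) simp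
    have gc: "g \<in> carrier (poly_alg Y)" using add.hyps(2) by (rule reduced_carrier)
    have "(c \<odot>\<^bsub>?Q\<^esub> (I +>\<^bsub>poly_alg Y\<^esub> ?m)) \<oplus>\<^bsub>?Q\<^esub> (I +>\<^bsub>poly_alg Y\<^esub> g) \<in> lspan ?Q ?B"
      using add by (intro lspan.add imageI)
    moreover have "(c \<odot>\<^bsub>?Q\<^esub> (I +>\<^bsub>poly_alg Y\<^esub> ?m)) \<oplus>\<^bsub>?Q\<^esub> (I +>\<^bsub>poly_alg Y\<^esub> g) =
        I +>\<^bsub>poly_alg Y\<^esub> (single m c + g)"
      using I.a_rcos_sum[OF P.smult_closed[OF m] gc, of c] by (simp add: P.quot_smult[OF I m] quot_alg_simps(3))
    ultimately show ?case by simp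
  qed
  finally show "U \<in> lspan ?Q ?B" .
qed

text \<open>The data of a presentation: relations \<open>z ^ p = cz z * z\<close> for \<open>z \<in> Z\<close>, and values \<open>x\<close> for the
  variables in an algebra where these relations hold.\<close>

locale power_relations =
  fixes p :: nat and Y Z :: "'v set" and cz :: "'v \<Rightarrow> 'k::comm_ring_1"
    and W mC and e :: 'w and x :: "'v \<Rightarrow> ('w \<Rightarrow>\<^sub>0 'k)" and I
  assumes p: "2 \<le> p" and ZY: "Z \<subseteq> Y"
    and C: "kalg (free_alg W mC e)"
    and x: "\<And>v. v \<in> Y \<Longrightarrow> ks (x v) \<subseteq> W"
    and x_rel: "\<And>z. z \<in> Z \<Longrightarrow> x z [^]\<^bsub>free_alg W mC e\<^esub> p = scale (cz z) (x z)"
  defines "I \<equiv> Idl\<^bsub>poly_alg Y\<^esub> {pvar z ^ p - scale (cz z) (pvar z) | z. z \<in> Z}"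
begin

abbreviation "ev \<equiv> lin (mon_eval (free_alg W mC e) x)"

lemma ev_hom: "ev \<in> alg_hom (poly_alg Y) (free_alg W mC e)"
  by (rule lin_mon_eval_hom[OF C x])

lemma gens: "{pvar z ^ p - scale (cz z) (pvar z) | z. z \<in> Z} \<subseteq> carrier (poly_alg Y)"
proof -
  have "pvar z ^ p - scale (cz z) (pvar z) \<in> carrier (poly_alg Y)" if "z \<in> Z" for z
  proof -
    have zY: "z \<in> Y" using that ZY by blast
    have "ks (single (single z p) 1 + - single (single z 1) (cz z))
      \<subseteq> {m. ks m \<subseteq> Y}"
      using zY p by (intro keys_subset_add) auto
    then have "ks (pvar z ^ p - scale (cz z) (pvar z)) \<subseteq> {m. ks m \<subseteq> Y}"
      unfolding power_relation_single by simp
    then show ?thesis by auto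
  qed
  then show ?thesis by blast
qed

lemma I_ideal: "ideal I (poly_alg Y)"
proof -
  interpret P: kalg "poly_alg Y :: ('k, _) module" by (rule poly_alg_kalg)
  show ?thesis unfolding I_def by (rule P.genideal_ideal[OF gens])
qed

lemma I_gen: "z \<in> Z \<Longrightarrow> pvar z ^ p - scale (cz z) (pvar z) \<in> I"
proof -
  interpret P: kalg "poly_alg Y :: ('k, _) module" by (rule poly_alg_kalg)
  show "z \<in> Z \<Longrightarrow> ?thesis" unfolding I_def by (rule subsetD[OF P.genideal_self[OF gens]]) blast
qed

lemma ev_I: "f \<in> I \<Longrightarrow> ev f = 0"
proof -
  interpret P: kalg "poly_alg Y :: ('k, _) module" by (rule poly_alg_kalg)
  interpret C: kalg "free_alg W mC e" by (rule C)
  interpret h: ring_hom_ring "poly_alg Y" "free_alg W mC e" ev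
    by (intro ring_hom_ringI2 alg_homD(1)[OF ev_hom]) unfold_locales
  let ?K = "a_kernel (poly_alg Y) (free_alg W mC e) ev"
  have "ev (pvar z ^ p - scale (cz z) (pvar z)) = 0" if "z \<in> Z" for z
  proof -
    have "x z \<in> carrier (free_alg W mC e)" using that ZY x by auto
    note mon = C.mon_eval_single[of x z, OF this]
    show ?thesis
      unfolding power_relation_single lin_diff lin_single mon
      using x_rel[OF that] C.nat_pow_eone[OF \<open>x z \<in> _\<close>] by (simp only: scale_one) simp
  qed
  then have "{pvar z ^ p - scale (cz z) (pvar z) | z. z \<in> Z} \<subseteq> ?K"
    using gens unfolding a_kernel_def' by auto
  then have "I \<subseteq> ?K"
    unfolding I_def by (intro P.genideal_minimal h.kernel_is_ideal)
  moreover assume "f \<in> I"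
  ultimately show "ev f = 0" unfolding a_kernel_def' by auto
qed

lemma quot_ev:
  "\<exists>f \<in> alg_hom (quot_alg (poly_alg Y) I) (free_alg W mC e).
     \<forall>g \<in> carrier (poly_alg Y). f (I +>\<^bsub>poly_alg Y\<^esub> g) = ev g"
proof -
  interpret P: kalg "poly_alg Y :: ('k, _) module" by (rule poly_alg_kalg)
  show ?thesis by (rule P.quot_hom[OF I_ideal C ev_hom]) (simp add: ev_I)
qed

lemma quot_kalg: "kalg (quot_alg (poly_alg Y) I)"
proof -
  interpret P: kalg "poly_alg Y :: ('k, _) module" by (rule poly_alg_kalg)
  show ?thesis by (rule P.quot_kalg[OF I_ideal])
qed

lemma reduced_coset_closed:
  "m \<in> reduced p Y Z \<Longrightarrow> I +>\<^bsub>poly_alg Y\<^esub> single m 1 \<in> carrier (quot_alg (poly_alg Y) I)"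
proof -
  assume m: "m \<in> reduced p Y Z"
  interpret P: kalg "poly_alg Y :: ('k, _) module" by (rule poly_alg_kalg)
  show ?thesis unfolding P.quot_carrier using m by (intro imageI reduced_carrier[of _ p Y Z]) simp
qed

lemma quot_mon_eval:
  "\<exists>f \<in> alg_hom (quot_alg (poly_alg Y) I) (free_alg W mC e). \<forall>m \<in> reduced p Y Z.
     f (I +>\<^bsub>poly_alg Y\<^esub> single m 1) = mon_eval (free_alg W mC e) x m"
proof -
  from quot_ev obtain f where f: "f \<in> alg_hom (quot_alg (poly_alg Y) I) (free_alg W mC e)"
    and "\<forall>g \<in> carrier (poly_alg Y). f (I +>\<^bsub>poly_alg Y\<^esub> g) = ev g" by (elim bexE)
  then have fx: "f (I +>\<^bsub>poly_alg Y\<^esub> g) = ev g" if "g \<in> carrier (poly_alg Y)" for g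
    using that by (elim bspec)
  have "f (I +>\<^bsub>poly_alg Y\<^esub> single m 1) = mon_eval (free_alg W mC e) x m"
    if "m \<in> reduced p Y Z" for m
  proof -
    have "single m 1 \<in> carrier (poly_alg Y)"
      using that by (intro reduced_carrier[of _ p Y Z]) simp
    from fx[OF this] show ?thesis by (simp only: lin_single scale_one)
  qed
  then show ?thesis using f by (intro bexI[of _ f] ballI)
qed

lemma quot_lspan:
  "carrier (quot_alg (poly_alg Y) I) \<subseteq>
    lspan (quot_alg (poly_alg Y) I) ((\<lambda>m. I +>\<^bsub>poly_alg Y\<^esub> single m 1) ` reduced p Y Z)"
  by (rule quot_lspan_reduced[OF p I_ideal I_gen])

lemma quot_iso_of_basis:
  assumes inj: "\<And>t. ks t \<subseteq> reduced p Y Z \<Longrightarrow> ev t = 0 \<Longrightarrow> t = 0"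
    and surj: "\<And>z. ks z \<subseteq> W \<Longrightarrow> \<exists>t. ks t \<subseteq> reduced p Y Z \<and> ev t = z"
  shows "quot_alg (poly_alg Y) I \<cong>\<^sub>a free_alg W mC e"
proof -
  interpret P: kalg "poly_alg Y :: ('k, _) module" by (rule poly_alg_kalg)
  interpret Id: ideal I "poly_alg Y" by (rule I_ideal)
  have "I = {f \<in> carrier (poly_alg Y). ev f = \<zero>\<^bsub>free_alg W mC e\<^esub>}"
  proof (intro equalityI subsetI)
    fix f assume "f \<in> I"
    then show "f \<in> {f \<in> carrier (poly_alg Y). ev f = \<zero>\<^bsub>free_alg W mC e\<^esub>}"
      using ev_I[of f] Id.a_subset by auto
  next
    fix f assume f: "f \<in> {f \<in> carrier (poly_alg Y). ev f = \<zero>\<^bsub>free_alg W mC e\<^esub>}"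
    then have "f \<in> carrier (poly_alg Y)" by blast
    then obtain g where g: "ks g \<subseteq> reduced p Y Z" "f - g \<in> I"
      using reduce_mod_ideal[OF p I_ideal I_gen] by blast
    have "ev g = 0" using f ev_I[OF g(2)] by (simp add: lin_diff)
    then show "f \<in> I" using inj[OF g(1)] g(2) by simp
  qed
  moreover have "carrier (free_alg W mC e) \<subseteq> ev ` carrier (poly_alg Y)"
  proof
    fix z assume "z \<in> carrier (free_alg W mC e)"
    then obtain t where t: "ks t \<subseteq> reduced p Y Z" "ev t = z" using surj[of z] by auto
    then show "z \<in> ev ` carrier (poly_alg Y)"
      using reduced_carrier[OF t(1)] by (intro image_eqI[of _ _ t]) simp_all
  qed
  ultimately show ?thesis by (intro P.quot_iso(2)[OF C ev_hom])
qed

end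

section \<open>Lyndon factorization\<close>

text \<open>Comparison of words by a mismatching letter; in contrast to the lexicographic order it is
  stable under appending arbitrary words on the right.\<close>

definition mismatch :: "'a rel \<Rightarrow> 'a list \<Rightarrow> 'a list \<Rightarrow> bool" where
  "mismatch r u v \<longleftrightarrow> (\<exists>q a b u' v'. u = q @ a # u' \<and> v = q @ b # v' \<and> (a, b) \<in> r)"

lemma mismatch_append: "mismatch r u v \<Longrightarrow> mismatch r (u @ x) (v @ y)"
  unfolding mismatch_def by (elim exE conjE) (intro exI conjI, simp_all)

lemma mismatch_prepend:
  assumes "mismatch r u v" shows "mismatch r (q @ u) (q @ v)"
proof -
  from assms obtain q' a b u' v' where "u = q' @ a # u'" "v = q' @ b # v'" "(a, b) \<in> r"
    unfolding mismatch_def by (elim exE conjE)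
  then show ?thesis unfolding mismatch_def
    by (intro exI[of _ "q @ q'"] exI[of _ a] exI[of _ b] exI[of _ u'] exI[of _ v']) simp
qed

lemma mismatch_lexord: "mismatch r u v \<Longrightarrow> (u, v) \<in> lexord r"
  unfolding mismatch_def by (elim exE conjE) (simp add: lexord_append_left_rightI)

lemma lexord_cases:
  assumes "(u, v) \<in> lexord r"
  obtains (prefix) z where "z \<noteq> []" "v = u @ z" | (mismatch) "mismatch r u v"
proof -
  from assms have "(\<exists>a v'. v = u @ a # v') \<or> mismatch r u v"
    unfolding lexord_def mismatch_def by blast
  then show thesis using prefix mismatch by blast
qed

lemma lexord_mismatch: "(u, v) \<in> lexord r \<Longrightarrow> length v \<le> length u \<Longrightarrow> mismatch r u v"
  by (erule lexord_cases) simp_all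

text \<open>The same interleaving of \<open>u\<close> with \<open>v\<close> works until \<open>u'\<close> falls behind \<open>u\<close>; from then on any
  shuffle does.\<close>

lemma lexord_shuffle_mono:
  assumes "(u', u) \<in> lexord r" "length u' = length u" "x \<in> shuffles u' v"
  shows "\<exists>y \<in> shuffles u v. (x, y) \<in> lexord r"
  using assms
proof (induction u v arbitrary: u' x rule: shuffles.induct)
  case (1 v)
  then show ?case by simp
next
  case (2 u)
  then show ?case by simp
next
  case (3 a u b v)
  from 3(4) obtain a' w where u': "u' = a' # w" "length w = length u" by (cases u') auto
  have lex: "(a', a) \<in> r \<or> a' = a \<and> (w, u) \<in> lexord r" using 3(3) u' by auto
  from 3(5) u' consider x' where "x = a' # x'" "x' \<in> shuffles w (b # v)"
    | x' where "x = b # x'" "x' \<in> shuffles u' v" by auto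
  then show ?case
  proof cases
    case 1
    show ?thesis
    proof (cases "(a', a) \<in> r")
      case True
      have "a # splice u (b # v) \<in> shuffles (a # u) (b # v)"
        by (intro Cons_in_shuffles_leftI splice_in_shuffles)
      moreover have "(x, a # splice u (b # v)) \<in> lexord r" using 1 True by simp
      ultimately show ?thesis by blast
    next
      case False
      with lex have "a' = a" "(w, u) \<in> lexord r" by auto
      with 3(1)[OF this(2) u'(2) 1(2)] obtain y where "y \<in> shuffles u (b # v)" "(x', y) \<in> lexord r" by blast
      then show ?thesis using 1 \<open>a' = a\<close>
        by (intro bexI[of _ "a # y"]) (auto intro: Cons_in_shuffles_leftI)
    qed
  next
    case 2
    from 3(2)[OF 3(3,4) 2(2)] obtain y where "y \<in> shuffles (a # u) v" "(x', y) \<in> lexord r" by blast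
    then show ?thesis using 2
      by (intro bexI[of _ "b # y"]) (auto intro: Cons_in_shuffles_rightI)
  qed
qed

text \<open>Multisets of words are written as exponent vectors, so that a word is described by the same kind
  of data as a monomial.\<close>

definition expo :: "'a list list \<Rightarrow> ('a list \<Rightarrow>\<^sub>0 nat)" where
  "expo ls = (\<Sum>l\<leftarrow>ls. single l 1)"

lemma expo_simps [simp]:
  "expo [] = 0" "expo (l # ls) = single l 1 + expo ls" "expo (ls @ ms) = expo ls + expo ms"
  by (simp_all add: expo_def)

lemma keys_add_nat: "ks (m + n) = ks m \<union> ks (n :: 'v \<Rightarrow>\<^sub>0 nat)"
  by (auto simp: in_keys_iff lookup_add)

lemma keys_expo [simp]: "ks (expo ls) = set ls"
  by (induction ls) (simp_all add: keys_add_nat)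

lemma expo_replicate [simp]: "expo (replicate k l) = single l k"
  by (induction k) (simp_all add: single_add[symmetric])

locale alphabet =
  fixes L :: "'a set" and r :: "'a rel"
  assumes trans_r: "trans r" and irrefl_r: "(a, a) \<notin> r"
    and total_r: "a \<in> L \<Longrightarrow> b \<in> L \<Longrightarrow> a = b \<or> (a, b) \<in> r \<or> (b, a) \<in> r"
begin

abbreviation lt (infix "\<lless>" 50) where "u \<lless> v \<equiv> (u, v) \<in> lexord r"
abbreviation le (infix "\<lless>=" 50) where "u \<lless>= v \<equiv> u = v \<or> u \<lless> v"

lemma lt_trans: "u \<lless> v \<Longrightarrow> v \<lless> w \<Longrightarrow> u \<lless> w"
  using lexord_trans trans_r by blast

lemma lt_irrefl: "\<not> u \<lless> u"
  using lexord_irreflexive irrefl_r by blast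

lemma lt_total: "u \<in> lists L \<Longrightarrow> v \<in> lists L \<Longrightarrow> u = v \<or> u \<lless> v \<or> v \<lless> u"
proof (induction u arbitrary: v)
  case Nil
  then show ?case by (cases v) auto
next
  case (Cons a u)
  then show ?case using total_r by (cases v) auto
qed

definition lyn :: "'a list set" where
  "lyn = {w \<in> lists L. w \<noteq> [] \<and> (\<forall>u v. w = u @ v \<and> u \<noteq> [] \<and> v \<noteq> [] \<longrightarrow> w \<lless> v)}"

lemma lynD: "w \<in> lyn \<Longrightarrow> w \<in> lists L" "w \<in> lyn \<Longrightarrow> w \<noteq> []"
  "u @ v \<in> lyn \<Longrightarrow> u \<noteq> [] \<Longrightarrow> v \<noteq> [] \<Longrightarrow> u @ v \<lless> v"
  by (auto simp: lyn_def)

lemma lyn_letter: "a \<in> L \<Longrightarrow> [a] \<in> lyn"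
  by (auto simp: lyn_def Cons_eq_append_conv)

lemma lyn_total: "u \<in> lyn \<Longrightarrow> v \<in> lyn \<Longrightarrow> \<not> u \<lless> v \<Longrightarrow> v \<lless>= u"
  using lt_total[of u v] lynD by blast

lemma le_trans: "u \<lless>= v \<Longrightarrow> v \<lless>= w \<Longrightarrow> u \<lless>= w"
  using lt_trans by blast

text \<open>A proper suffix of \<open>u\<close> exceeds \<open>u\<close> at a mismatching letter, which survives appending \<open>v\<close>; a suffix
  of \<open>v\<close> is at least \<open>v\<close>, which exceeds \<open>u @ v\<close>.\<close>

lemma lyn_append:
  assumes u: "u \<in> lyn" and v: "v \<in> lyn" and uv: "u \<lless> v"
  shows "u @ v \<in> lyn"
proof -
  have *: "u @ v \<lless> v" using uv
  proof (cases rule: lexord_cases)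
    case (prefix z)
    then have "v \<lless> z" using lynD(3)[of u z] v lynD(2)[OF u] by simp
    then have "u @ v \<lless> u @ z" by (rule lexord_append_leftI)
    then show ?thesis using prefix by simp
  next
    case mismatch
    then show ?thesis using mismatch_append[of r u v v "[]"] by (simp add: mismatch_lexord)
  qed
  have "u @ v \<lless> y" if e: "u @ v = x @ y" and xy: "x \<noteq> []" "y \<noteq> []" for x y
  proof -
    from e consider w where "u = x @ w" "y = w @ v" | w where "x = u @ w" "v = w @ y"
      by (auto simp: append_eq_append_conv2)
    then show ?thesis
    proof cases
      case 1
      show ?thesis
      proof (cases "w = []")
        case False
        then have "u \<lless> w" using lynD(3)[of x w] 1 xy u by simp
        then have "mismatch r u w" by (rule lexord_mismatch) (simp add: 1)
        then show ?thesis unfolding 1(2) by (intro mismatch_lexord mismatch_append)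
      qed (use * 1 in simp)
    next
      case 2
      show ?thesis
      proof (cases "w = []")
        case False
        then have "v \<lless> y" using lynD(3)[of w y] 2 xy v by simp
        then show ?thesis using * lt_trans by blast
      qed (use * 2 in simp)
    qed
  qed
  then show ?thesis using lynD(1,2)[OF u] lynD(1,2)[OF v] unfolding lyn_def by auto
qed

text \<open>The factorizations of the Chen-Fox-Lyndon theorem.\<close>

definition dec :: "'a list list \<Rightarrow> bool" where
  "dec ls \<longleftrightarrow> set ls \<subseteq> lyn \<and> sorted_wrt (\<lambda>x y. y \<lless>= x) ls"

lemma dec_Nil [simp]: "dec []" by (simp add: dec_def)

lemma dec_Cons: "dec (l # ls) \<longleftrightarrow> l \<in> lyn \<and> (\<forall>m \<in> set ls. m \<lless>= l) \<and> dec ls"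
  by (auto simp: dec_def)

lemma dec_append: "dec (ls @ ms) \<longleftrightarrow> dec ls \<and> dec ms \<and> (\<forall>l \<in> set ls. \<forall>m \<in> set ms. m \<lless>= l)"
  by (auto simp: dec_def sorted_wrt_append)

lemma dec_lyn: "dec ls \<Longrightarrow> l \<in> set ls \<Longrightarrow> l \<in> lyn"
  by (auto simp: dec_def)

lemma dec_replicate: "l \<in> lyn \<Longrightarrow> dec (replicate k l)"
  by (induction k) (auto simp: dec_Cons)

lemma dec_concat_lists: "dec ls \<Longrightarrow> concat ls \<in> lists L"
  by (induction ls) (auto simp: dec_Cons dest: lynD(1))

text \<open>A Lyndon word in front of a factorization absorbs the following factors as long as they are
  larger, since concatenation in increasing order stays Lyndon.\<close>

fun addl :: "'a list \<Rightarrow> 'a list list \<Rightarrow> 'a list list" where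
  "addl l [] = [l]"
| "addl l (m # ms) = (if l \<lless> m then addl (l @ m) ms else l # m # ms)"

lemma concat_addl: "concat (addl l ms) = l @ concat ms"
  by (induction l ms rule: addl.induct) auto

lemma dec_addl: "l \<in> lyn \<Longrightarrow> dec ms \<Longrightarrow> dec (addl l ms)"
proof (induction l ms rule: addl.induct)
  case (2 l m ms)
  show ?case
  proof (cases "l \<lless> m")
    case True
    then show ?thesis using 2 lyn_append[of l m] by (simp add: dec_Cons)
  next
    case False
    then have "m \<lless>= l" using 2 lyn_total by (simp add: dec_Cons)
    then have "x \<lless>= l" if "x \<in> set (m # ms)" for x
      using 2(3) that le_trans[of x m l] by (auto simp: dec_Cons)
    then show ?thesis using False 2 by (simp add: dec_Cons)
  qed
qed (simp add: dec_Cons)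

fun factors :: "'a list \<Rightarrow> 'a list list" where
  "factors [] = []"
| "factors (a # u) = addl [a] (factors u)"

lemma concat_factors [simp]: "concat (factors u) = u"
  by (induction u) (auto simp: concat_addl)

lemma dec_factors: "u \<in> lists L \<Longrightarrow> dec (factors u)"
  by (induction u) (auto simp: dec_addl lyn_letter)

lemma prefix_of_concat:
  assumes "z \<noteq> []" "concat ls = z @ y"
  shows "\<exists>z1 q m y'. z = z1 @ q \<and> q \<noteq> [] \<and> m \<in> set ls \<and> m = q @ y'"
  using assms
proof (induction ls arbitrary: z)
  case (Cons m ms)
  then have "m @ concat ms = z @ y" by simp
  then consider w where "m = z @ w" | w where "z = m @ w" "concat ms = w @ y"
    by (auto simp: append_eq_append_conv2)
  then show ?case
  proof cases
    case 1
    then show ?thesis using Cons.prems(1) by (intro exI[of _ "[]"] exI[of _ z] exI[of _ m] exI[of _ w]) simp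
  next
    case 2
    show ?thesis
    proof (cases "w = []")
      case True
      then show ?thesis using 2 Cons.prems(1)
        by (intro exI[of _ "[]"] exI[of _ m] exI[of _ m] exI[of _ "[]"]) simp
    next
      case False
      from Cons.IH[OF this 2(2)] obtain z1 q n y' where "w = z1 @ q" "q \<noteq> []" "n \<in> set ms" "n = q @ y'"
        by (elim exE conjE)
      then show ?thesis using 2(1)
        by (intro exI[of _ "m @ z1"] exI[of _ q] exI[of _ n] exI[of _ y']) simp
    qed
  qed
qed simp

text \<open>The factorization of a word into decreasing Lyndon words is unique because a longer first
  factor \<open>l'\<close> would have a proper suffix that is a prefix of a factor \<open>m \<lless>= l\<close>, hence would be
  smaller than \<open>l\<close>, its own proper prefix.\<close>

lemma first_factor_maximal:
  assumes l: "dec (l # ls)" and l': "dec (l' # ls')" and e: "l @ concat ls = l' @ concat ls'"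
  shows "\<not> length l < length l'"
proof
  assume "length l < length l'"
  with e obtain z where z: "l' = l @ z" "z \<noteq> []" "concat ls = z @ concat ls'"
    by (auto simp: append_eq_append_conv2)
  from prefix_of_concat[OF z(2,3)] obtain z1 q m y' where
    q: "z = z1 @ q" "q \<noteq> []" "m \<in> set ls" "m = q @ y'" by (elim exE conjE)
  have "l \<noteq> []" using l lynD(2) by (auto simp: dec_Cons)
  then have "l' \<lless> q" using lynD(3)[of "l @ z1" q] l' z q by (simp add: dec_Cons)
  moreover have "q \<lless>= m" using q(4) by (cases y') (simp_all add: lexord_append_rightI)
  moreover have "m \<lless>= l" using l q(3) by (simp add: dec_Cons)
  moreover have "l \<lless> l'" using z by (cases z) (simp_all add: lexord_append_rightI)
  ultimately have "l' \<lless> l'" using lt_trans[of l' q m] lt_trans[of l' m l] lt_trans[of l' l l'] by auto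
  then show False by (simp add: lt_irrefl)
qed

lemma dec_concat_unique: "dec ls \<Longrightarrow> dec ls' \<Longrightarrow> concat ls = concat ls' \<Longrightarrow> ls = ls'"
proof (induction ls arbitrary: ls')
  case Nil
  then show ?case using lynD(2) by (cases ls') (auto simp: dec_Cons)
next
  case (Cons l ls)
  have "ls' \<noteq> []" using Cons.prems lynD(2)[of l] by (auto simp: dec_Cons)
  then obtain l' ms where ls': "ls' = l' # ms" by (cases ls') auto
  have e: "l @ concat ls = l' @ concat ms" using Cons.prems(3) ls' by simp
  have d: "dec (l # ls)" "dec (l' # ms)" using Cons.prems ls' by simp_all
  have "length l = length l'"
    using first_factor_maximal[OF d e] first_factor_maximal[OF d(2,1) e[symmetric]] by simp
  with e have "l = l'" "concat ls = concat ms" by simp_all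
  moreover have "dec ls" "dec ms" using d by (simp_all add: dec_Cons)
  ultimately have "ls = ms" using Cons.IH[of ms] by blast
  with \<open>l = l'\<close> ls' show ?case by simp
qed

lemma factors_concat: "dec ls \<Longrightarrow> factors (concat ls) = ls"
  by (rule dec_concat_unique) (simp_all add: dec_factors dec_concat_lists)

text \<open>Insertion that keeps the factors decreasing. It shows that every multiset of Lyndon words is the
  multiset of factors of some word.\<close>

fun insd :: "'a list \<Rightarrow> 'a list list \<Rightarrow> 'a list list" where
  "insd l [] = [l]"
| "insd l (m # ms) = (if l \<lless> m then m # insd l ms else l # m # ms)"

lemma expo_insd: "expo (insd l ms) = single l 1 + expo ms"
  by (induction ms) (auto simp: add_ac)

lemma set_insd: "set (insd l ms) = insert l (set ms)"
  by (induction ms) auto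

lemma dec_insd: "l \<in> lyn \<Longrightarrow> dec ms \<Longrightarrow> dec (insd l ms)"
proof (induction ms)
  case (Cons m ms)
  show ?case
  proof (cases "l \<lless> m")
    case True
    then show ?thesis using Cons by (auto simp: dec_Cons set_insd)
  next
    case False
    then have "m \<lless>= l" using Cons lyn_total by (simp add: dec_Cons)
    then have "x \<lless>= l" if "x \<in> set (m # ms)" for x
      using Cons.prems(2) that le_trans[of x m l] by (auto simp: dec_Cons)
    then show ?thesis using False Cons by (simp add: dec_Cons)
  qed
qed (simp add: dec_Cons)

lemma dec_exists: "ks n \<subseteq> lyn \<Longrightarrow> \<exists>ls. dec ls \<and> expo ls = n"
proof (induction "mdeg n" arbitrary: n)
  case 0
  then have "n = 0" by (auto simp: mdeg_def intro!: poly_mapping_eqI simp: in_keys_iff)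
  then show ?case by (intro exI[of _ "[]"]) simp
next
  case (Suc k)
  then have "n \<noteq> 0" by (auto simp: mdeg_def)
  then obtain l where l: "l \<in> ks n" by (metis all_not_in_conv keys_eq_empty)
  then have "1 \<le> lk n l" by (simp add: in_keys_iff)
  then obtain n' where n': "n = n' + single l 1" "ks n' \<subseteq> ks n" by (rule lookup_le_split)
  have "k = mdeg n'" using Suc.hyps(2) n'(1) by (simp add: mdeg_add)
  then obtain ls where "dec ls" "expo ls = n'" using Suc.hyps(1)[of n'] Suc.prems n'(2) by auto
  then show ?case using l Suc.prems n'(1)
    by (intro exI[of _ "insd l ls"]) (auto simp: dec_insd expo_insd add_ac)
qed

lemma dec_head:
  assumes "dec ls" "y \<in> set ls" "\<And>x. x \<in> set ls \<Longrightarrow> x \<lless>= y"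
  obtains ls' where "ls = y # ls'"
proof (cases ls)
  case (Cons l ms)
  have "l \<lless>= y" using Cons assms by simp
  moreover have "y \<lless>= l" using assms(1,2) Cons by (auto simp: dec_Cons)
  ultimately have "l = y" using lt_trans lt_irrefl by blast
  then show ?thesis using that Cons by blast
qed (use assms in simp)

lemma dec_expo_unique: "dec ls \<Longrightarrow> dec ls' \<Longrightarrow> expo ls = expo ls' \<Longrightarrow> ls = ls'"
proof (induction ls arbitrary: ls')
  case Nil
  then have "set ls' = {}" by (metis keys_expo expo_simps(1) keys_zero)
  then show ?case by simp
next
  case (Cons l ls)
  have s: "set ls' = set (l # ls)" by (metis keys_expo Cons.prems(3))
  obtain ms where ms: "ls' = l # ms"
    by (rule dec_head[of ls' l]) (use Cons.prems s in \<open>auto simp: dec_Cons\<close>)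
  have "expo ls = expo ms" using Cons.prems(3) ms by simp
  moreover have "dec ls" "dec ms" using Cons.prems(1,2) ms by (simp_all add: dec_Cons)
  ultimately have "ls = ms" using Cons.IH[of ms] by blast
  with ms show ?case by simp
qed

definition arrange :: "('a list \<Rightarrow>\<^sub>0 nat) \<Rightarrow> 'a list list" where
  "arrange n = (SOME ls. dec ls \<and> expo ls = n)"

definition wrd :: "('a list \<Rightarrow>\<^sub>0 nat) \<Rightarrow> 'a list" where
  "wrd n = concat (arrange n)"

abbreviation fexpo :: "'a list \<Rightarrow> ('a list \<Rightarrow>\<^sub>0 nat)" where
  "fexpo u \<equiv> expo (factors u)"

lemma arrange: "ks n \<subseteq> lyn \<Longrightarrow> dec (arrange n)" "ks n \<subseteq> lyn \<Longrightarrow> expo (arrange n) = n"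
  using someI_ex[OF dec_exists] unfolding arrange_def by blast+

lemma arrange_expo: "dec ls \<Longrightarrow> arrange (expo ls) = ls"
proof -
  assume d: "dec ls"
  then have "ks (expo ls) \<subseteq> lyn" by (simp add: dec_def)
  then show ?thesis by (intro dec_expo_unique arrange d)
qed

lemma wrd_expo: "dec ls \<Longrightarrow> wrd (expo ls) = concat ls"
  by (simp add: wrd_def arrange_expo)

lemma wrd_fexpo: "u \<in> lists L \<Longrightarrow> wrd (fexpo u) = u"
  by (simp add: wrd_expo dec_factors)

lemma fexpo_wrd: "ks n \<subseteq> lyn \<Longrightarrow> fexpo (wrd n) = n"
  by (simp add: wrd_def factors_concat arrange)

lemma wrd_lists: "ks n \<subseteq> lyn \<Longrightarrow> wrd n \<in> lists L"
  unfolding wrd_def by (intro dec_concat_lists arrange)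

lemma fexpo_keys: "u \<in> lists L \<Longrightarrow> ks (fexpo u) \<subseteq> lyn"
  using dec_factors by (auto simp: dec_def)

lemma length_concat_expo: "length (concat ls) = (\<Sum>l\<in>ks (expo ls). lk (expo ls) l * length l)"
proof (induction ls)
  case (Cons l ls)
  have "(\<Sum>m\<in>ks (single l 1 + expo ls). lk (single l 1 + expo ls) m * length m) =
     (\<Sum>m\<in>ks (single l (1::nat)). lk (single l 1) m * length m) +
     (\<Sum>m\<in>ks (expo ls). lk (expo ls) m * length m)"
    by (rule setsum_keys_plus_distrib) (simp_all add: distrib_right)
  then show ?case using Cons by simp
qed simp

lemma length_wrd_add:
  assumes "ks m \<subseteq> lyn" "ks n \<subseteq> lyn"
  shows "length (wrd (m + n)) = length (wrd m) + length (wrd n)"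
proof -
  have l: "length (wrd m) = (\<Sum>l\<in>ks m. lk m l * length l)" if "ks m \<subseteq> lyn" for m
    unfolding wrd_def length_concat_expo arrange(2)[OF that] ..
  have "(\<Sum>l\<in>ks (m + n). lk (m + n) l * length l) =
    (\<Sum>l\<in>ks m. lk m l * length l) + (\<Sum>l\<in>ks n. lk n l * length l)"
    by (rule setsum_keys_plus_distrib) (simp_all add: distrib_right)
  then show ?thesis using l[OF assms(1)] l[OF assms(2)] l[of "m + n"] assms by (simp add: keys_add_nat)
qed

text \<open>Removing the first letter from a Lyndon word \<open>l\<close> leaves a word whose factors all exceed \<open>l\<close>,
  since the last of them, the smallest, is a proper suffix of \<open>l\<close>.\<close>

lemma factors_tail_greater:
  assumes "a # s \<in> lyn" "f \<in> set (factors s)"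
  shows "a # s \<lless> f"
proof -
  have s: "s \<in> lists L" using lynD(1)[OF assms(1)] by simp
  have ne: "factors s \<noteq> []" using assms(2) by auto
  have d: "dec (factors s)" using s by (rule dec_factors)
  have dl: "factors s = butlast (factors s) @ [last (factors s)]" using ne by simp
  have "s = concat (butlast (factors s)) @ last (factors s)"
    using arg_cong[OF dl, of concat] by simp
  moreover have "last (factors s) \<noteq> []" using ne d lynD(2) dec_lyn last_in_set by metis
  ultimately have "a # s \<lless> last (factors s)"
    using lynD(3)[of "a # concat (butlast (factors s))" "last (factors s)"] assms(1) by simp
  moreover have "last (factors s) \<lless>= f"
  proof -
    have "dec (butlast (factors s) @ [last (factors s)])" using d dl by simp
    moreover have "f \<in> set (butlast (factors s)) \<or> f = last (factors s)"
      using assms(2) by (subst (asm) dl) auto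
    ultimately show ?thesis by (auto simp: dec_append)
  qed
  ultimately show ?thesis using lt_trans by blast
qed

lemma factors_tail:
  assumes u: "a # u \<in> lists L" and f: "factors (a # u) = l # ls"
  obtains s where "l = a # s" "factors u = factors s @ ls" "\<And>f. f \<in> set (factors s) \<Longrightarrow> l \<lless> f"
    "dec (l # ls)"
proof -
  have d: "dec (l # ls)" using dec_factors[OF u] f by simp
  have c: "l @ concat ls = a # u" using concat_factors[of "a # u"] f by simp
  have "l \<in> lyn" using d by (simp add: dec_Cons)
  then have "l \<noteq> []" by (rule lynD(2))
  with c obtain s where s: "l = a # s" "u = s @ concat ls" by (cases l) auto
  have g: "l \<lless> f" if "f \<in> set (factors s)" for f
    using factors_tail_greater \<open>l \<in> lyn\<close> that s(1) by simp
  have "s \<in> lists L" using u s by simp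
  have "dec (factors s @ ls)"
    unfolding dec_append using dec_factors[OF \<open>s \<in> lists L\<close>] d g lt_trans by (auto simp: dec_Cons)
  then have "factors u = factors s @ ls" using factors_concat[of "factors s @ ls"] s(2) by simp
  then show thesis using that s(1) g d by blast
qed

text \<open>Since \<open>l \<lless> y\<close>, either \<open>q\<close> and \<open>y\<close> have a mismatch, or \<open>y = q @ t\<close>. Then comparing \<open>q @ y\<close> with
  \<open>y\<close> amounts to comparing the Lyndon word \<open>y\<close> with its proper suffix \<open>t\<close>.\<close>

lemma prefix_lyn_mismatch:
  assumes l: "l = q @ q2" and q: "q \<noteq> []" and y: "y \<in> lyn" and ly: "l \<lless> y"
  shows "mismatch r (q @ y) y"
proof -
  have pre: ?thesis if t: "y = q @ t" "t \<noteq> []" for t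
  proof -
    have "y \<lless> t" using lynD(3)[of q t] y t q by simp
    then have "mismatch r y t" by (rule lexord_mismatch) (simp add: t)
    then have "mismatch r (q @ y) (q @ t)" by (rule mismatch_prepend)
    then show ?thesis using t by simp
  qed
  show ?thesis using ly
  proof (cases rule: lexord_cases)
    case (prefix z)
    then show ?thesis using pre[of "q2 @ z"] l by simp
  next
    case mismatch
    then obtain w a b u' v' where w: "l = w @ a # u'" "y = w @ b # v'" "(a, b) \<in> r"
      unfolding mismatch_def by (elim exE conjE)
    from w(1) l have "q @ q2 = w @ a # u'" by simp
    then obtain us where "q = w @ us \<and> us @ q2 = a # u' \<or> q @ us = w"
      by (auto simp: append_eq_append_conv2)
    then consider t where "w = q @ t" | t where "q = w @ a # t"
      by (cases us) auto
    then show ?thesis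
    proof cases
      case 1
      then show ?thesis using pre[of "t @ b # v'"] w(2) by simp
    next
      case 2
      then have "mismatch r q y"
        unfolding mismatch_def using w by blast
      then show ?thesis using mismatch_append[of r q y y "[]"] by simp
    qed
  qed
qed

text \<open>The two lemmas below describe how the first letter of \<open>a # u\<close> relates to the word with the
  factors of \<open>a # u\<close> and \<open>N\<close>. If the first factor \<open>l\<close> of \<open>a # u\<close> is a largest factor overall,
  the merged word starts with \<open>l\<close>, and \<open>a\<close> can be split off.\<close>

lemma wrd_tail_eq:
  assumes u: "a # u \<in> lists L" and f: "factors (a # u) = l # ls"
    and N: "ks N \<subseteq> lyn" "\<And>y. y \<in> ks N \<Longrightarrow> y \<lless>= l"
  shows "a # wrd (fexpo u + N) = wrd (fexpo (a # u) + N)"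
proof -
  from u f obtain s where s: "l = a # s" "factors u = factors s @ ls"
    "\<And>f. f \<in> set (factors s) \<Longrightarrow> l \<lless> f" "dec (l # ls)" by (rule factors_tail) blast
  have sL: "s \<in> lists L" using s(1,4) lynD(1)[of l] by (simp add: dec_Cons)
  let ?M = "expo ls + N"
  have M: "ks ?M \<subseteq> lyn" using N s(4) by (auto simp: keys_add_nat dec_def)
  let ?ms = "arrange ?M"
  have le: "m \<lless>= l" if "m \<in> set ?ms" for m
  proof -
    have "m \<in> ks ?M" using that keys_expo[of ?ms] arrange(2)[OF M] by simp
    then show ?thesis using N s(4) by (auto simp: keys_add_nat dec_Cons)
  qed
  have "dec (factors s @ ?ms)"
    unfolding dec_append using dec_factors[OF sL] arrange(1)[OF M] le s(3) lt_trans by blast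
  moreover have "expo (factors s @ ?ms) = fexpo u + N"
    by (simp add: s(2) arrange(2)[OF M] add.assoc)
  ultimately have "wrd (fexpo u + N) = s @ concat ?ms"
    using wrd_expo[of "factors s @ ?ms"] by simp
  moreover have "dec (l # ?ms)" using arrange(1)[OF M] le s(4) by (auto simp: dec_Cons)
  moreover have "expo (l # ?ms) = fexpo (a # u) + N"
    unfolding f by (simp add: arrange(2)[OF M] add.assoc)
  ultimately have "wrd (fexpo u + N) = s @ concat ?ms" "wrd (fexpo (a # u) + N) = l @ concat ?ms"
    using wrd_expo[of "l # ?ms"] by (simp_all del: factors.simps)
  then show ?thesis using s(1) by simp
qed

text \<open>If instead \<open>N\<close> has a factor larger than \<open>l\<close>, the merged word starts with the largest factor \<open>y\<close>
  of all, whereas splitting off \<open>a\<close> would put a non-empty prefix of \<open>l\<close> in front of \<open>y\<close>.\<close>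

lemma wrd_tail_less:
  assumes u: "a # u \<in> lists L" and f: "factors (a # u) = l # ls"
    and N: "ks N \<subseteq> lyn" "y0 \<in> ks N" "l \<lless> y0"
  shows "mismatch r (a # wrd (fexpo u + N)) (wrd (fexpo (a # u) + N))"
proof -
  from u f obtain s where s: "l = a # s" "factors u = factors s @ ls"
    "\<And>f. f \<in> set (factors s) \<Longrightarrow> l \<lless> f" "dec (l # ls)" by (rule factors_tail) blast
  have sL: "s \<in> lists L" using s(1,4) lynD(1)[of l] by (simp add: dec_Cons)
  let ?M = "expo ls + N"
  have M: "ks ?M \<subseteq> lyn" using N s(4) by (auto simp: keys_add_nat dec_def)
  have setM: "set (arrange ?M) = ks ?M" using keys_expo[of "arrange ?M"] arrange(2)[OF M] by simp
  have "y0 \<in> set (arrange ?M)" using N(2) setM by (simp add: keys_add_nat)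
  then obtain y ms where yms: "arrange ?M = y # ms" by (cases "arrange ?M") auto
  have dy: "dec (y # ms)" using arrange(1)[OF M] yms by simp
  have yM: "x \<lless>= y" if "x \<in> ks ?M" for x using that setM yms dy by (auto simp: dec_Cons)
  have "y0 \<lless>= y" using yM N(2) by (simp add: keys_add_nat)
  then have ly: "l \<lless> y" using N(3) lt_trans by blast
  have y: "y \<in> lyn" using dy by (simp add: dec_Cons)
  have "y \<in> set (arrange ?M)" using yms by simp
  then have yK: "y \<in> ks ?M" by (simp only: setM)
  \<comment> \<open>The factors of \<open>s\<close> that stay in front of \<open>y\<close> spell a prefix of \<open>s\<close>.\<close>
  let ?P = "\<lambda>f. \<not> f \<lless> y"
  let ?fs = "takeWhile ?P (factors s)" and ?gs = "dropWhile ?P (factors s)"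
  have ds: "dec (?fs @ ?gs)" using dec_factors[OF sL] by simp
  have fs: "y \<lless>= x" if "x \<in> set ?fs" for x
  proof (rule lyn_total[OF _ y])
    show "x \<in> lyn" using ds that dec_lyn by (metis UnI1 set_append)
    show "\<not> x \<lless> y" using that set_takeWhileD by metis
  qed
  have gs: "x \<lless> y" if "x \<in> set ?gs" for x
  proof -
    from that obtain g gs where g: "?gs = g # gs" by (cases ?gs) auto
    then have "g \<lless> y" using hd_dropWhile[of ?P "factors s"] by simp
    moreover have "x \<lless>= g" using that g ds by (auto simp: dec_append dec_Cons)
    ultimately show ?thesis using lt_trans by blast
  qed
  let ?R = "expo ?gs + ?M"
  have "set ?gs \<subseteq> lyn"
    by (rule subsetI, rule dec_lyn[OF dec_factors[OF sL]], erule set_dropWhileD)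
  then have R: "ks ?R \<subseteq> lyn" using M by (simp add: keys_add_nat)
  have setR: "set (arrange ?R) = ks ?R" by (subst keys_expo[symmetric]) (simp only: arrange(2)[OF R])
  have Ry: "x \<lless>= y" if "x \<in> set (arrange ?R)" for x
  proof -
    from that have "x \<in> set ?gs \<or> x \<in> ks ?M" unfolding setR keys_add_nat keys_expo by blast
    then show ?thesis using gs[of x] yM[of x] by blast
  qed
  obtain rs where rs: "arrange ?R = y # rs"
  proof (rule dec_head[OF arrange(1)[OF R], of y])
    show "y \<in> set (arrange ?R)" using yK unfolding setR keys_add_nat by blast
  qed (rule Ry, assumption)
  have "dec (?fs @ arrange ?R)"
    unfolding dec_append
  proof (intro conjI ballI)
    show "dec ?fs" using ds unfolding dec_append by (elim conjE)
    show "dec (arrange ?R)" by (rule arrange(1)[OF R])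
    show "m \<lless>= x" if "x \<in> set ?fs" "m \<in> set (arrange ?R)" for x m
      using le_trans[OF Ry[OF that(2)] fs[OF that(1)]] .
  qed
  from wrd_expo[OF this] have w1: "wrd (fexpo u + N) = concat ?fs @ y @ concat rs"
  proof -
    have "expo ?fs + expo ?gs = fexpo s" using expo_simps(3)[of ?fs ?gs] by simp
    then have "expo (?fs @ arrange ?R) = fexpo u + N"
      unfolding expo_simps arrange(2)[OF R] s(2) by (simp only: add.assoc[symmetric])
    then show ?thesis using wrd_expo[OF \<open>dec (?fs @ arrange ?R)\<close>] rs by simp
  qed
  let ?U = "fexpo (a # u) + N"
  have Ue: "?U = single l 1 + ?M" unfolding f by (simp add: add_ac)
  have U: "ks ?U \<subseteq> lyn" unfolding Ue using M s(4) by (auto simp: keys_add_nat dec_Cons)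
  have "set (arrange ?U) = ks ?U" by (subst keys_expo[symmetric]) (simp only: arrange(2)[OF U])
  also have "\<dots> = ks (single l (1::nat)) \<union> ks ?M" unfolding Ue by (rule keys_add_nat)
  finally have setU: "set (arrange ?U) = ks (single l (1::nat)) \<union> ks ?M" .
  have Uy: "x \<lless>= y" if "x \<in> set (arrange ?U)" for x
  proof -
    from that have "x = l \<or> x \<in> ks ?M" unfolding setU by simp
    then show ?thesis using ly yM[of x] by blast
  qed
  obtain us where us: "arrange ?U = y # us"
  proof (rule dec_head[OF arrange(1)[OF U], of y])
    show "y \<in> set (arrange ?U)" using yK unfolding setU by (rule UnI2)
  qed (rule Uy, assumption)
  then have w2: "wrd ?U = y @ concat us" by (simp add: wrd_def)
  have "l = (a # concat ?fs) @ concat ?gs"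
    using concat_factors[of s] unfolding s(1) by (simp flip: concat_append del: concat_factors)
  then have "mismatch r ((a # concat ?fs) @ y) y"
    by (rule prefix_lyn_mismatch[OF _ _ y ly]) simp
  then have "mismatch r (((a # concat ?fs) @ y) @ concat rs) (y @ concat us)"
    by (rule mismatch_append)
  then show ?thesis unfolding w1 w2 by simp
qed

end

section \<open>The mixable shuffle algebra\<close>

lemma prepend_lin: "prepend a f = lin (\<lambda>w. single (a # w) 1) f"
  by (simp add: prepend_def lin_def)

lemma prepend_add: "prepend a (f + g) = prepend a f + prepend a g"
  and prepend_scale: "prepend a (scale c f) = scale c (prepend a f)"
  and prepend_zero [simp]: "prepend a 0 = 0"
  and prepend_single [simp]: "prepend a (single w c) = single (a # w) c"
  by (simp_all add: prepend_lin lin_add lin_scale)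

lemma lookup_prepend [simp]:
  "lk (prepend a f) [] = 0" "lk (prepend a f) (b # w) = (if a = b then lk f w else 0)"
proof -
  show "lk (prepend a f) [] = 0" by (simp add: prepend_lin lookup_lin lookup_single when_def)
  have "lk (prepend a f) (b # w) = (\<Sum>u\<in>ks f. if u = w then (if a = b then lk f u else 0) else 0)"
    unfolding prepend_lin lookup_lin by (intro sum.cong) (auto simp: lookup_single when_def)
  then show "lk (prepend a f) (b # w) = (if a = b then lk f w else 0)"
    by (simp add: in_keys_iff)
qed

lemma sum_prepend: "prepend a (sum f A) = (\<Sum>x\<in>A. prepend a (f x))"
  by (simp add: prepend_lin lin_sum)

lemma sum_bilin: "bilin_ext m (sum f A) g = (\<Sum>x\<in>A. bilin_ext m (f x) g)"
  by (simp add: bilin_ext_lin lin_sum)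

lemma keys_prepend: "ks (prepend a f) = (#) a ` ks f"
proof (rule Set.set_eqI)
  fix w show "w \<in> ks (prepend a f) \<longleftrightarrow> w \<in> (#) a ` ks f"
    by (cases w) (auto simp: in_keys_iff image_iff split: if_splits)
qed

lemma keys_prepend_lists: "a \<in> B \<Longrightarrow> ks f \<subseteq> lists B \<Longrightarrow> ks (prepend a f) \<subseteq> lists B"
  unfolding keys_prepend by (rule image_subsetI, rule lists.Cons, assumption, erule (1) subsetD)

abbreviation (input) word :: "'a list \<Rightarrow> ('a list \<Rightarrow>\<^sub>0 'k::comm_ring_1)" where
  "word w \<equiv> single w 1"

locale quasi_shuffle =
  fixes lam :: "'k::comm_ring_1" and S :: "'a ord_semigroup"
  assumes sg: "abelian_semigroup S"
begin

abbreviation ms where "ms \<equiv> mixable_shuffle lam S"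
abbreviation qsh (infixl "\<diamondop>" 70) where "f \<diamondop> g \<equiv> bilin_ext ms f g"
abbreviation "L \<equiv> carrier S"

lemma sg_closed: "a \<in> L \<Longrightarrow> b \<in> L \<Longrightarrow> sgmult S a b \<in> L"
  and sg_comm: "a \<in> L \<Longrightarrow> b \<in> L \<Longrightarrow> sgmult S a b = sgmult S b a"
  and sg_assoc: "a \<in> L \<Longrightarrow> b \<in> L \<Longrightarrow> c \<in> L \<Longrightarrow>
    sgmult S (sgmult S a b) c = sgmult S a (sgmult S b c)"
  using sg unfolding abelian_semigroup_def by blast+

lemma ms_Nil_right [simp]: "ms u [] = word u"
  by (cases u) simp_all

lemma qsh_Nil [simp]: "lin (ms []) f = f" "word [] \<diamondop> f = f" "f \<diamondop> word [] = f"
proof -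
  have "lin (ms []) f = lin word f" by (rule lin_cong) simp
  then show "lin (ms []) f = f" by simp
  then show "word [] \<diamondop> f = f" by simp
  have "lin (\<lambda>u. lin (ms u) (word [])) f = lin word f" by (rule lin_cong) simp
  then show "f \<diamondop> word [] = f" by (simp add: bilin_ext_lin)
qed

lemma qsh_prepend: "prepend a f \<diamondop> prepend b g =
    prepend a (f \<diamondop> prepend b g) + prepend b (prepend a f \<diamondop> g) +
    scale lam (prepend (sgmult S a b) (f \<diamondop> g))"
proof -
  have "ks f \<subseteq> UNIV" by simp
  then show ?thesis
  proof (induction f rule: keys_induct)
    case (add u c f)
    have "ks g \<subseteq> UNIV" by simp
    then have "word (a # u) \<diamondop> prepend b g =
        prepend a (word u \<diamondop> prepend b g) + prepend b (word (a # u) \<diamondop> g) +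
        scale lam (prepend (sgmult S a b) (word u \<diamondop> g))"
    proof (induction g rule: keys_induct)
      case (add v d g)
      have "word (a # u) \<diamondop> single (b # v) d =
        prepend a (word u \<diamondop> single (b # v) d) +
        prepend b (word (a # u) \<diamondop> single v d) +
        scale lam (prepend (sgmult S a b) (word u \<diamondop> single v d))"
        by (simp add: scale_add prepend_scale mult.commute)
      with add.IH show ?case
        unfolding prepend_add bilin_ext_add_right prepend_single scale_add by (simp add: algebra_simps)
    qed simp
    then have "scale c (word (a # u)) \<diamondop> prepend b g =
        prepend a (scale c (word u) \<diamondop> prepend b g) + prepend b (scale c (word (a # u)) \<diamondop> g) +
        scale lam (prepend (sgmult S a b) (scale c (word u) \<diamondop> g))"
      unfolding bilin_ext_scale_left prepend_scale by (simp add: scale_add mult.commute)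
    then have "single (a # u) c \<diamondop> prepend b g =
        prepend a (single u c \<diamondop> prepend b g) +
        prepend b (single (a # u) c \<diamondop> g) +
        scale lam (prepend (sgmult S a b) (single u c \<diamondop> g))"
      unfolding scale_single by (simp only: mult_1_right)
    with add.IH show ?case
      unfolding prepend_add bilin_ext_add_left prepend_single scale_add by (simp only: add_ac)
  qed simp
qed

lemma keys_ms_Cons:
  assumes "x \<in> ks (ms (a # u) (b # v))"
  obtains y where "x = a # y" "y \<in> ks (ms u (b # v))"
    | y where "x = b # y" "y \<in> ks (ms (a # u) v)"
    | y where "x = sgmult S a b # y" "y \<in> ks (ms u v)"
proof -
  let ?f = "prepend a (ms u (b # v))" and ?g = "prepend b (ms (a # u) v)"
    and ?h = "prepend (sgmult S a b) (ms u v)"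
  have "lk ?f x + lk ?g x + lam * lk ?h x \<noteq> 0"
    using assms by (simp add: in_keys_iff lookup_add)
  then have "lk ?f x \<noteq> 0 \<or> lk ?g x \<noteq> 0 \<or> lk ?h x \<noteq> 0" by (intro notI disjCI) simp
  then have "x \<in> (#) a ` ks (ms u (b # v)) \<or> x \<in> (#) b ` ks (ms (a # u) v) \<or>
      x \<in> (#) (sgmult S a b) ` ks (ms u v)"
    unfolding keys_prepend[symmetric] in_keys_iff .
  then show thesis by (elim disjE imageE) (rule that; assumption)+
qed

lemma keys_ms: "x \<in> ks (ms u v) \<Longrightarrow>
    length x < length u + length v \<or> x \<in> shuffles u v"
proof (induction "length u + length v" arbitrary: u v x rule: less_induct)
  case less
  show ?case
  proof (cases u; cases v)
    fix a u' b v' assume [simp]: "u = a # u'" "v = b # v'"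
    from less.prems have "x \<in> ks (ms (a # u') (b # v'))" by (simp only: \<open>u = _\<close> \<open>v = _\<close>)
    then show ?thesis
    proof (cases rule: keys_ms_Cons)
      case (1 y)
      then show ?thesis using less.hyps[of u' v y] by (auto intro: Cons_in_shuffles_leftI)
    next
      case (2 y)
      then show ?thesis using less.hyps[of u v' y] by (auto intro: Cons_in_shuffles_rightI)
    next
      case (3 y)
      then have "length y \<le> length u' + length v'"
        using less.hyps[of u' v' y] length_shuffles[of y u' v'] by fastforce
      then show ?thesis using 3 by simp
    qed
  qed (use less.prems in simp_all)
qed

lemma keys_ms_length: "x \<in> ks (ms u v) \<Longrightarrow> length x \<le> length u + length v"
  using keys_ms[of x u v] length_shuffles[of x u v] by linarith

lemma keys_ms_lists: "u \<in> lists L \<Longrightarrow> v \<in> lists L \<Longrightarrow> ks (ms u v) \<subseteq> lists L"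
proof (induction "length u + length v" arbitrary: u v rule: less_induct)
  case less
  show ?case
  proof (cases u; cases v)
    fix a u' b v' assume [simp]: "u = a # u'" "v = b # v'"
    have ab: "a \<in> L" "b \<in> L" "sgmult S a b \<in> L" using less.prems sg_closed by auto
    have "ks (ms u' (b # v')) \<subseteq> lists L" "ks (ms (a # u') v') \<subseteq> lists L" "ks (ms u' v') \<subseteq> lists L"
      using less by simp_all
    then have "ks (prepend a (ms u' (b # v'))) \<subseteq> lists L" "ks (prepend b (ms (a # u') v')) \<subseteq> lists L"
      "ks (prepend (sgmult S a b) (ms u' v')) \<subseteq> lists L"
      using ab by (simp_all only: keys_prepend_lists)
    then show ?thesis by (simp add: keys_subset_add order_trans[OF keys_scale_subset])
  qed (use less.prems in simp_all)
qed

lemma ms_comm: "u \<in> lists L \<Longrightarrow> v \<in> lists L \<Longrightarrow> ms u v = ms v u"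
proof (induction "length u + length v" arbitrary: u v rule: less_induct)
  case less
  show ?case
  proof (cases u; cases v)
    fix a u' b v' assume [simp]: "u = a # u'" "v = b # v'"
    have "ms u' (b # v') = ms (b # v') u'" "ms (a # u') v' = ms v' (a # u')" "ms u' v' = ms v' u'"
      using less by simp_all
    then show ?thesis using less.prems by (simp add: sg_comm add_ac)
  qed simp_all
qed

text \<open>Expanding both sides by first letters leaves seven products with fewer letters on each side,
  the weights \<open>lam\<close> and \<open>lam ^ 2\<close> counting contractions.\<close>

lemma qsh_assoc_step:
  assumes "a \<in> L" "b \<in> L" "c \<in> L"
    and "(U \<diamondop> prepend b V) \<diamondop> prepend c W = U \<diamondop> (prepend b V \<diamondop> prepend c W)"
    and "(prepend a U \<diamondop> V) \<diamondop> prepend c W = prepend a U \<diamondop> (V \<diamondop> prepend c W)"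
    and "(prepend a U \<diamondop> prepend b V) \<diamondop> W = prepend a U \<diamondop> (prepend b V \<diamondop> W)"
    and "(U \<diamondop> V) \<diamondop> prepend c W = U \<diamondop> (V \<diamondop> prepend c W)"
    and "(U \<diamondop> prepend b V) \<diamondop> W = U \<diamondop> (prepend b V \<diamondop> W)"
    and "(prepend a U \<diamondop> V) \<diamondop> W = prepend a U \<diamondop> (V \<diamondop> W)"
    and "(U \<diamondop> V) \<diamondop> W = U \<diamondop> (V \<diamondop> W)"
  shows "(prepend a U \<diamondop> prepend b V) \<diamondop> prepend c W = prepend a U \<diamondop> (prepend b V \<diamondop> prepend c W)"
proof -
  let ?A = "prepend a U" and ?B = "prepend b V" and ?C = "prepend c W"
  note lin_rules = bilin_ext_add_left bilin_ext_add_right bilin_ext_scale_left bilin_ext_scale_right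
    prepend_add prepend_scale scale_add
  have "(?A \<diamondop> ?B) \<diamondop> ?C =
    prepend a ((U \<diamondop> ?B) \<diamondop> ?C) + prepend b ((?A \<diamondop> V) \<diamondop> ?C) + prepend c ((?A \<diamondop> ?B) \<diamondop> W) +
    scale lam (prepend (sgmult S a c) ((U \<diamondop> ?B) \<diamondop> W) + prepend (sgmult S b c) ((?A \<diamondop> V) \<diamondop> W) +
      prepend (sgmult S a b) ((U \<diamondop> V) \<diamondop> ?C) +
      scale lam (prepend (sgmult S (sgmult S a b) c) ((U \<diamondop> V) \<diamondop> W)))"
    by (simp only: qsh_prepend lin_rules add_ac)
  moreover have "?A \<diamondop> (?B \<diamondop> ?C) =
    prepend a (U \<diamondop> (?B \<diamondop> ?C)) + prepend b (?A \<diamondop> (V \<diamondop> ?C)) + prepend c (?A \<diamondop> (?B \<diamondop> W)) +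
    scale lam (prepend (sgmult S a c) (U \<diamondop> (?B \<diamondop> W)) + prepend (sgmult S b c) (?A \<diamondop> (V \<diamondop> W)) +
      prepend (sgmult S a b) (U \<diamondop> (V \<diamondop> ?C)) +
      scale lam (prepend (sgmult S a (sgmult S b c)) (U \<diamondop> (V \<diamondop> W))))"
    by (simp only: qsh_prepend lin_rules add_ac)
  ultimately show ?thesis by (simp only: assms sg_assoc)
qed

lemma ms_assoc: "u \<in> lists L \<Longrightarrow> v \<in> lists L \<Longrightarrow> w \<in> lists L \<Longrightarrow>
    (word u \<diamondop> word v) \<diamondop> word w = word u \<diamondop> (word v \<diamondop> word w)"
proof (induction "length u + length v + length w" arbitrary: u v w rule: less_induct)
  case less
  show ?case
  proof (cases "u = [] \<or> v = [] \<or> w = []")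
    case True
    then show ?thesis by (elim disjE) (simp_all only: qsh_Nil)
  next
    case False
    then obtain a u' b v' c w' where [simp]: "u = a # u'" "v = b # v'" "w = c # w'"
      by (meson neq_Nil_conv)
    have "(prepend a (word u') \<diamondop> prepend b (word v')) \<diamondop> prepend c (word w') =
        prepend a (word u') \<diamondop> (prepend b (word v') \<diamondop> prepend c (word w'))"
      by (rule qsh_assoc_step; (unfold prepend_single)?; (rule less.hyps)?) (use less.prems in simp_all)
    then show ?thesis by (simp only: prepend_single \<open>u = _\<close> \<open>v = _\<close> \<open>w = _\<close>)
  qed
qed

abbreviation "M \<equiv> free_alg (lists L) ms [] :: ('k, 'a list \<Rightarrow>\<^sub>0 'k) module"

lemma MS_eq: "MS lam S = M"
  by (simp add: MS_def)

lemma MS_kalg: "kalg M"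
proof (rule free_alg_kalg)
  fix u v w assume "u \<in> lists L" "v \<in> lists L" "w \<in> lists L"
  then have "(word u \<diamondop> word v) \<diamondop> word w = word u \<diamondop> (word v \<diamondop> word w)" by (rule ms_assoc)
  then show "lin (\<lambda>x. ms x w) (ms u v) = lin (ms u) (ms v w)" by (simp add: bilin_ext_lin)
qed (simp_all add: keys_ms_lists ms_comm)

sublocale M: kalg M by (rule MS_kalg)

lemma prepend_closed: "a \<in> L \<Longrightarrow> f \<in> carrier M \<Longrightarrow> prepend a f \<in> carrier M"
  by (simp add: keys_prepend_lists)

lemma sgpow_closed: "a \<in> L \<Longrightarrow> (sgmult S a ^^ k) a \<in> L"
  by (induction k) (auto simp: sg_closed)

text \<open>Powers of \<open>a \<otimes> f\<close> grouped by the first letter of the resulting words: the first letter is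
  \<open>a ^ (k + 1)\<close> when exactly \<open>k + 1\<close> of the factors contribute to it. In characteristic \<open>p\<close> only
  \<open>k + 1 = p\<close> survives in the \<open>p\<close>-th power, which is how the Frobenius map becomes letterwise.\<close>

lemma prepend_power:
  assumes a: "a \<in> L" and f: "f \<in> carrier M"
  shows "prepend a f [^]\<^bsub>M\<^esub> Suc m =
    (\<Sum>k\<le>m. scale (of_nat (Suc m choose Suc k) * lam ^ k)
      (prepend ((sgmult S a ^^ k) a) (f [^]\<^bsub>M\<^esub> Suc k \<otimes>\<^bsub>M\<^esub> prepend a f [^]\<^bsub>M\<^esub> (m - k))))"
proof (induction m)
  case 0
  show ?case using M.r_one[OF f] M.l_one[OF f] M.l_one[OF prepend_closed[OF a f]] by simp
next
  case (Suc m)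
  let ?A = "prepend a f"
  let ?pw = "\<lambda>k. (sgmult S a ^^ k) a"
  have A: "?A \<in> carrier M" by (rule prepend_closed[OF a f])
  have fk: "f [^]\<^bsub>M\<^esub> k \<in> carrier M" for k :: nat by (rule M.nat_pow_closed[OF f])
  have Ak: "?A [^]\<^bsub>M\<^esub> k \<in> carrier M" for k :: nat by (rule M.nat_pow_closed[OF A])
  define T where "T k = prepend (?pw k) (f [^]\<^bsub>M\<^esub> Suc k \<otimes>\<^bsub>M\<^esub> ?A [^]\<^bsub>M\<^esub> (Suc m - k))" for k
  define c where "c k = of_nat (Suc m choose k) * lam ^ k" for k
  have step: "prepend (?pw k) (f [^]\<^bsub>M\<^esub> Suc k \<otimes>\<^bsub>M\<^esub> ?A [^]\<^bsub>M\<^esub> (m - k)) \<diamondop> ?A =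
      T k + prepend a (prepend (?pw k) (f [^]\<^bsub>M\<^esub> Suc k \<otimes>\<^bsub>M\<^esub> ?A [^]\<^bsub>M\<^esub> (m - k)) \<diamondop> f) +
      scale lam (T (Suc k))" if "k \<le> m" for k
  proof -
    let ?Y = "f [^]\<^bsub>M\<^esub> Suc k \<otimes>\<^bsub>M\<^esub> ?A [^]\<^bsub>M\<^esub> (m - k)"
    have "?Y \<otimes>\<^bsub>M\<^esub> ?A = f [^]\<^bsub>M\<^esub> Suc k \<otimes>\<^bsub>M\<^esub> (?A [^]\<^bsub>M\<^esub> (m - k) \<otimes>\<^bsub>M\<^esub> ?A)"
      by (rule M.m_assoc[OF fk Ak A])
    also have "?A [^]\<^bsub>M\<^esub> (m - k) \<otimes>\<^bsub>M\<^esub> ?A = ?A [^]\<^bsub>M\<^esub> (Suc m - k)"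
      using that by (simp add: Suc_diff_le)
    finally have 1: "prepend (?pw k) (?Y \<diamondop> ?A) = T k" by (simp add: T_def)
    have "?Y \<otimes>\<^bsub>M\<^esub> f = f [^]\<^bsub>M\<^esub> Suc (Suc k) \<otimes>\<^bsub>M\<^esub> ?A [^]\<^bsub>M\<^esub> (m - k)"
      using M.m_assoc[OF fk Ak f, of "Suc k" "m - k"] M.m_comm[OF Ak f, of "m - k"]
        M.m_assoc[OF fk f Ak, of "Suc k" "m - k"] M.nat_pow_Suc[of f "Suc k"] by (simp only:)
    moreover have "sgmult S (?pw k) a = ?pw (Suc k)"
      using sg_comm[OF sgpow_closed[OF a] a, of k] by simp
    ultimately have 2: "prepend (sgmult S (?pw k) a) (?Y \<diamondop> f) = T (Suc k)" by (simp add: T_def)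
    show ?thesis unfolding qsh_prepend[of "?pw k" ?Y a f] 1 2 ..
  qed
  have T0: "prepend a (?A [^]\<^bsub>M\<^esub> Suc m \<diamondop> f) = T 0"
    using M.m_comm[OF Ak f, of "Suc m"] M.l_one[OF f] by (simp add: T_def)
  have d: "of_nat (Suc m choose Suc k) * lam ^ k * lam = c (Suc k)" for k
    by (simp add: c_def mult_ac)
  define g where "g k = of_nat (Suc m choose Suc k) * lam ^ k" for k
  define Y where "Y k = f [^]\<^bsub>M\<^esub> Suc k \<otimes>\<^bsub>M\<^esub> ?A [^]\<^bsub>M\<^esub> (m - k)" for k
  have IH: "?A [^]\<^bsub>M\<^esub> Suc m = (\<Sum>k\<le>m. scale (g k) (prepend (?pw k) (Y k)))"
    unfolding Suc.IH g_def Y_def ..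
  have "?A [^]\<^bsub>M\<^esub> Suc (Suc m) = ?A [^]\<^bsub>M\<^esub> Suc m \<diamondop> ?A" by simp
  also have "\<dots> = (\<Sum>k\<le>m. scale (g k) (prepend (?pw k) (Y k) \<diamondop> ?A))"
    unfolding IH sum_bilin bilin_ext_scale_left ..
  also have "\<dots> = (\<Sum>k\<le>m. scale (g k) (T k) + scale (g k) (prepend a (prepend (?pw k) (Y k) \<diamondop> f)) +
      scale (c (Suc k)) (T (Suc k)))"
    by (rule sum.cong) (simp_all only: atMost_iff step[folded Y_def] scale_add scale_scale d[folded g_def])
  also have "\<dots> = (\<Sum>k\<le>m. scale (g k) (T k)) +
      prepend a (?A [^]\<^bsub>M\<^esub> Suc m \<diamondop> f) + (\<Sum>k\<le>m. scale (c (Suc k)) (T (Suc k)))"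
    unfolding IH sum_bilin sum_prepend bilin_ext_scale_left prepend_scale sum.distrib ..
  also have "(\<Sum>k\<le>m. scale (g k) (T k)) = (\<Sum>k\<le>m. scale (of_nat (Suc m choose Suc k) * lam ^ k) (T k))"
    unfolding g_def ..
  also have "(\<Sum>k\<le>m. scale (of_nat (Suc m choose Suc k) * lam ^ k) (T k)) =
      (\<Sum>k\<le>Suc m. scale (of_nat (Suc m choose Suc k) * lam ^ k) (T k))"
    by (simp add: binomial_eq_0)
  also have "\<dots> + prepend a (?A [^]\<^bsub>M\<^esub> Suc m \<diamondop> f) + (\<Sum>k\<le>m. scale (c (Suc k)) (T (Suc k))) =
      (\<Sum>k\<le>Suc m. scale (of_nat (Suc m choose Suc k) * lam ^ k) (T k)) + (\<Sum>k\<le>Suc m. scale (c k) (T k))"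
    unfolding T0 by (subst (2) sum.atMost_Suc_shift) (simp add: c_def add.assoc)
  also have "\<dots> = (\<Sum>k\<le>Suc m. scale (of_nat (Suc (Suc m) choose Suc k) * lam ^ k) (T k))"
    unfolding sum.distrib[symmetric] scale_add_left[symmetric] c_def
    by (intro sum.cong refl) (simp add: distrib_right add.commute)
  finally show ?case by (simp only: T_def)
qed

end

section \<open>The Frobenius map\<close>

lemma mod_ring_fermat:
  fixes x :: "'p::prime_card mod_ring"
  assumes "x \<noteq> 0" shows "x ^ (CARD('p) - 1) = 1"
proof -
  have p: "2 \<le> CARD('p)" using prime_card prime_ge_2_nat by blast
  have "x * inverse x = 1" using assms by (rule right_inverse)
  moreover have "inverse x = x ^ (CARD('p) - 2)" using assms by (simp add: inverse_mod_ring_def)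
  moreover have "CARD('p) - 1 = Suc (CARD('p) - 2)" using p by simp
  ultimately show ?thesis by simp
qed

lemma of_nat_mod_ring_eq_0: "(of_nat n :: 'p::prime_card mod_ring) = 0 \<longleftrightarrow> CARD('p) dvd n"
  by (simp add: of_nat_eq_0_iff_char_dvd)

lemma freshman_diff:
  fixes x y :: "('v \<Rightarrow>\<^sub>0 nat) \<Rightarrow>\<^sub>0 'p::prime_card mod_ring"
  shows "(x - y) ^ CARD('p) = x ^ CARD('p) - y ^ CARD('p)"
proof -
  have c: "CHAR(('v \<Rightarrow>\<^sub>0 nat) \<Rightarrow>\<^sub>0 'p mod_ring) = CARD('p)"
  proof (rule CHAR_eqI)
    show "of_nat CARD('p) = (0 :: ('v \<Rightarrow>\<^sub>0 nat) \<Rightarrow>\<^sub>0 'p mod_ring)"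
      unfolding single_of_nat[symmetric] by (simp add: of_nat_mod_ring_eq_0)
    fix n assume "of_nat n = (0 :: ('v \<Rightarrow>\<^sub>0 nat) \<Rightarrow>\<^sub>0 'p mod_ring)"
    then have "lk (of_nat n :: ('v \<Rightarrow>\<^sub>0 nat) \<Rightarrow>\<^sub>0 'p mod_ring) 0 = 0" by simp
    then have "(of_nat n :: 'p mod_ring) = 0" unfolding lookup_of_nat by simp
    then show "CARD('p) dvd n" by (simp only: of_nat_mod_ring_eq_0)
  qed
  have "((x - y) + y) ^ CARD('p) = (x - y) ^ CARD('p) + y ^ CARD('p)"
    by (rule freshmans_dream) (simp_all add: c prime_card)
  then show ?thesis by simp
qed

locale frobenius = quasi_shuffle lam S
  for lam :: "'p::prime_card mod_ring" and S :: "'a ord_semigroup" +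
  assumes lam: "lam \<noteq> 0"
begin

text \<open>The sum of \<open>prepend_power\<close> is reduced to its last term by the vanishing of binomial coefficients
  modulo \<open>p\<close>, and \<open>lam ^ (p - 1) = 1\<close>.\<close>

lemma word_frobenius:
  "w \<in> lists L \<Longrightarrow> word w [^]\<^bsub>M\<^esub> CARD('p) = word (word_pow CARD('p) S w)"
proof (induction w)
  case Nil
  show ?case using M.nat_pow_one[of "CARD('p)"] by (simp add: word_pow_def)
next
  case (Cons a w)
  have a: "a \<in> L" and w: "w \<in> lists L" using Cons.prems by auto
  have wM: "word w \<in> carrier M" using w by simp
  obtain m where m: "CARD('p) = Suc m" using prime_gt_0_nat[OF prime_card] by (metis gr0_conv_Suc)
  let ?t = "\<lambda>k. prepend ((sgmult S a ^^ k) a)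
    (word w [^]\<^bsub>M\<^esub> Suc k \<otimes>\<^bsub>M\<^esub> prepend a (word w) [^]\<^bsub>M\<^esub> (m - k))"
  have z: "of_nat (Suc m choose Suc k) = (0 :: 'p mod_ring)" if "k < m" for k
    unfolding of_nat_mod_ring_eq_0 m
    by (rule dvd_choose_prime) (use that prime_card[where 'a = 'p] m in auto)
  have "prepend a (word w) [^]\<^bsub>M\<^esub> Suc m =
      (\<Sum>k\<le>m. scale (of_nat (Suc m choose Suc k) * lam ^ k) (?t k))"
    by (rule prepend_power[OF a wM])
  also have "\<dots> = (\<Sum>k\<in>{m}. scale (of_nat (Suc m choose Suc k) * lam ^ k) (?t k))"
  proof (rule sum.mono_neutral_right)
    show "\<forall>k\<in>{..m} - {m}. scale (of_nat (Suc m choose Suc k) * lam ^ k) (?t k) = 0"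
    proof
      fix k assume "k \<in> {..m} - {m}"
      then have "k < m" by auto
      from z[OF this] show "scale (of_nat (Suc m choose Suc k) * lam ^ k) (?t k) = 0"
        by (simp only: mult_zero_left scale_zero)
    qed
  qed simp_all
  also have "\<dots> = ?t m"
    using mod_ring_fermat[OF lam] m by simp
  also have "\<dots> = prepend (sgpow S a (Suc m)) (word w [^]\<^bsub>M\<^esub> Suc m)"
    using M.r_one[OF M.nat_pow_closed[OF wM], of "Suc m"] by (simp add: sgpow_def)
  also have "\<dots> = word (word_pow (Suc m) S (a # w))"
    using Cons.IH[OF w] unfolding m by (simp add: word_pow_def)
  finally show ?case unfolding m by (simp only: prepend_single)
qed

lemma alg_hom_power:
  assumes "h \<in> alg_hom (poly_alg Y) M" "f \<in> carrier (poly_alg Y)"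
  shows "h (f ^ n) = h f [^]\<^bsub>M\<^esub> n \<and> f ^ n \<in> carrier (poly_alg Y)"
proof (induction n)
  case 0
  interpret P: kalg "poly_alg Y :: ('p mod_ring, _) module" by (rule poly_alg_kalg)
  show ?case using alg_homD(6)[OF assms(1)] P.one_closed by simp
next
  case (Suc n)
  interpret P: kalg "poly_alg Y :: ('p mod_ring, _) module" by (rule poly_alg_kalg)
  have "h (f ^ n * f) = h (f ^ n) \<otimes>\<^bsub>M\<^esub> h f"
    using alg_homD(4)[OF assms(1), of "f ^ n" f] Suc assms(2) by simp
  moreover have "f ^ n * f \<in> carrier (poly_alg Y)" using P.m_closed[of "f ^ n" f] Suc assms(2) by simp
  ultimately show ?case using Suc by (simp add: mult.commute)
qed

lemma frobenius_diff:
  assumes f: "f \<in> carrier M" and g: "g \<in> carrier M"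
  shows "(f - g) [^]\<^bsub>M\<^esub> CARD('p) = f [^]\<^bsub>M\<^esub> CARD('p) - g [^]\<^bsub>M\<^esub> CARD('p)"
proof -
  \<comment> \<open>The identity is transported from the polynomial ring in two variables.\<close>
  define x where "x b = (if b then f else g)" for b
  let ?h = "lin (mon_eval M x)"
  let ?X = "pvar True :: (bool \<Rightarrow>\<^sub>0 nat) \<Rightarrow>\<^sub>0 'p mod_ring" and ?Y = "pvar False :: (bool \<Rightarrow>\<^sub>0 nat) \<Rightarrow>\<^sub>0 'p mod_ring"
  have xM: "x b \<in> carrier M" for b using f g by (simp add: x_def)
  have h: "?h \<in> alg_hom (poly_alg UNIV) M"
    using xM by (intro lin_mon_eval_hom[OF MS_kalg]) simp
  have c: "F \<in> carrier (poly_alg UNIV)" for F :: "(bool \<Rightarrow>\<^sub>0 nat) \<Rightarrow>\<^sub>0 'p mod_ring" by simp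
  have v: "?h (pvar b) = x b" for b
  proof -
    have "?h (pvar b) = mon_eval M x (single b 1)" by (simp only: pvar_def lin_single scale_one)
    also have "\<dots> = x b [^]\<^bsub>M\<^esub> (1::nat)" by (rule M.mon_eval_single[of x b, OF xM])
    also have "\<dots> = x b" by (rule M.nat_pow_eone[OF xM])
    finally show ?thesis .
  qed
  have "(f - g) [^]\<^bsub>M\<^esub> CARD('p) = ?h ((?X - ?Y) ^ CARD('p))"
    using conjunct1[OF alg_hom_power[OF h c[of "?X - ?Y"]], of "CARD('p)"] by (simp add: lin_diff v x_def)
  also have "\<dots> = ?h (?X ^ CARD('p)) - ?h (?Y ^ CARD('p))"
    by (simp only: freshman_diff lin_diff)
  also have "\<dots> = f [^]\<^bsub>M\<^esub> CARD('p) - g [^]\<^bsub>M\<^esub> CARD('p)"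
    using alg_hom_power[OF h c[of ?X], of "CARD('p)"] alg_hom_power[OF h c[of ?Y], of "CARD('p)"]
    by (simp add: v x_def)
  finally show ?thesis .
qed

end

section \<open>Leading words of products\<close>

text \<open>The number of ways to interleave equal elements when two multisets are merged.\<close>

definition bin :: "('v \<Rightarrow>\<^sub>0 nat) \<Rightarrow> ('v \<Rightarrow>\<^sub>0 nat) \<Rightarrow> nat" where
  "bin m n = (\<Prod>x\<in>ks n. (lk m x + lk n x) choose lk n x)"

lemma bin_superset: "finite F \<Longrightarrow> ks n \<subseteq> F \<Longrightarrow> bin m n = (\<Prod>x\<in>F. (lk m x + lk n x) choose lk n x)"
  unfolding bin_def by (rule prod.mono_neutral_left) (auto simp: in_keys_iff)

lemma bin_sym: "bin m n = bin n m"
proof -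
  have "bin m n = (\<Prod>x\<in>ks m \<union> ks n. (lk m x + lk n x) choose lk n x)"
    by (rule bin_superset) auto
  also have "\<dots> = (\<Prod>x\<in>ks m \<union> ks n. (lk n x + lk m x) choose lk m x)"
    by (rule prod.cong) (simp_all add: binomial_symmetric[of "lk n _"] add.commute)
  also have "\<dots> = bin n m" by (rule bin_superset[symmetric]) auto
  finally show ?thesis .
qed

lemma bin_cong: "(\<And>x. x \<in> ks n \<Longrightarrow> lk m x = lk m' x) \<Longrightarrow> bin m n = bin m' n"
  unfolding bin_def by (rule prod.cong) simp_all

lemma bin_zero [simp]: "bin m 0 = 1" "bin 0 m = 1"
  using bin_sym[of 0 m] by (simp_all add: bin_def)

lemma bin_single: "bin m (single l k) = (lk m l + k) choose k"
proof -
  have "bin m (single l k) = (\<Prod>x\<in>{l}. (lk m x + lk (single l k) x) choose lk (single l k) x)"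
    by (rule bin_superset) auto
  then show ?thesis by simp
qed

text \<open>Pascal's rule at \<open>l\<close>, the binomial coefficients at all other elements being common factors.\<close>

lemma bin_pascal:
  "bin (m + single l 1) (n + single l 1) =
    bin m (n + single l 1) + bin (m + single l 1) n"
proof -
  let ?F = "insert l (ks n)" and ?l = "single l (1::nat)"
  let ?R = "\<Prod>x\<in>?F - {l}. (lk m x + lk n x) choose lk n x"
  have sub: "ks (n + ?l) \<subseteq> ?F" by (auto simp: keys_add_nat)
  have R: "(\<Prod>x\<in>?F - {l}. (lk m' x + lk n' x) choose lk n' x) = ?R"
    if "m' = m \<or> m' = m + ?l" "n' = n \<or> n' = n + ?l" for m' n'
    using that by (intro prod.cong) (auto simp: lookup_add lookup_single when_def)
  have e: "bin m' n' = ((lk m' l + lk n' l) choose lk n' l) * ?R"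
    if "m' = m \<or> m' = m + ?l" "n' = n \<or> n' = n + ?l" for m' n'
  proof -
    have "ks n' \<subseteq> ?F" using that sub by auto
    then have "bin m' n' = (\<Prod>x\<in>?F. (lk m' x + lk n' x) choose lk n' x)"
      by (intro bin_superset) simp_all
    also have "\<dots> = ((lk m' l + lk n' l) choose lk n' l) *
        (\<Prod>x\<in>?F - {l}. (lk m' x + lk n' x) choose lk n' x)"
      by (rule prod.remove) simp_all
    finally show ?thesis unfolding R[OF that] .
  qed
  have "bin (m + ?l) (n + ?l) = (lk (m + ?l) l + lk (n + ?l) l choose lk (n + ?l) l) * ?R"
    and "bin m (n + ?l) = (lk m l + lk (n + ?l) l choose lk (n + ?l) l) * ?R"
    and "bin (m + ?l) n = (lk (m + ?l) l + lk n l choose lk n l) * ?R"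
    by (rule e; simp)+
  then show ?thesis by (simp only: lookup_add lookup_single_eq) (simp add: distrib_right)
qed

locale ordered_quasi_shuffle = quasi_shuffle lam S
  for lam :: "'k::comm_ring_1" and S :: "'a ord_semigroup" +
  assumes wo: "well_order_on (carrier S) (sgle S)"
begin

sublocale alphabet "carrier S" "sgless S"
proof
  have lin: "linear_order_on L (sgle S)" using wo by (simp add: well_order_on_def)
  then have tr: "trans (sgle S)" and an: "antisym (sgle S)" and tot: "total_on L (sgle S)"
    by (simp_all add: order_on_defs)
  show "trans (sgless S)"
    unfolding sgless_def using tr an by (meson trans_diff_Id)
  show "(a, a) \<notin> sgless S" for a by (simp add: sgless_def)
  show "a = b \<or> (a, b) \<in> sgless S \<or> (b, a) \<in> sgless S" if "a \<in> L" "b \<in> L" for a b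
    using tot that by (auto simp: total_on_def sgless_def)
qed

abbreviation wlt (infix "\<lless>" 50) where "u \<lless> v \<equiv> (u, v) \<in> lexord (sgless S)"
abbreviation wle (infix "\<lless>=" 50) where "u \<lless>= v \<equiv> u = v \<or> u \<lless> v"

lemma wf_sgless: "wf (sgless S)"
  using wo by (simp add: well_order_on_def sgless_def)

abbreviation wless (infix "\<sqsubset>" 50) where "x \<sqsubset> y \<equiv> (x, y) \<in> lenlex (sgless S)"

lemma wless_iff: "x \<sqsubset> y \<longleftrightarrow> length x < length y \<or> length x = length y \<and> x \<lless> y"
  unfolding lenlex_conv by (auto simp: lexord_lex)

lemma wless_trans: "x \<sqsubset> y \<Longrightarrow> y \<sqsubset> z \<Longrightarrow> x \<sqsubset> z"
  using lt_trans by (auto simp: wless_iff)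

lemma wless_irrefl: "\<not> x \<sqsubset> x"
  by (simp add: wless_iff lt_irrefl)

lemma wless_total: "x \<in> lists L \<Longrightarrow> y \<in> lists L \<Longrightarrow> x = y \<or> x \<sqsubset> y \<or> y \<sqsubset> x"
  using lt_total[of x y] by (auto simp: wless_iff)

lemma lookup_prepend_length:
  assumes "\<And>x. x \<in> ks f \<Longrightarrow> length x = length Y \<Longrightarrow> x = Y \<or> x \<lless> Y"
    and "length Z = Suc (length Y)" and "a # Y = Z \<or> a # Y \<lless> Z"
  shows "lk (prepend a f) Z = (if a # Y = Z then lk f Y else 0)"
proof (cases "a # Y = Z")
  case False
  then have l: "a # Y \<lless> Z" using assms(3) by blast
  have "Z \<notin> ks (prepend a f)"
  proof
    assume "Z \<in> ks (prepend a f)"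
    then obtain x where x: "Z = a # x" "x \<in> ks f" unfolding keys_prepend by blast
    then have "length x = length Y" using assms(2) by simp
    then have "x = Y \<or> x \<lless> Y" using assms(1) x(2) by blast
    moreover have "Y \<lless> x" using l x(1) irrefl_r by simp
    ultimately show False using lt_irrefl lt_trans by blast
  qed
  then show ?thesis using False by (simp add: in_keys_iff)
qed auto

text \<open>The largest shuffle of two words is obtained by merging their Lyndon factors, and it arises
  once for every way of interleaving equal factors. The recursion of the product over first letters
  takes the letter from the word with the larger first factor, and for equal first factors its two
  branches are those of Pascal's rule.\<close>

lemma ms_leading:
  assumes "u \<in> lists L" "v \<in> lists L"
  shows "lk (ms u v) (wrd (fexpo u + fexpo v)) = of_nat (bin (fexpo u) (fexpo v)) \<and>
    (\<forall>x \<in> shuffles u v. x \<lless>= wrd (fexpo u + fexpo v))"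
  using assms
proof (induction "length u + length v" arbitrary: u v rule: less_induct)
  case less
  show ?case
  proof (cases "u = [] \<or> v = []")
    case True
    then show ?thesis using less.prems by (elim disjE) (simp_all add: wrd_fexpo)
  next
    case False
    then obtain a u' b v' where u: "u = a # u'" and v: "v = b # v'" by (meson neq_Nil_conv)
    have ul: "u' \<in> lists L" "a # u' \<in> lists L" and vl: "v' \<in> lists L" "b # v' \<in> lists L"
      using less.prems u v by auto
    define mu mv mu' mv' where "mu = fexpo u" and "mv = fexpo v" and "mu' = fexpo u'" and "mv' = fexpo v'"
    have kmu: "ks mu \<subseteq> lyn" and kmv: "ks mv \<subseteq> lyn" and kmu': "ks mu' \<subseteq> lyn" and kmv': "ks mv' \<subseteq> lyn"
      using fexpo_keys less.prems ul vl unfolding mu_def mv_def mu'_def mv'_def by simp_all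
    have lenm: "length (wrd mu) = length u" "length (wrd mv) = length v"
      "length (wrd mu') = length u'" "length (wrd mv') = length v'"
      using wrd_fexpo less.prems ul vl unfolding mu_def mv_def mu'_def mv'_def by simp_all
    define Z X1 X2 where "Z = wrd (mu + mv)" and "X1 = wrd (mu' + mv)" and "X2 = wrd (mu + mv')"
    have lX: "length Z = length u + length v" and lX1: "length X1 = length u' + length v"
      and lX2: "length X2 = length u + length v'"
      unfolding Z_def X1_def X2_def using length_wrd_add kmu kmv kmu' kmv' lenm by simp_all
    have IH1: "lk (ms u' v) X1 = of_nat (bin mu' mv)" "\<And>x. x \<in> shuffles u' v \<Longrightarrow> x \<lless>= X1"
      using less.hyps[of u' v] ul less.prems(2) unfolding X1_def mu'_def mv_def u by auto
    have IH2: "lk (ms u v') X2 = of_nat (bin mu mv')" "\<And>x. x \<in> shuffles u v' \<Longrightarrow> x \<lless>= X2"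
      using less.hyps[of u v'] vl less.prems(1) unfolding X2_def mu_def mv'_def v by auto
    obtain l ls where fu: "factors (a # u') = l # ls"
      using concat_factors[of "a # u'"]
      by (cases "factors (a # u')") (auto simp del: factors.simps concat_factors)
    obtain k ks' where fv: "factors (b # v') = k # ks'"
      using concat_factors[of "b # v'"]
      by (cases "factors (b # v')") (auto simp del: factors.simps concat_factors)
    obtain s where s0: "l = a # s" and s: "factors u' = factors s @ ls" "\<And>f. f \<in> set (factors s) \<Longrightarrow> l \<lless> f" "dec (l # ls)"
      using ul(2) fu by (rule factors_tail) blast
    obtain t where t0: "k = b # t" and t: "factors v' = factors t @ ks'" "\<And>f. f \<in> set (factors t) \<Longrightarrow> k \<lless> f" "dec (k # ks')"
      using vl(2) fv by (rule factors_tail) blast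
    have mu: "mu = expo ls + single l 1"
      unfolding mu_def u fu by (simp add: add.commute)
    have mv: "mv = expo ks' + single k 1"
      unfolding mv_def v fv by (simp add: add.commute)
    have mu': "mu' = fexpo s + expo ls" unfolding mu'_def s(1) by simp
    have mv': "mv' = fexpo t + expo ks'" unfolding mv'_def t(1) by simp
    have lek: "x \<lless>= l" if "x \<in> ks mu" for x
      using that s(3) unfolding mu keys_add_nat by (auto simp: dec_Cons)
    have kek: "x \<lless>= k" if "x \<in> ks mv" for x
      using that t(3) unfolding mv keys_add_nat by (auto simp: dec_Cons)
    have lmu: "l \<in> ks mu" and kmv_in: "k \<in> ks mv" unfolding mu mv keys_add_nat by simp_all
    have ll: "l \<in> lyn" "k \<in> lyn" using s(3) t(3) by (simp_all add: dec_Cons)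
    have A1: "a # X1 = Z" if "k \<lless>= l"
      unfolding X1_def Z_def mu'_def mu_def u
      by (rule wrd_tail_eq[OF ul(2) fu kmv]) (use that kek le_trans in blast)
    have B1: "a # X1 \<lless> Z" if "l \<lless> k"
      unfolding X1_def Z_def mu'_def mu_def u
      by (rule mismatch_lexord, rule wrd_tail_less[OF ul(2) fu kmv kmv_in that])
    have A2: "b # X2 = Z" if "l \<lless>= k"
      unfolding X2_def Z_def mv'_def mv_def v add.commute[of mu]
      by (rule wrd_tail_eq[OF vl(2) fv kmu]) (use that lek le_trans in blast)
    have B2: "b # X2 \<lless> Z" if "k \<lless> l"
      unfolding X2_def Z_def mv'_def mv_def v add.commute[of mu]
      by (rule mismatch_lexord, rule wrd_tail_less[OF vl(2) fv kmu lmu that])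
    have tot: "l = k \<or> l \<lless> k \<or> k \<lless> l" using ll lynD(1) lt_total by blast
    have AB: "a # X1 = Z \<or> a # X1 \<lless> Z" "b # X2 = Z \<or> b # X2 \<lless> Z"
      using tot A1 B1 A2 B2 by blast+
    have bound: "x \<lless>= Z" if x: "x \<in> shuffles u v" for x
    proof -
      from x u v consider y where "x = a # y" "y \<in> shuffles u' v" | y where "x = b # y" "y \<in> shuffles u v'"
        by auto
      then show ?thesis
      proof cases
        case (1 y)
        have "y \<lless>= X1" by (rule IH1(2)[OF 1(2)])
        then have "x \<lless>= a # X1" unfolding 1(1) by auto
        then show ?thesis using AB(1) lt_trans by blast
      next
        case (2 y)
        have "y \<lless>= X2" by (rule IH2(2)[OF 2(2)])
        then have "x \<lless>= b # X2" unfolding 2(1) by auto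
        then show ?thesis using AB(2) lt_trans by blast
      qed
    qed
    \<comment> \<open>Contracted terms are too short to contribute.\<close>
    have "Z \<notin> ks (prepend (sgmult S a b) (ms u' v'))"
      using keys_ms_length[of _ u' v'] lX u v unfolding keys_prepend by fastforce
    then have "lk (ms u v) Z = lk (prepend a (ms u' v)) Z + lk (prepend b (ms u v')) Z"
      by (simp add: u v lookup_add in_keys_iff)
    also have "lk (prepend a (ms u' v)) Z = (if a # X1 = Z then lk (ms u' v) X1 else 0)"
    proof (rule lookup_prepend_length[OF _ _ AB(1)])
      show "x = X1 \<or> x \<lless> X1" if "x \<in> ks (ms u' v)" "length x = length X1" for x
        using keys_ms[OF that(1)] that(2) lX1 IH1(2)[of x] by linarith
    qed (simp add: lX lX1 u)
    also have "lk (prepend b (ms u v')) Z = (if b # X2 = Z then lk (ms u v') X2 else 0)"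
    proof (rule lookup_prepend_length[OF _ _ AB(2)])
      show "x = X2 \<or> x \<lless> X2" if "x \<in> ks (ms u v')" "length x = length X2" for x
        using keys_ms[OF that(1)] that(2) lX2 IH2(2)[of x] by linarith
    qed (simp add: lX lX2 v)
    finally have lkX: "lk (ms u v) Z = (if a # X1 = Z then of_nat (bin mu' mv) else 0) +
        (if b # X2 = Z then of_nat (bin mu mv') else 0)"
      by (simp only: IH1(1) IH2(1))
    have sz: "lk (fexpo s) x = 0" if "x \<lless>= l" for x
    proof -
      have "x \<notin> set (factors s)" using s(2) that lt_trans lt_irrefl by blast
      then show ?thesis by (simp add: in_keys_iff[symmetric] flip: not_in_keys_iff_lookup_eq_zero)
    qed
    have tz: "lk (fexpo t) x = 0" if "x \<lless>= k" for x
    proof -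
      have "x \<notin> set (factors t)" using t(2) that lt_trans lt_irrefl by blast
      then show ?thesis by (simp add: in_keys_iff[symmetric] flip: not_in_keys_iff_lookup_eq_zero)
    qed
    have "lk (ms u v) Z = of_nat (bin mu mv)"
    proof -
      consider "l = k" | "l \<lless> k" | "k \<lless> l" using tot by blast
      then show ?thesis
      proof cases
        case 1
        have "bin mu' mv = bin (expo ls) mv"
          by (rule bin_cong) (use kek sz 1 in \<open>simp add: mu' lookup_add\<close>)
        moreover have "bin mu mv' = bin mu (expo ks')"
          unfolding bin_sym[of mu] by (rule bin_cong) (use lek tz 1 in \<open>simp add: mv' lookup_add\<close>)
        ultimately have "bin mu mv = bin mu' mv + bin mu mv'"
          using bin_pascal[of "expo ls" l "expo ks'"] mu mv 1 by simp
        then show ?thesis using lkX A1 A2 1 by simp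
      next
        case 2
        have "bin mu mv' = bin mu mv"
          unfolding bin_sym[of mu]
        proof (rule bin_cong)
          fix x assume "x \<in> ks mu"
          then have "x \<lless> k" using lek 2 lt_trans by blast
          moreover from this have "x \<noteq> k" using lt_irrefl by blast
          ultimately show "lk mv' x = lk mv x"
            using tz by (simp add: mv mv' lookup_add lookup_single when_def)
        qed
        moreover have "a # X1 \<noteq> Z" using B1[OF 2] lt_irrefl by blast
        ultimately show ?thesis using lkX A2 2 by simp
      next
        case 3
        have "bin mu' mv = bin mu mv"
        proof (rule bin_cong)
          fix x assume "x \<in> ks mv"
          then have "x \<lless> l" using kek 3 lt_trans by blast
          moreover from this have "x \<noteq> l" using lt_irrefl by blast
          ultimately show "lk mu' x = lk mu x"
            using sz by (simp add: mu mu' lookup_add lookup_single when_def)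
        qed
        moreover have "b # X2 \<noteq> Z" using B2[OF 3] lt_irrefl by blast
        ultimately show ?thesis using lkX A1 3 by simp
      qed
    qed
    with bound show ?thesis unfolding Z_def mu_def mv_def by blast
  qed
qed

end

section \<open>Carry-free expansions in base p\<close>

text \<open>The total exponent vector of a monomial \<open>m\<close> whose variable \<open>v\<close> stands for the exponent
  vector \<open>E v\<close>.\<close>

definition total_expo :: "('v \<Rightarrow> ('x \<Rightarrow>\<^sub>0 nat)) \<Rightarrow> ('v \<Rightarrow>\<^sub>0 nat) \<Rightarrow> ('x \<Rightarrow>\<^sub>0 nat)" where
  "total_expo E m = (\<Sum>v\<in>ks m. Poly_Mapping.map ((*) (lk m v)) (E v))"

lemma lookup_map_mult: "lk (Poly_Mapping.map ((*) k) f) x = (k::nat) * lk f x"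
  by transfer (auto simp: when_def)

lemma lookup_total_expo: "lk (total_expo E m) x = (\<Sum>v\<in>ks m. lk m v * lk (E v) x)"
  by (simp add: total_expo_def lookup_sum lookup_map_mult)

lemma total_expo_add: "total_expo E (m + n) = total_expo E m + total_expo E n"
proof -
  have "Poly_Mapping.map ((*) 0) (E v) = 0" for v
    by (rule poly_mapping_eqI) (simp only: lookup_map_mult lookup_zero mult_zero_left)
  moreover have "Poly_Mapping.map ((*) (a + b)) (E v) =
      Poly_Mapping.map ((*) a) (E v) + Poly_Mapping.map ((*) b) (E v)" for a b v
    by (rule poly_mapping_eqI) (simp only: lookup_map_mult lookup_add distrib_right)
  ultimately show ?thesis
    unfolding total_expo_def by (intro setsum_keys_plus_distrib)
qed

lemma total_expo_zero [simp]: "total_expo E 0 = 0"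
  by (simp add: total_expo_def)

lemma total_expo_single: "total_expo E (single v 1) = E v"
  by (auto intro!: poly_mapping_eqI simp: total_expo_def lookup_map_mult)

lemma keys_total_expo: "ks (total_expo E m) \<subseteq> (\<Union>v\<in>ks m. ks (E v))"
proof
  fix x assume "x \<in> ks (total_expo E m)"
  then have "(\<Sum>v\<in>ks m. lk m v * lk (E v) x) \<noteq> 0" by (simp add: in_keys_iff lookup_total_expo)
  then obtain v where "v \<in> ks m" "lk m v * lk (E v) x \<noteq> 0" by (meson sum.neutral)
  then show "x \<in> (\<Union>v\<in>ks m. ks (E v))" by (auto simp: in_keys_iff)
qed

lemma mdeg_eq_0: "mdeg m = 0 \<Longrightarrow> m = 0"
  by (auto simp: mdeg_def intro!: poly_mapping_eqI simp: in_keys_iff)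

text \<open>Greedy expansion: subtract the largest available power of \<open>p\<close>. No digit overflows because
  the digit of \<open>p ^ k\<close> is bounded by what remains.\<close>

lemma total_expo_surj:
  assumes p: "2 \<le> p"
    and powers: "\<And>x k. x \<in> ks n \<Longrightarrow> p ^ k \<le> lk n x \<Longrightarrow> \<exists>v\<in>V. E v = single x (p ^ k)"
  shows "\<exists>m \<in> reduced p V V. total_expo E m = n"
  using powers
proof (induction "mdeg n" arbitrary: n rule: less_induct)
  case less
  show ?case
  proof (cases "n = 0")
    case True
    then show ?thesis using p by (intro bexI[of _ 0]) (simp_all add: reduced_def)
  next
    case False
    then obtain x where x: "x \<in> ks n" by (metis all_not_in_conv keys_eq_empty)
    let ?P = "\<lambda>k. p ^ k \<le> lk n x"
    have bound: "k \<le> lk n x" if "?P k" for k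
      using that self_le_ge2_pow[OF p, of k] by linarith
    have P0: "?P 0" using x by (simp add: in_keys_iff Suc_leI)
    obtain k where k: "?P k" "\<And>j. ?P j \<Longrightarrow> j \<le> k"
      using Nat.ex_has_greatest_nat[of ?P 0 "lk n x"] P0 bound by blast
    have kmax: "lk n x < p ^ Suc k" using k(2)[of "Suc k"] by (meson not_less not_less_eq_eq order_refl)
    from less.prems[OF x k(1)] obtain v where v: "v \<in> V" "E v = single x (p ^ k)" by blast
    from k(1) obtain n' where n': "n = n' + single x (p ^ k)" "ks n' \<subseteq> ks n"
      by (rule lookup_le_split)
    have pk: "0 < p ^ k" using p by simp
    have "mdeg n' < mdeg n" using pk by (simp add: n'(1) mdeg_add)
    moreover have "\<exists>v\<in>V. E v = single y (p ^ j)" if "y \<in> ks n'" "p ^ j \<le> lk n' y" for y j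
      using that less.prems[of y j] n' by (auto simp: lookup_add)
    ultimately obtain m where m: "m \<in> reduced p V V" "total_expo E m = n'"
      using less.hyps[of n'] by blast
    have "lk m v * p ^ k \<le> lk n' x"
    proof -
      have "lk m v * lk (E v) x \<le> lk (total_expo E m) x"
      proof (cases "v \<in> ks m")
        case True
        then show ?thesis unfolding lookup_total_expo by (intro member_le_sum) simp_all
      qed (simp add: in_keys_iff)
      then show ?thesis by (simp add: v m(2))
    qed
    then have "(lk m v + 1) * p ^ k \<le> lk n x" by (simp add: n'(1) lookup_add)
    then have "(lk m v + 1) * p ^ k < p * p ^ k" using kmax by simp
    then have "lk m v + 1 < p" by (simp only: mult_less_cancel2)
    moreover have "lk m y < p" if "y \<in> V" for y using m(1) that by (simp add: reduced_def)
    ultimately have "m + single v 1 \<in> reduced p V V"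
      using m(1) v(1) by (auto simp: reduced_def keys_add_nat lookup_add lookup_single when_def)
    moreover have "total_expo E (m + single v 1) = n"
      unfolding total_expo_add total_expo_single m(2) v(2) n'(1) ..
    ultimately show ?thesis by blast
  qed
qed

lemma base_digit:
  fixes c :: "nat \<Rightarrow> nat"
  assumes c: "\<And>j. c j < p" and i: "i < K"
  shows "(\<Sum>j<K. c j * p ^ j) div p ^ i mod p = c i"
  using assms
proof (induction K arbitrary: c i)
  case (Suc K)
  have p: "0 < p" using Suc.prems(1)[of 0] by simp
  have e: "(\<Sum>j<Suc K. c j * p ^ j) = c 0 + p * (\<Sum>j<K. c (Suc j) * p ^ j)"
    unfolding sum.lessThan_Suc_shift sum_distrib_left by (simp add: mult_ac)
  show ?case
  proof (cases i)
    case 0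
    then show ?thesis using Suc.prems(1)[of 0] unfolding e by simp
  next
    case (Suc i')
    have "(\<Sum>j<Suc K. c j * p ^ j) div p = (\<Sum>j<K. c (Suc j) * p ^ j)"
      using Suc.prems(1)[of 0] p unfolding e by (simp add: div_add1_eq)
    then have "(\<Sum>j<Suc K. c j * p ^ j) div p ^ i = (\<Sum>j<K. c (Suc j) * p ^ j) div p ^ i'"
      unfolding Suc power_Suc div_mult2_eq by (simp only:)
    then show ?thesis using Suc.IH[of "\<lambda>j. c (Suc j)" i'] Suc.prems Suc by simp
  qed
qed simp

lemma prime_power_dvd_choose:
  assumes "Factorial_Ring.prime (p::nat)" "0 < k" "k < p ^ j"
  shows "p dvd (p ^ j choose k)"
proof (rule ccontr)
  assume "\<not> p dvd (p ^ j choose k)"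
  with assms(1) have "coprime p (p ^ j choose k)" by (rule prime_imp_coprime)
  then have "coprime (p ^ j) (p ^ j choose k)" by simp
  moreover have "p ^ j dvd k * (p ^ j choose k)"
    using times_binomial_minus1_eq[OF assms(2), of "p ^ j"] by simp
  ultimately have "p ^ j dvd k" by (simp add: coprime_dvd_mult_left_iff)
  then show False using assms by (simp add: dvd_imp_le leD)
qed

text \<open>The case of Lucas' theorem for binomial coefficients \<open>n choose p ^ j\<close>.\<close>

lemma choose_prime_power:
  fixes j :: nat
  defines "q \<equiv> CARD('p::prime_card) ^ j"
  shows "(of_nat (n choose q) :: 'p mod_ring) = of_nat (n div q)"
proof -
  have q: "0 < q" using prime_gt_0_nat[OF prime_card[where 'a = 'p]] by (simp add: q_def)
  have step: "(of_nat ((q + n) choose q) :: 'p mod_ring) = 1 + of_nat (n choose q)" for n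
  proof -
    have "(of_nat ((q + n) choose q) :: 'p mod_ring) =
        (\<Sum>k\<le>q. of_nat ((q choose k) * (n choose (q - k))))"
      by (simp only: vandermonde[symmetric] of_nat_sum)
    also have "\<dots> = (\<Sum>k\<in>{0, q}. of_nat ((q choose k) * (n choose (q - k))))"
    proof (rule sum.mono_neutral_right)
      show "\<forall>k\<in>{..q} - {0, q}. (of_nat ((q choose k) * (n choose (q - k))) :: 'p mod_ring) = 0"
      proof
        fix k assume "k \<in> {..q} - {0, q}"
        then have "CARD('p) dvd (q choose k)"
          unfolding q_def by (intro prime_power_dvd_choose[OF prime_card]) auto
        then show "(of_nat ((q choose k) * (n choose (q - k))) :: 'p mod_ring) = 0"
          unfolding of_nat_mod_ring_eq_0 by (rule dvd_trans) simp
      qed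
    qed auto
    also have "\<dots> = 1 + of_nat (n choose q)" using q by (simp add: add.commute)
    finally show ?thesis .
  qed
  show ?thesis
  proof (induction n rule: less_induct)
    case (less n)
    show ?case
    proof (cases "n < q")
      case True
      then show ?thesis by (simp add: binomial_eq_0)
    next
      case False
      then have n: "n = q + (n - q)" by simp
      have "(of_nat (n choose q) :: 'p mod_ring) = 1 + of_nat ((n - q) choose q)"
        using step[of "n - q"] n by simp
      also have "\<dots> = 1 + of_nat ((n - q) div q)" using less[of "n - q"] q False by simp
      also have "\<dots> = of_nat (Suc ((n - q) div q))" by simp
      also have "Suc ((n - q) div q) = n div q" using False q by (simp add: le_div_geq)
      finally show ?thesis .
    qed
  qed
qed

lemma reduced_mono:
  assumes "m \<in> reduced p Y Z" "ks m' \<subseteq> ks m" "\<And>v. lk m' v \<le> lk m v"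
  shows "m' \<in> reduced p Y Z"
proof -
  have "lk m' z < p" if "z \<in> Z" for z
    using assms(1) that le_less_trans[OF assms(3)[of z]] by (simp add: reduced_def)
  moreover have "ks m' \<subseteq> Y" using assms(1,2) by (auto simp: reduced_def)
  ultimately show ?thesis by (simp add: reduced_def)
qed

section \<open>Monomials in powers of Lyndon words form a basis\<close>

lemma lookup_outside: "ks f \<subseteq> B \<Longrightarrow> w \<notin> B \<Longrightarrow> lk f w = 0"
  by (auto simp: in_keys_iff)

context ordered_quasi_shuffle begin

text \<open>Leading term for the length-lexicographic order, which unlike the lexicographic order is
  well-founded, and in which the contracted words of a product never lead.\<close>

definition has_lead :: "('a list \<Rightarrow>\<^sub>0 'k) \<Rightarrow> 'a list \<Rightarrow> 'k \<Rightarrow> bool" where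
  "has_lead f w c \<longleftrightarrow> w \<in> lists L \<and> ks f \<subseteq> lists L \<and> lk f w = c \<and> (\<forall>x\<in>ks f. x = w \<or> x \<sqsubset> w)"

text \<open>Replacing a factor by a smaller word makes every word of the product smaller: a shorter factor
  gives shorter words, and a factor of equal length gives smaller shuffles.\<close>

lemma keys_ms_wless:
  assumes uv: "u \<in> lists L" "v \<in> lists L" and x: "x = u \<or> x \<sqsubset> u" and y: "y = v \<or> y \<sqsubset> v"
    and ne: "x \<noteq> u \<or> y \<noteq> v" and z: "z \<in> ks (ms x y)"
  shows "z \<sqsubset> wrd (fexpo u + fexpo v)"
proof -
  let ?Z = "wrd (fexpo u + fexpo v)"
  have lZ: "length ?Z = length u + length v"
    using length_wrd_add[OF fexpo_keys[OF uv(1)] fexpo_keys[OF uv(2)]] by (simp add: wrd_fexpo uv)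
  have lx: "length x \<le> length u" and ly: "length y \<le> length v"
    using x y by (auto simp: wless_iff)
  show ?thesis
  proof (cases "length z < length ?Z")
    case True
    then show ?thesis by (simp add: wless_iff)
  next
    case False
    then have eq: "length x = length u" "length y = length v" "length z = length x + length y"
      using lx ly lZ keys_ms_length[OF z] by auto
    then have sh: "z \<in> shuffles x y" using keys_ms[OF z] by auto
    have x': "x \<lless>= u" and y': "y \<lless>= v" using x y eq by (auto simp: wless_iff)
    obtain z1 where z1: "z1 \<in> shuffles u y" "z = z1 \<and> x = u \<or> z \<lless> z1"
    proof (cases "x = u")
      case True
      then show ?thesis using that[of z] sh by simp
    next
      case False
      with x' have "x \<lless> u" by simp
      from lexord_shuffle_mono[OF this eq(1) sh] show ?thesis using that by (elim bexE) simp
    qed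
    then have "z1 \<in> shuffles y u" by (simp add: shuffles_commutes)
    obtain z2 where z2: "z2 \<in> shuffles v u" "z1 = z2 \<and> y = v \<or> z1 \<lless> z2"
    proof (cases "y = v")
      case True
      then show ?thesis using that[of z1] \<open>z1 \<in> shuffles y u\<close> by simp
    next
      case False
      with y' have "y \<lless> v" by simp
      from lexord_shuffle_mono[OF this eq(2) \<open>z1 \<in> shuffles y u\<close>] show ?thesis
        using that by (elim bexE) simp
    qed
    have "z2 \<lless>= ?Z" using ms_leading[OF uv] z2(1) by (simp add: shuffles_commutes)
    moreover have "z \<lless> z2" using z1(2) z2(2) ne lt_trans by blast
    ultimately have "z \<lless> ?Z" using lt_trans by blast
    then show ?thesis using eq lZ by (simp add: wless_iff)
  qed
qed

lemma has_lead_mult: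
  assumes f: "has_lead f u c" and g: "has_lead g v d"
  shows "has_lead (f \<diamondop> g) (wrd (fexpo u + fexpo v)) (c * d * of_nat (bin (fexpo u) (fexpo v)))"
proof -
  let ?Z = "wrd (fexpo u + fexpo v)"
  have uv: "u \<in> lists L" "v \<in> lists L" using f g by (simp_all add: has_lead_def)
  have kf: "ks f \<subseteq> lists L" and kg: "ks g \<subseteq> lists L" using f g by (simp_all add: has_lead_def)
  \<comment> \<open>Only the product of the two leading terms reaches the leading word.\<close>
  define f0 g0 where "f0 = f - single u c" and "g0 = g - single v d"
  have f0: "x \<sqsubset> u" if "x \<in> ks f0" for x
  proof -
    have "x \<noteq> u" using that f by (auto simp: f0_def in_keys_iff lookup_minus has_lead_def)
    moreover from this have "x \<in> ks f" using that by (simp add: f0_def in_keys_iff lookup_minus lookup_single_not_eq)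
    ultimately show ?thesis using f by (auto simp: has_lead_def)
  qed
  have g0: "y \<sqsubset> v" if "y \<in> ks g0" for y
  proof -
    have "y \<noteq> v" using that g by (auto simp: g0_def in_keys_iff lookup_minus has_lead_def)
    moreover from this have "y \<in> ks g" using that by (simp add: g0_def in_keys_iff lookup_minus lookup_single_not_eq)
    ultimately show ?thesis using g by (auto simp: has_lead_def)
  qed
  let ?B = "{z. z \<sqsubset> ?Z}"
  have k1: "ks (f0 \<diamondop> g) \<subseteq> ?B"
  proof (rule keys_bilin_ext, rule subsetI)
    fix x y z assume "x \<in> ks f0" "y \<in> ks g" "z \<in> ks (ms x y)"
    then show "z \<in> ?B" using f0[of x] g keys_ms_wless[OF uv, of x y z] wless_irrefl
      by (auto simp: has_lead_def)
  qed
  have k2: "ks (single u c \<diamondop> g0) \<subseteq> ?B"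
  proof (rule keys_bilin_ext, rule subsetI)
    fix x y z assume "x \<in> ks (single u c)" "y \<in> ks g0" "z \<in> ks (ms x y)"
    then show "z \<in> ?B" using g0[of y] keys_ms_wless[OF uv, of x y z] wless_irrefl
      by (auto split: if_splits)
  qed
  have "f \<diamondop> g = f0 \<diamondop> g + single u c \<diamondop> g"
    by (simp only: f0_def bilin_ext_add_left[symmetric] diff_add_cancel)
  also have "single u c \<diamondop> g = single u c \<diamondop> g0 + single u c \<diamondop> single v d"
    by (simp only: g0_def bilin_ext_add_right[symmetric] diff_add_cancel)
  also have "single u c \<diamondop> single v d = scale (c * d) (ms u v)"
    by simp
  finally have e: "f \<diamondop> g = f0 \<diamondop> g + (single u c \<diamondop> g0 + scale (c * d) (ms u v))" .
  have nZ: "?Z \<notin> ?B" by (simp add: wless_irrefl)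
  have "lk (f0 \<diamondop> g) ?Z = 0" "lk (single u c \<diamondop> g0) ?Z = 0"
    by (rule lookup_outside[OF k1 nZ], rule lookup_outside[OF k2 nZ])
  then have coef: "lk (f \<diamondop> g) ?Z = c * d * of_nat (bin (fexpo u) (fexpo v))"
    unfolding e lookup_add lookup_scale using ms_leading[OF uv] by (simp only: add_0)
  have kB: "ks (f \<diamondop> g) \<subseteq> insert ?Z ?B"
    unfolding e
  proof (intro keys_subset_add)
    show "ks (scale (c * d) (ms u v)) \<subseteq> insert ?Z ?B"
    proof (rule order_trans[OF keys_scale_subset], rule subsetI)
      fix x assume x: "x \<in> ks (ms u v)"
      have lZ: "length ?Z = length u + length v"
        using length_wrd_add[OF fexpo_keys[OF uv(1)] fexpo_keys[OF uv(2)]] by (simp add: wrd_fexpo uv)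
      from keys_ms[OF x] show "x \<in> insert ?Z ?B"
      proof
        assume "x \<in> shuffles u v"
        then have "x = ?Z \<or> x \<lless> ?Z" "length x = length ?Z"
          using ms_leading[OF uv] lZ by (simp_all add: length_shuffles)
        then show ?thesis by (auto simp: wless_iff)
      qed (simp add: wless_iff lZ)
    qed
  qed (rule order_trans[OF k1] order_trans[OF k2], rule subset_insertI)+
  have kL: "ks (f \<diamondop> g) \<subseteq> lists L"
    using kf kg by (intro keys_bilin_ext keys_ms_lists) blast+
  have "?Z \<in> lists L"
    by (rule wrd_lists) (simp only: keys_add_nat Un_subset_iff fexpo_keys uv simp_thms)
  then show ?thesis unfolding has_lead_def using kL coef kB by (intro conjI ballI) auto
qed

lemma finite_wless_maximal:
  assumes "finite A" "A \<noteq> {}" "A \<subseteq> lists L"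
  shows "\<exists>w\<in>A. \<forall>x\<in>A. x = w \<or> x \<sqsubset> w"
  using assms
proof (induction A rule: finite_ne_induct)
  case (insert a A)
  then obtain w where w: "w \<in> A" "\<And>x. x \<in> A \<Longrightarrow> x = w \<or> x \<sqsubset> w" by blast
  have "a = w \<or> a \<sqsubset> w \<or> w \<sqsubset> a" using insert.prems w(1) by (intro wless_total) auto
  then show ?case
  proof (elim disjE)
    assume "w \<sqsubset> a"
    then have "x = a \<or> x \<sqsubset> a" if "x \<in> insert a A" for x
      using that w(2)[of x] wless_trans[of x w a] by auto
    then show ?thesis by blast
  qed (use w in \<open>auto intro!: bexI[of _ w]\<close>)
qed simp

lemma triangular_independent:
  fixes b :: "'i \<Rightarrow> ('a list \<Rightarrow>\<^sub>0 'k)"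
  assumes lead: "\<And>i. i \<in> K \<Longrightarrow> has_lead (b i) (ld i) (c i)"
    and c: "\<And>i d. i \<in> K \<Longrightarrow> d * c i = 0 \<Longrightarrow> d = 0"
    and inj: "inj_on ld K" and t: "ks t \<subseteq> K" and z: "lin b t = 0"
  shows "t = 0"
proof (rule ccontr)
  assume "t \<noteq> 0"
  have "ld i \<in> lists L" if "i \<in> ks t" for i
    using lead[OF subsetD[OF t that]] unfolding has_lead_def by (elim conjE)
  then have "ld ` ks t \<subseteq> lists L" by (rule image_subsetI)
  moreover have "ld ` ks t \<noteq> {}" using \<open>t \<noteq> 0\<close> by (simp add: keys_eq_empty)
  ultimately have "\<exists>w\<in>ld ` ks t. \<forall>x\<in>ld ` ks t. x = w \<or> x \<sqsubset> w"
    by (intro finite_wless_maximal[OF finite_imageI[OF finite_keys]])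
  then obtain w where w0: "w \<in> ld ` ks t" and "\<forall>x\<in>ld ` ks t. x = w \<or> x \<sqsubset> w"
    by (elim bexE)
  then have w: "x = w \<or> x \<sqsubset> w" if "x \<in> ld ` ks t" for x using that by (elim bspec)
  from w0 obtain i where i: "i \<in> ks t" "w = ld i" by (elim imageE)
  have other: "lk (b j) w = 0" if "j \<in> ks t - {i}" for j
  proof (rule ccontr)
    assume "lk (b j) w \<noteq> 0"
    then have "w \<in> ks (b j)" by (simp add: in_keys_iff)
    have jt: "j \<in> ks t" "j \<noteq> i" using that by simp_all
    have jK: "j \<in> K" "i \<in> K" using jt(1) i(1) t by (simp_all add: subsetD)
    have "w = ld j \<or> w \<sqsubset> ld j"
      using lead[OF jK(1)] \<open>w \<in> ks (b j)\<close> unfolding has_lead_def by (elim conjE bspec)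
    moreover have "ld j \<noteq> w" using inj_onD[OF inj _ jK] jt(2) unfolding i(2) by (intro notI) simp
    moreover have "ld j = w \<or> ld j \<sqsubset> w" using jt(1) by (intro w imageI)
    ultimately show False using wless_trans[of w "ld j" w] wless_irrefl[of w] by simp
  qed
  have "lk (lin b t) w = lk t i * lk (b i) w + (\<Sum>j\<in>ks t - {i}. lk t j * lk (b j) w)"
    unfolding lookup_lin by (rule sum.remove[OF finite_keys i(1)])
  also have "(\<Sum>j\<in>ks t - {i}. lk t j * lk (b j) w) = 0"
    by (rule sum.neutral) (simp add: other)
  also have "lk (b i) w = c i"
    using lead[OF subsetD[OF t i(1)]] unfolding has_lead_def i(2) by (elim conjE)
  finally have "lk t i * c i = 0" using z by simp
  then show False using c[of i "lk t i"] i(1) t by (auto simp: in_keys_iff)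
qed

lemma triangular_spanning:
  fixes b :: "'i \<Rightarrow> ('a list \<Rightarrow>\<^sub>0 'k)"
  assumes lead: "\<And>i. i \<in> K \<Longrightarrow> has_lead (b i) (ld i) (c i)"
    and c: "\<And>i. i \<in> K \<Longrightarrow> \<exists>d. d * c i = 1"
    and surj: "lists L \<subseteq> ld ` K" and z: "ks z \<subseteq> lists L"
  shows "\<exists>t. ks t \<subseteq> K \<and> lin b t = z"
proof -
  have comb: "\<exists>t. ks t \<subseteq> K \<and> lin b t = f"
    if "ks f \<subseteq> B" "\<And>w. w \<in> B \<Longrightarrow> \<exists>t. ks t \<subseteq> K \<and> lin b t = word w" for f B
    using that(1)
  proof (induction f rule: keys_induct)
    case zero
    show ?case by (intro exI[of _ 0]) simp
  next
    case (add w d f)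
    from add.IH obtain t where t: "ks t \<subseteq> K" "lin b t = f" by (elim exE conjE)
    from that(2)[OF add.hyps(1)] obtain s where s: "ks s \<subseteq> K" "lin b s = word w" by (elim exE conjE)
    have "lin b (scale d s + t) = single w d + f" by (simp add: lin_add lin_scale s t)
    moreover have "ks (scale d s + t) \<subseteq> K"
      using s t by (intro keys_subset_add order_trans[OF keys_scale_subset])
    ultimately show ?case by (intro exI[of _ "scale d s + t"] conjI)
  qed
  have "w \<in> lists L \<longrightarrow> (\<exists>t. ks t \<subseteq> K \<and> lin b t = word w)" for w
  proof (induction w rule: wf_induct[OF wf_lenlex[OF wf_sgless]])
    case (1 w)
    show ?case
    proof
      assume w: "w \<in> lists L"
      then obtain i where i: "i \<in> K" "w = ld i" using surj by blast
      from c[OF i(1)] obtain d where d: "d * c i = 1" by blast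
      define f where "f = b i - single w (c i)"
      have "ks f \<subseteq> {x. x \<sqsubset> w \<and> x \<in> lists L}"
      proof
        fix x assume x: "x \<in> ks f"
        have "x \<noteq> w" using x lead[OF i(1)] i(2) by (auto simp: f_def in_keys_iff lookup_minus has_lead_def)
        moreover from this have "x \<in> ks (b i)" using x by (simp add: f_def in_keys_iff lookup_minus lookup_single_not_eq)
        ultimately show "x \<in> {x. x \<sqsubset> w \<and> x \<in> lists L}" using lead[OF i(1)] i(2) by (auto simp: has_lead_def)
      qed
      moreover have "\<exists>t. ks t \<subseteq> K \<and> lin b t = word x" if "x \<in> {x. x \<sqsubset> w \<and> x \<in> lists L}" for x
        using 1 that by blast
      ultimately obtain t where t: "ks t \<subseteq> K" "lin b t = f"
        using comb[of f "{x. x \<sqsubset> w \<and> x \<in> lists L}"] by blast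
      have "lin b (single i 1 - t) = single w (c i)"
        by (simp add: lin_diff t(2) f_def)
      then have "lin b (scale d (single i 1 + - t)) = word w"
        by (simp add: lin_scale d)
      moreover have "ks (scale d (single i 1 + - t)) \<subseteq> K"
        by (intro order_trans[OF keys_scale_subset] keys_subset_add) (use i t in simp_all)
      ultimately show "\<exists>t. ks t \<subseteq> K \<and> lin b t = word w"
        by (intro exI[of _ "scale d (single i 1 + - t)"] conjI)
    qed
  qed
  then show ?thesis using comb[OF z] by blast
qed

lemma factors_word_rep: "l \<in> lyn \<Longrightarrow> factors (word_rep l k) = replicate k l"
  unfolding word_rep_def by (rule factors_concat) (rule dec_replicate)

lemma fexpo_word_rep: "l \<in> lyn \<Longrightarrow> fexpo (word_rep l k) = single l k"
  by (simp add: factors_word_rep)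

lemma word_rep_lists: "l \<in> lists L \<Longrightarrow> word_rep l k \<in> lists L"
  unfolding word_rep_def by (induction k) auto

lemma length_word_rep [simp]: "length (word_rep l k) = k * length l"
  unfolding word_rep_def by (induction k) auto

end

locale mixable = frobenius lam S + ordered_quasi_shuffle lam S
  for lam :: "'p::prime_card mod_ring" and S :: "'a ord_semigroup" +
  fixes p :: nat
  assumes p_card: "p = CARD('p)"
begin

abbreviation "TL \<equiv> Tw p lyn"

lemma p_ge_2: "2 \<le> p"
  using prime_ge_2_nat[OF prime_card[where 'a = 'p]] by (simp only: p_card)

lemmas of_nat_eq_0_p = of_nat_mod_ring_eq_0[where 'p = 'p, folded p_card]
lemmas choose_p_power = choose_prime_power[where 'p = 'p, folded p_card]

lemma TL_cases:
  assumes "v \<in> TL"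
  obtains l i where "l \<in> lyn" "v = word_rep l (p ^ i)" "fexpo v = single l (p ^ i)"
  using assms fexpo_word_rep unfolding Tw_def by blast

lemma TL_lists: "v \<in> TL \<Longrightarrow> v \<in> lists L"
  by (elim TL_cases) (simp add: word_rep_lists lynD(1) del: in_lists_conv_set)

abbreviation lyndon_expo where "lyndon_expo \<equiv> total_expo fexpo"

text \<open>The exponents of a reduced monomial are recovered from the Lyndon multiplicities of its leading
  word as their base \<open>p\<close> digits.\<close>

lemma lyndon_expo_digit:
  assumes m: "m \<in> reduced p TL TL" and l: "l \<in> lyn"
  shows "lk (lyndon_expo m) l div p ^ i mod p = lk m (word_rep l (p ^ i))"
proof -
  \<comment> \<open>Digit positions from \<open>K\<close> on belong to words that are too long to occur in \<open>m\<close>.\<close>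
  define K where "K = Suc (i + (\<Sum>v\<in>ks m. length v))"
  let ?w = "\<lambda>j. word_rep l (p ^ j)"
  have ks: "ks m \<subseteq> TL" using m by (simp add: reduced_def)
  have inj: "inj_on ?w {..<K}"
  proof (rule inj_onI)
    fix j k assume "?w j = ?w k"
    then have "single l (p ^ j) = single l (p ^ k)"
      using fexpo_word_rep[OF l] by metis
    then have "p ^ j = p ^ k" by (metis lookup_single_eq)
    then show "j = k" using p_ge_2 by simp
  qed
  have in_range: "v \<in> ?w ` {..<K}" if v: "v \<in> ks m" and nz: "lk (fexpo v) l \<noteq> 0" for v
  proof -
    have "v \<in> TL" using ks v by (rule subsetD)
    then obtain k j where k: "k \<in> lyn" "v = word_rep k (p ^ j)" "fexpo v = single k (p ^ j)"
      by (rule TL_cases)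
    have "k = l" using nz unfolding k(3) by (simp add: lookup_single when_def split: if_splits)
    have "j < p ^ j" by (rule power_gt_expt) (use p_ge_2 in simp)
    also have "p ^ j \<le> length v" using lynD(2)[OF k(1)] unfolding k(2) by (cases k) simp_all
    also have "\<dots> \<le> (\<Sum>v\<in>ks m. length v)" using v by (intro member_le_sum) simp_all
    finally have "j < K" by (simp add: K_def)
    then show ?thesis using k(2) \<open>k = l\<close> by (intro image_eqI[of _ _ j]) simp_all
  qed
  have "lk (lyndon_expo m) l = (\<Sum>v\<in>ks m \<union> ?w ` {..<K}. lk m v * lk (fexpo v) l)"
    unfolding lookup_total_expo by (rule sum.mono_neutral_left) (simp_all add: in_keys_iff)
  also have "\<dots> = (\<Sum>v\<in>?w ` {..<K}. lk m v * lk (fexpo v) l)"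
  proof (rule sum.mono_neutral_right)
    show "\<forall>v\<in>ks m \<union> ?w ` {..<K} - ?w ` {..<K}. lk m v * lk (fexpo v) l = 0"
    proof
      fix v assume v: "v \<in> ks m \<union> ?w ` {..<K} - ?w ` {..<K}"
      have "lk (fexpo v) l = 0"
      proof (rule ccontr)
        assume "lk (fexpo v) l \<noteq> 0"
        with in_range[of v] v show False by blast
      qed
      then show "lk m v * lk (fexpo v) l = 0" by (simp only: mult_zero_right)
    qed
  qed simp_all
  also have "\<dots> = (\<Sum>j<K. lk m (?w j) * p ^ j)"
    unfolding sum.reindex[OF inj] o_def fexpo_word_rep[OF l] lookup_single_eq ..
  finally have e: "lk (lyndon_expo m) l = (\<Sum>j<K. lk m (?w j) * p ^ j)" .
  have "lk m (?w j) < p" for j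
  proof -
    have "?w j \<in> TL" using l unfolding Tw_def by blast
    then show ?thesis using m by (simp add: reduced_def)
  qed
  then show ?thesis unfolding e by (rule base_digit) (simp add: K_def)
qed

lemma keys_lyndon_expo: "ks m \<subseteq> TL \<Longrightarrow> ks (lyndon_expo m) \<subseteq> lyn"
proof -
  assume "ks m \<subseteq> TL"
  then have "ks (fexpo v) \<subseteq> lyn" if "v \<in> ks m" for v
    using that TL_lists by (intro fexpo_keys) blast
  then show ?thesis using keys_total_expo[of fexpo m] by blast
qed

text \<open>A factor \<open>x v\<close> is multiplied to a monomial in which \<open>v\<close> has an exponent below \<open>p - 1\<close>. By
  Lucas' theorem the coefficient of the leading word picks up this exponent plus one.\<close>

lemma monomial_lead:
  assumes x: "\<And>v. v \<in> TL \<Longrightarrow> has_lead (x v) v 1" and m: "m \<in> reduced p TL TL"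
  shows "\<exists>c. c \<noteq> 0 \<and> has_lead (mon_eval M x m) (wrd (lyndon_expo m)) c"
  using m
proof (induction "mdeg m" arbitrary: m)
  case 0
  then have "m = 0" using mdeg_eq_0 by metis
  moreover have "wrd 0 = []" using wrd_expo[of "[]"] by simp
  ultimately show ?case by (intro exI[of _ 1]) (simp add: has_lead_def)
next
  case (Suc n)
  then have "m \<noteq> 0" by (auto simp: mdeg_def)
  then obtain v where v: "v \<in> ks m" by (metis all_not_in_conv keys_eq_empty)
  then have "1 \<le> lk m v" by (simp add: in_keys_iff)
  then obtain m' where m': "m = m' + single v 1" "ks m' \<subseteq> ks m" by (rule lookup_le_split)
  have vTL: "v \<in> TL" and kTL: "ks m \<subseteq> TL" using v Suc.prems by (auto simp: reduced_def)
  have "lk m' w \<le> lk m w" for w by (simp add: m'(1) lookup_add)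
  with Suc.prems m'(2) have red: "m' \<in> reduced p TL TL" by (rule reduced_mono)
  have "n = mdeg m'" using Suc.hyps(2) m'(1) by (simp add: mdeg_add)
  from Suc.hyps(1)[OF this red] obtain c where
    c: "c \<noteq> 0" "has_lead (mon_eval M x m') (wrd (lyndon_expo m')) c" by (elim exE conjE)
  have xM: "x u \<in> carrier M" if "u \<in> TL" for u using x[OF that] by (simp add: has_lead_def)
  have "mon_eval M x m = mon_eval M x m' \<otimes>\<^bsub>M\<^esub> mon_eval M x (single v 1)"
    unfolding m'(1)
  proof (rule M.mon_eval_add[of TL])
    show "ks m' \<subseteq> TL" using m'(2) kTL by (rule order_trans)
    show "ks (single v 1) \<subseteq> TL" using vTL by simp
  qed (rule xM)
  also have "mon_eval M x (single v 1) = x v"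
    using M.mon_eval_single[of x v 1, OF xM[OF vTL]] M.nat_pow_eone[OF xM[OF vTL]] by simp
  finally have e: "mon_eval M x m = mon_eval M x m' \<diamondop> x v" by simp
  obtain l i where l: "l \<in> lyn" "v = word_rep l (p ^ i)" "fexpo v = single l (p ^ i)"
    using vTL by (rule TL_cases)
  have km': "ks (lyndon_expo m') \<subseteq> lyn" by (rule keys_lyndon_expo[OF order_trans[OF m'(2) kTL]])
  let ?n = "lk (lyndon_expo m') l"
  have "bin (lyndon_expo m') (fexpo v) = (?n + p ^ i) choose p ^ i"
    unfolding l(3) by (rule bin_single)
  then have "(of_nat (bin (lyndon_expo m') (fexpo v)) :: 'p mod_ring) = of_nat ((?n + p ^ i) div p ^ i)"
    by (simp only: choose_p_power)
  also have "(?n + p ^ i) div p ^ i = Suc (?n div p ^ i)" using p_ge_2 by simp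
  also have "of_nat (Suc (?n div p ^ i)) \<noteq> (0 :: 'p mod_ring)"
  proof
    assume "of_nat (Suc (?n div p ^ i)) = (0 :: 'p mod_ring)"
    then have "Suc (?n div p ^ i) mod p = 0" by (simp only: of_nat_eq_0_p mod_eq_0_iff_dvd)
    then have "Suc (?n div p ^ i mod p) mod p = 0" by (simp only: mod_Suc_eq)
    moreover have "?n div p ^ i mod p = lk m' v" unfolding l(2) by (rule lyndon_expo_digit[OF red l(1)])
    moreover have "lk m v < p" using Suc.prems vTL by (simp add: reduced_def)
    moreover have "lk m v = Suc (lk m' v)" by (simp add: m'(1) lookup_add)
    ultimately show False by simp
  qed
  finally have nz: "(of_nat (bin (lyndon_expo m') (fexpo v)) :: 'p mod_ring) \<noteq> 0" .
  have "has_lead (mon_eval M x m) (wrd (lyndon_expo m))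
      (c * 1 * of_nat (bin (lyndon_expo m') (fexpo v)))"
  proof -
    have "lyndon_expo m = lyndon_expo m' + fexpo v"
      unfolding m'(1) total_expo_add total_expo_single ..
    then show ?thesis using has_lead_mult[OF c(2) x[OF vTL]] by (simp only: e fexpo_wrd[OF km'])
  qed
  then show ?case using c(1) nz by (intro exI conjI) auto
qed

text \<open>The words \<open>wrd (lyndon_expo m)\<close> run through all words exactly once: Lyndon factorization
  turns a word into multiplicities of Lyndon words, and their base \<open>p\<close> digits are the exponents
  of a reduced monomial.\<close>

lemma lead_bij: "bij_betw (\<lambda>m. wrd (lyndon_expo m)) (reduced p TL TL) (lists L)"
proof (rule bij_betw_imageI)
  show "inj_on (\<lambda>m. wrd (lyndon_expo m)) (reduced p TL TL)"
  proof (rule inj_onI)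
    fix m n assume m: "m \<in> reduced p TL TL" and n: "n \<in> reduced p TL TL"
      and e: "wrd (lyndon_expo m) = wrd (lyndon_expo n)"
    have "ks m \<subseteq> TL" "ks n \<subseteq> TL" using m n by (simp_all add: reduced_def)
    then have e': "lyndon_expo m = lyndon_expo n"
      using fexpo_wrd[OF keys_lyndon_expo, of m] fexpo_wrd[OF keys_lyndon_expo, of n] e by metis
    show "m = n"
    proof (rule poly_mapping_eqI)
      fix v show "lk m v = lk n v"
      proof (cases "v \<in> TL")
        case True
        then show ?thesis
          using lyndon_expo_digit[OF m] lyndon_expo_digit[OF n] e' by (elim TL_cases) metis
      next
        case False
        then have "v \<notin> ks m" "v \<notin> ks n" using \<open>ks m \<subseteq> TL\<close> \<open>ks n \<subseteq> TL\<close> by blast+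
        then show ?thesis by (simp add: in_keys_iff)
      qed
    qed
  qed
  show "(\<lambda>m. wrd (lyndon_expo m)) ` reduced p TL TL = lists L"
  proof (intro equalityI subsetI)
    fix w assume "w \<in> (\<lambda>m. wrd (lyndon_expo m)) ` reduced p TL TL"
    then obtain m where m: "m \<in> reduced p TL TL" "w = wrd (lyndon_expo m)" by blast
    show "w \<in> lists L"
      unfolding m(2) by (intro wrd_lists keys_lyndon_expo) (use m(1) in \<open>simp add: reduced_def\<close>)
  next
    fix w assume w: "w \<in> lists L"
    have "\<exists>m \<in> reduced p TL TL. lyndon_expo m = fexpo w"
    proof (rule total_expo_surj[OF p_ge_2])
      fix l k assume "l \<in> ks (fexpo w)"
      then have "l \<in> lyn" using fexpo_keys[OF w] by blast
      then show "\<exists>v\<in>TL. fexpo v = single l (p ^ k)"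
        using fexpo_word_rep[of l "p ^ k"] unfolding Tw_def by blast
    qed
    then show "w \<in> (\<lambda>m. wrd (lyndon_expo m)) ` reduced p TL TL"
      using wrd_fexpo[OF w] by (metis image_eqI)
  qed
qed

lemma lyndon_monomial_basis:
  assumes x: "\<And>v. v \<in> TL \<Longrightarrow> has_lead (x v) v 1"
  shows "ks t \<subseteq> reduced p TL TL \<Longrightarrow> lin (mon_eval M x) t = 0 \<Longrightarrow> t = 0"
    and "ks z \<subseteq> lists L \<Longrightarrow> \<exists>t. ks t \<subseteq> reduced p TL TL \<and> lin (mon_eval M x) t = z"
proof -
  have "\<forall>m \<in> reduced p TL TL. \<exists>c. c \<noteq> 0 \<and> has_lead (mon_eval M x m) (wrd (lyndon_expo m)) c"
  proof
    fix m assume "m \<in> reduced p TL TL"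
    from monomial_lead[OF x this] show "\<exists>c. c \<noteq> 0 \<and> has_lead (mon_eval M x m) (wrd (lyndon_expo m)) c" .
  qed
  from bchoice[OF this] obtain c where
    c': "\<forall>m \<in> reduced p TL TL. c m \<noteq> 0 \<and> has_lead (mon_eval M x m) (wrd (lyndon_expo m)) (c m)"
    by (elim exE)
  have c: "c m \<noteq> 0" "has_lead (mon_eval M x m) (wrd (lyndon_expo m)) (c m)" if "m \<in> reduced p TL TL" for m
    using bspec[OF c' that] by simp_all
  show "t = 0" if "ks t \<subseteq> reduced p TL TL" "lin (mon_eval M x) t = 0"
  proof (rule triangular_independent[where K = "reduced p TL TL" and b = "mon_eval M x" and
        ld = "\<lambda>m. wrd (lyndon_expo m)" and c = c])
    show "inj_on (\<lambda>m. wrd (lyndon_expo m)) (reduced p TL TL)"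
      using lead_bij by (rule bij_betw_imp_inj_on)
    show "ks t \<subseteq> reduced p TL TL" "lin (mon_eval M x) t = 0" by fact+
    show "has_lead (mon_eval M x m) (wrd (lyndon_expo m)) (c m)" if "m \<in> reduced p TL TL" for m
      using that by (rule c(2))
    show "d = 0" if "m \<in> reduced p TL TL" "d * c m = 0" for m d
      using c(1)[OF that(1)] that(2) by simp
  qed
  show "\<exists>t. ks t \<subseteq> reduced p TL TL \<and> lin (mon_eval M x) t = z" if "ks z \<subseteq> lists L"
  proof (rule triangular_spanning[where K = "reduced p TL TL" and b = "mon_eval M x" and
        ld = "\<lambda>m. wrd (lyndon_expo m)" and c = c])
    show "ks z \<subseteq> lists L" by fact
    show "has_lead (mon_eval M x m) (wrd (lyndon_expo m)) (c m)" if "m \<in> reduced p TL TL" for m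
      using that by (rule c(2))
    show "\<exists>d. d * c m = 1" if "m \<in> reduced p TL TL" for m
      using c(1)[OF that] by (intro exI[of _ "inverse (c m)"]) simp
    show "lists L \<subseteq> (\<lambda>m. wrd (lyndon_expo m)) ` reduced p TL TL"
      using bij_betw_imp_surj_on[OF lead_bij] by simp
  qed
qed

end

section \<open>Splitting the variables\<close>

lemma lookup_total_expo_inj:
  assumes inj: "inj_on g V" and m: "ks m \<subseteq> V" and u: "u \<in> V"
  shows "lk (total_expo (\<lambda>v. single (g v) 1) m) (g u) = lk m u"
proof -
  have "lk (total_expo (\<lambda>v. single (g v) 1) m) (g u) =
      (\<Sum>v\<in>ks m. if v = u then lk m v else 0)"
    unfolding lookup_total_expo
    by (rule sum.cong) (use inj_onD[OF inj _ subsetD[OF m] u] in \<open>auto simp: lookup_single when_def\<close>)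
  then show ?thesis by (simp add: in_keys_iff)
qed

text \<open>A surjection of index sets that preserves values carries a basis to a basis: it is injective
  automatically, as basis elements with different indices have different values.\<close>

lemma basis_transfer:
  fixes b :: "'i \<Rightarrow> ('w \<Rightarrow>\<^sub>0 'k::comm_ring_1)" and b' :: "'j \<Rightarrow> ('w \<Rightarrow>\<^sub>0 'k)"
  assumes onto: "\<phi> ` K = K'" and val: "\<And>i. i \<in> K \<Longrightarrow> b' (\<phi> i) = b i"
  shows "(\<And>t. ks t \<subseteq> K \<Longrightarrow> lin b t = 0 \<Longrightarrow> t = 0) \<Longrightarrow> ks s \<subseteq> K' \<Longrightarrow> lin b' s = 0 \<Longrightarrow> s = 0"
    and "(\<exists>t. ks t \<subseteq> K \<and> lin b t = z) \<Longrightarrow> (\<exists>s. ks s \<subseteq> K' \<and> lin b' s = z)"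
proof -
  assume indep: "\<And>t. ks t \<subseteq> K \<Longrightarrow> lin b t = 0 \<Longrightarrow> t = 0" and s: "ks s \<subseteq> K'" "lin b' s = 0"
  define \<sigma> where "\<sigma> = inv_into K \<phi>"
  have \<sigma>: "\<sigma> j \<in> K" "\<phi> (\<sigma> j) = j" if "j \<in> ks s" for j
    using that s(1) onto unfolding \<sigma>_def by (auto intro: inv_into_into f_inv_into_f)
  define t where "t = lin (\<lambda>j. single (\<sigma> j) 1) s"
  have "ks t \<subseteq> K" unfolding t_def by (rule keys_subset_lin) (simp add: \<sigma>)
  moreover have "lin b t = lin b' s"
    unfolding t_def lin_lin by (rule lin_cong) (simp add: \<sigma> flip: val)
  ultimately have "t = 0" using indep s(2) by simp
  moreover have "lin (\<lambda>i. single (\<phi> i) 1) t = lin (\<lambda>j. single j 1) s"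
    unfolding t_def lin_lin by (rule lin_cong) (simp add: \<sigma>)
  ultimately show "s = 0" by simp
next
  assume "\<exists>t. ks t \<subseteq> K \<and> lin b t = z"
  then obtain t where t: "ks t \<subseteq> K" "lin b t = z" by (elim exE conjE)
  let ?s = "lin (\<lambda>i. single (\<phi> i) 1) t"
  have "\<phi> i \<in> K'" if "i \<in> ks t" for i using that t(1) onto by blast
  then have "ks ?s \<subseteq> K'" by (intro keys_subset_lin) simp
  moreover have "lin b' ?s = lin b t"
    unfolding lin_lin by (rule lin_cong) (simp add: val subsetD[OF t(1)])
  ultimately show "\<exists>s. ks s \<subseteq> K' \<and> lin b' s = z" using t(2) by (intro exI[of _ ?s] conjI) simp_all
qed

text \<open>Monomials in \<open>V1 \<union> V2\<close> are split into a part in \<open>V1\<close> and a part in \<open>V2\<close>. The variables of the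
  second part are renamed by \<open>d\<close>, which allows variables that are themselves elements of the
  algebra.\<close>

locale split_variables =
  fixes V1 V2 :: "'v set" and d :: "'v \<Rightarrow> 'y" and p :: nat and Z1 Z2 :: "'v set"
  assumes disj: "V1 \<inter> V2 = {}" and inj: "inj_on d V2" and Z: "Z1 \<subseteq> V1" "Z2 \<subseteq> V2"
begin

definition part_one where "part_one = total_expo (\<lambda>v. if v \<in> V1 then single v 1 else 0)"
definition part_two where "part_two = total_expo (\<lambda>v. if v \<in> V1 then 0 else single (d v) 1)"

lemma lookup_part_one: "lk (part_one m) v = (if v \<in> V1 then lk m v else 0)"
proof -
  have "lk (part_one m) v = (\<Sum>u\<in>ks m. if u = v then (if v \<in> V1 then lk m v else 0) else 0)"
    unfolding part_one_def lookup_total_expo by (rule sum.cong) (auto simp: lookup_single when_def)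
  then show ?thesis by (simp add: in_keys_iff)
qed

lemma lookup_part_two:
  assumes "ks m \<subseteq> V1 \<union> V2" "v \<in> V2"
  shows "lk (part_two m) (d v) = lk m v"
proof -
  have "lk (part_two m) (d v) = (\<Sum>u\<in>ks m. if u = v then lk m v else 0)"
    unfolding part_two_def lookup_total_expo
  proof (rule sum.cong[OF refl])
    fix u assume u: "u \<in> ks m"
    show "lk m u * lk (if u \<in> V1 then 0 else single (d u) 1) (d v) = (if u = v then lk m v else 0)"
    proof (cases "u \<in> V1")
      case True
      then show ?thesis using assms(2) disj by auto
    next
      case False
      then have "u \<in> V2" using u assms(1) by blast
      then have "d u = d v \<longleftrightarrow> u = v" using inj_on_eq_iff[OF inj _ assms(2)] by simp
      then show ?thesis using False by (simp add: lookup_single when_def)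
    qed
  qed
  then show ?thesis by (simp add: in_keys_iff)
qed

lemma keys_part_two: "ks m \<subseteq> V1 \<union> V2 \<Longrightarrow> ks (part_two m) \<subseteq> d ` V2"
  unfolding part_two_def by (rule order_trans[OF keys_total_expo]) (auto split: if_splits)

lemma part_image:
  "(\<lambda>m. (part_one m, part_two m)) ` reduced p (V1 \<union> V2) (Z1 \<union> Z2) =
    reduced p V1 Z1 \<times> reduced p (d ` V2) (d ` Z2)"
proof (intro equalityI subsetI)
  fix x assume "x \<in> (\<lambda>m. (part_one m, part_two m)) ` reduced p (V1 \<union> V2) (Z1 \<union> Z2)"
  then obtain m where m: "m \<in> reduced p (V1 \<union> V2) (Z1 \<union> Z2)" "x = (part_one m, part_two m)" by blast
  have k: "ks m \<subseteq> V1 \<union> V2" and lt: "\<And>z. z \<in> Z1 \<union> Z2 \<Longrightarrow> lk m z < p"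
    using m(1) by (simp_all add: reduced_def)
  have "ks (part_one m) \<subseteq> V1"
    by (auto simp: in_keys_iff lookup_part_one split: if_splits)
  moreover have "lk (part_one m) z < p" if "z \<in> Z1" for z
    using lt[of z] that Z by (auto simp: lookup_part_one)
  moreover have "lk (part_two m) y < p" if "y \<in> d ` Z2" for y
    using that lt lookup_part_two[OF k] Z by auto
  ultimately show "x \<in> reduced p V1 Z1 \<times> reduced p (d ` V2) (d ` Z2)"
    using keys_part_two[OF k] by (simp add: m(2) reduced_def)
next
  fix x assume "x \<in> reduced p V1 Z1 \<times> reduced p (d ` V2) (d ` Z2)"
  then obtain m1 m2 where x: "x = (m1, m2)" and m1: "m1 \<in> reduced p V1 Z1"
    and m2: "m2 \<in> reduced p (d ` V2) (d ` Z2)" by blast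
  let ?e = "inv_into V2 d"
  define n where "n = total_expo (\<lambda>y. single (?e y) 1) m2"
  have inj': "inj_on ?e (d ` V2)" by (rule inj_on_inv_into) simp
  have k2: "ks m2 \<subseteq> d ` V2" and k1: "ks m1 \<subseteq> V1" using m1 m2 by (simp_all add: reduced_def)
  have n: "lk n v = lk m2 (d v)" if "v \<in> V2" for v
    using lookup_total_expo_inj[OF inj' k2, of "d v"] that inv_into_f_f[OF inj that] by (simp add: n_def)
  have kn: "ks n \<subseteq> V2"
    unfolding n_def
  proof (rule order_trans[OF keys_total_expo], rule UN_least)
    fix y assume "y \<in> ks m2"
    then have "?e y \<in> V2" using k2 by (intro inv_into_into) blast
    then show "ks (single (?e y) (1::nat)) \<subseteq> V2" by simp
  qed
  have n0: "lk n v = 0" if "v \<in> V1" for v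
  proof -
    have "v \<notin> ks n" using kn that disj by blast
    then show ?thesis by (simp add: in_keys_iff)
  qed
  have m10: "lk m1 v = 0" if "v \<notin> V1" for v
  proof -
    have "v \<notin> ks m1" using k1 that by blast
    then show ?thesis by (simp add: in_keys_iff)
  qed
  let ?m = "m1 + n"
  have km: "ks ?m \<subseteq> V1 \<union> V2" using k1 kn by (auto simp: keys_add_nat)
  have "part_one ?m = m1"
    by (rule poly_mapping_eqI) (simp add: lookup_part_one lookup_add n0 m10)
  moreover have "part_two ?m = m2"
  proof (rule poly_mapping_eqI)
    fix y show "lk (part_two ?m) y = lk m2 y"
    proof (cases "y \<in> d ` V2")
      case True
      then obtain v where v: "v \<in> V2" "y = d v" by blast
      have "v \<notin> V1" using v(1) disj by blast
      then show ?thesis using lookup_part_two[OF km v(1)] n[OF v(1)] m10[of v] v(2) by (simp add: lookup_add)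
    next
      case False
      then have "y \<notin> ks m2" "y \<notin> ks (part_two ?m)" using k2 keys_part_two[OF km] by blast+
      then show ?thesis by (simp add: in_keys_iff)
    qed
  qed
  moreover have "lk ?m z < p" if "z \<in> Z1 \<union> Z2" for z
  proof (cases "z \<in> V1")
    case True
    then have "z \<in> Z1" using that Z disj by blast
    then show ?thesis using m1 True by (simp add: lookup_add n0 reduced_def)
  next
    case False
    then have z: "z \<in> Z2" "z \<in> V2" using that Z by blast+
    then show ?thesis using m2 False by (simp add: lookup_add n m10 reduced_def)
  qed
  ultimately show "x \<in> (\<lambda>m. (part_one m, part_two m)) ` reduced p (V1 \<union> V2) (Z1 \<union> Z2)"
    using km x by (intro image_eqI[of _ _ ?m]) (simp_all add: reduced_def)
qed

end

lemma (in kalg) mon_eval_total_expo: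
  assumes x: "\<And>v. v \<in> V \<Longrightarrow> x v \<in> carrier A" and x': "\<And>u. u \<in> U \<Longrightarrow> x' u \<in> carrier A"
    and E: "\<And>v. v \<in> V \<Longrightarrow> ks (E v) \<subseteq> U" and val: "\<And>v. v \<in> V \<Longrightarrow> mon_eval A x' (E v) = x v"
    and m: "ks m \<subseteq> V"
  shows "mon_eval A x' (total_expo E m) = mon_eval A x m"
  using m
proof (induction "mdeg m" arbitrary: m)
  case 0
  then have "m = 0" using mdeg_eq_0 by metis
  then show ?case by simp
next
  case (Suc n)
  then have "m \<noteq> 0" by (auto simp: mdeg_def)
  then obtain v where v: "v \<in> ks m" by (metis all_not_in_conv keys_eq_empty)
  then have "1 \<le> lk m v" by (simp add: in_keys_iff)
  then obtain m' where m': "m = m' + single v 1" "ks m' \<subseteq> ks m" by (rule lookup_le_split)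
  have vV: "v \<in> V" using v Suc.prems by blast
  have km': "ks m' \<subseteq> V" using m'(2) Suc.prems by (rule order_trans)
  have ksv: "ks (single v (1::nat)) \<subseteq> V" using vV by simp
  have "n = mdeg m'" using Suc.hyps(2) m'(1) by (simp add: mdeg_add)
  from Suc.hyps(1)[OF this km'] have IH: "mon_eval A x' (total_expo E m') = mon_eval A x m'" .
  have kE: "ks (total_expo E m') \<subseteq> U"
    by (rule order_trans[OF keys_total_expo], rule UN_least, rule E, rule subsetD[OF km'])
  have "mon_eval A x' (total_expo E m' + E v) =
      mon_eval A x' (total_expo E m') \<otimes> mon_eval A x' (E v)"
    by (rule mon_eval_add[OF x' kE E[OF vV]])
  also have "\<dots> = mon_eval A x m' \<otimes> mon_eval A x (single v 1)"
    using mon_eval_single[of x v 1, OF x[OF vV]] nat_pow_eone[OF x[OF vV]] by (simp add: IH val[OF vV])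
  also have "\<dots> = mon_eval A x m"
    unfolding m'(1) by (rule mon_eval_add[OF x km' ksv, symmetric])
  finally show ?case unfolding m'(1) total_expo_add total_expo_single .
qed

lemma lspan_poly_alg:
  "carrier (poly_alg Y :: ('k::comm_ring_1, _) module) \<subseteq>
    lspan (poly_alg Y) ((\<lambda>m. single m 1) ` {m. ks m \<subseteq> Y})"
proof
  fix f :: "('a \<Rightarrow>\<^sub>0 nat) \<Rightarrow>\<^sub>0 'k" assume "f \<in> carrier (poly_alg Y)"
  then have "ks f \<subseteq> {m. ks m \<subseteq> Y}" by simp
  then show "f \<in> lspan (poly_alg Y) ((\<lambda>m. single m 1) ` {m. ks m \<subseteq> Y})"
  proof (induction f rule: keys_induct)
    case zero
    show ?case using lspan.zero[of "poly_alg Y"] by simp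
  next
    case (add m c f)
    from lspan.add[OF imageI[OF add.hyps(1), of "\<lambda>m. single m 1"] add.IH, of c]
    show ?case by simp
  qed
qed

context mixable begin

abbreviation "wp \<equiv> word_pow p S"

lemma Lyn_eq: "Lyn S = lyn"
  by (simp add: Lyn_def lyn_def)

lemma sgpow_p_closed: "a \<in> L \<Longrightarrow> sgpow S a p \<in> L"
  by (simp add: sgpow_def sgpow_closed)

lemma wp_lists: "w \<in> lists L \<Longrightarrow> wp w \<in> lists L"
  by (auto simp: word_pow_def sgpow_p_closed)

lemma length_wp [simp]: "length (wp w) = length w"
  by (simp add: word_pow_def)

lemma wp_word_rep: "wp (word_rep l k) = word_rep (wp l) k"
  unfolding word_rep_def by (induction k) (simp_all add: word_pow_def)

lemma wp_word_rep_fixed: "0 < k \<Longrightarrow> wp (word_rep l k) = word_rep l k \<longleftrightarrow> wp l = l"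
proof -
  assume "0 < k"
  then obtain j where k: "k = Suc j" by (cases k) auto
  have "wp (word_rep l k) = wp l @ wp (word_rep l j)" "word_rep l k = l @ word_rep l j"
    unfolding k word_rep_def by (simp_all add: word_pow_def)
  then show ?thesis using wp_word_rep[of l j] by auto
qed

lemma word_power_p: "w \<in> lists L \<Longrightarrow> word w [^]\<^bsub>M\<^esub> p = word (wp w)"
  using word_frobenius[of w] by (simp only: p_card)

lemma wp_funpow_lists: "w \<in> lists L \<Longrightarrow> (wp ^^ k) w \<in> lists L"
  by (induction k) (simp_all only: funpow.simps o_def wp_lists id_def)

lemma word_power_p_iter: "w \<in> lists L \<Longrightarrow> word w [^]\<^bsub>M\<^esub> (p ^ k) = word ((wp ^^ k) w)"
proof (induction k)
  case 0
  then show ?case using M.nat_pow_eone[of "word w"] by simp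
next
  case (Suc k)
  have wM: "word w \<in> carrier M" using Suc.prems by simp
  have "word w [^]\<^bsub>M\<^esub> (p ^ Suc k) = (word w [^]\<^bsub>M\<^esub> (p ^ k)) [^]\<^bsub>M\<^esub> p"
    unfolding M.nat_pow_pow[OF wM] by (simp add: mult.commute)
  then show ?case
    unfolding Suc.IH[OF Suc.prems] word_power_p[OF wp_funpow_lists[OF Suc.prems]] by simp
qed

lemma TL_parts: "TL = TL1 p S \<union> TL2 p S" "TL1 p S \<inter> TL2 p S = {}"
  "v \<in> TL1 p S \<Longrightarrow> wp v = v" "v \<in> TL2 p S \<Longrightarrow> wp v \<noteq> v"
proof -
  have pp: "0 < p ^ i" for i using p_ge_2 by simp
  show 1: "wp v = v" if "v \<in> TL1 p S" for v
    using that wp_word_rep_fixed[OF pp] by (auto simp: TL1_def Tw_def part1_def)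
  show 2: "wp v \<noteq> v" if "v \<in> TL2 p S" for v
    using that wp_word_rep_fixed[OF pp] by (auto simp: TL2_def Tw_def part2_def)
  show "TL1 p S \<inter> TL2 p S = {}" using 1 2 by blast
  show "TL = TL1 p S \<union> TL2 p S"
    unfolding TL1_def TL2_def Tw_def part1_def part2_def Lyn_eq by blast
qed

lemma has_lead_word: "w \<in> lists L \<Longrightarrow> has_lead (word w) w 1"
  by (simp add: has_lead_def)

text \<open>The tensor decompositions: the variables of a monomial basis are split into two sets, and the
  two subalgebras generated by them carry the given presentations.\<close>

lemma tensor_of_split:
  assumes A: "kalg A" and B: "kalg B" and f: "f \<in> alg_hom A M" and g: "g \<in> alg_hom B M"
    and s: "split_variables V1 V2 d Z1 Z2"
    and iA: "\<And>m. m \<in> reduced p V1 Z1 \<Longrightarrow> iA m \<in> carrier A"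
      "carrier A \<subseteq> lspan A (iA ` reduced p V1 Z1)"
      "\<And>m. m \<in> reduced p V1 Z1 \<Longrightarrow> f (iA m) = mon_eval M xA m"
    and iB: "\<And>m. m \<in> reduced p (d ` V2) (d ` Z2) \<Longrightarrow> iB m \<in> carrier B"
      "carrier B \<subseteq> lspan B (iB ` reduced p (d ` V2) (d ` Z2))"
      "\<And>m. m \<in> reduced p (d ` V2) (d ` Z2) \<Longrightarrow> g (iB m) = mon_eval M xB m"
    and x: "\<And>v. v \<in> V1 \<union> V2 \<Longrightarrow> x v \<in> carrier M"
    and x12: "\<And>v. v \<in> V1 \<Longrightarrow> xA v = x v" "\<And>v. v \<in> V2 \<Longrightarrow> xB (d v) = x v"
    and indep: "\<And>t. ks t \<subseteq> reduced p (V1 \<union> V2) (Z1 \<union> Z2) \<Longrightarrow> lin (mon_eval M x) t = 0 \<Longrightarrow> t = 0"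
    and span: "\<And>z. ks z \<subseteq> lists L \<Longrightarrow>
      \<exists>t. ks t \<subseteq> reduced p (V1 \<union> V2) (Z1 \<union> Z2) \<and> lin (mon_eval M x) t = z"
  shows "M \<cong>\<^sub>a A \<otimes>\<^sub>a B"
proof -
  interpret s: split_variables V1 V2 d p Z1 Z2 by fact
  let ?K = "reduced p (V1 \<union> V2) (Z1 \<union> Z2)" and ?I = "reduced p V1 Z1" and ?J = "reduced p (d ` V2) (d ` Z2)"
  let ?b = "\<lambda>(i, j). mon_eval M xA i \<diamondop> mon_eval M xB j"
  let ?b' = "\<lambda>(i, j). f (iA i) \<diamondop> g (iB j)"
  have val: "?b (s.part_one m, s.part_two m) = mon_eval M x m" if "m \<in> ?K" for m
  proof -
    have k: "ks m \<subseteq> V1 \<union> V2" using that by (simp add: reduced_def)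
    \<comment> \<open>The two parts of \<open>m\<close> are the values of \<open>m\<close> with the other variables set to \<open>1\<close>.\<close>
    define y where "y v = (if v \<in> V1 then x v else \<one>\<^bsub>M\<^esub>)" for v
    define y' where "y' v = (if v \<in> V1 then \<one>\<^bsub>M\<^esub> else x v)" for v
    have yM: "y v \<in> carrier M" "y' v \<in> carrier M" if "v \<in> V1 \<union> V2" for v
      using x[OF that] M.one_closed unfolding y_def y'_def by simp_all
    have x1M: "xA v \<in> carrier M" if "v \<in> V1" for v unfolding x12(1)[OF that] using that by (intro x) simp
    have x2M: "xB v \<in> carrier M" if "v \<in> d ` V2" for v
    proof -
      from that obtain u where u: "u \<in> V2" "v = d u" by (elim imageE)
      show ?thesis unfolding u(2) x12(2)[OF u(1)] using u(1) by (intro x) simp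
    qed
    have "mon_eval M xA (s.part_one m) = mon_eval M y m"
      unfolding s.part_one_def
    proof (rule M.mon_eval_total_expo[where V = "V1 \<union> V2" and U = V1])
      fix v assume "v \<in> V1 \<union> V2"
      show "mon_eval M xA (if v \<in> V1 then single v 1 else 0) = y v"
        using M.mon_eval_single[of xA v 1] M.nat_pow_eone[of "xA v"] x1M[of v] M.mon_eval_zero[of xA]
        by (simp add: y_def x12(1) del: free_alg_simps)
    qed (use yM x1M k in \<open>auto simp del: free_alg_simps\<close>)
    moreover have "mon_eval M xB (s.part_two m) = mon_eval M y' m"
      unfolding s.part_two_def
    proof (rule M.mon_eval_total_expo[where V = "V1 \<union> V2" and U = "d ` V2"])
      fix v assume v: "v \<in> V1 \<union> V2"
      show "mon_eval M xB (if v \<in> V1 then 0 else single (d v) 1) = y' v"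
      proof (cases "v \<in> V1")
        case True
        then show ?thesis using M.mon_eval_zero[of xB] by (simp add: y'_def del: free_alg_simps)
      next
        case False
        then have v2: "v \<in> V2" "d v \<in> d ` V2" using v by simp_all
        show ?thesis
          using M.mon_eval_single[of xB "d v" 1, OF x2M[OF v2(2)]] M.nat_pow_eone[OF x2M[OF v2(2)]] False
          by (simp add: y'_def x12(2)[OF v2(1)] del: free_alg_simps)
      qed
    qed (use yM x2M k in \<open>auto simp del: free_alg_simps\<close>)
    moreover have "mon_eval M y m \<otimes>\<^bsub>M\<^esub> mon_eval M y' m = mon_eval M x m"
      unfolding mon_eval_def
    proof (subst M.finprod_multf[symmetric])
      show "finprod M (\<lambda>v. y v [^]\<^bsub>M\<^esub> lk m v \<otimes>\<^bsub>M\<^esub> y' v [^]\<^bsub>M\<^esub> lk m v) (ks m) =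
          finprod M (\<lambda>v. x v [^]\<^bsub>M\<^esub> lk m v) (ks m)"
      proof (rule M.finprod_cong')
        fix v assume "v \<in> ks m"
        then have "x v [^]\<^bsub>M\<^esub> lk m v \<in> carrier M" using x k by (intro M.nat_pow_closed) blast
        then show "y v [^]\<^bsub>M\<^esub> lk m v \<otimes>\<^bsub>M\<^esub> y' v [^]\<^bsub>M\<^esub> lk m v = x v [^]\<^bsub>M\<^esub> lk m v"
          unfolding y_def y'_def
          using M.nat_pow_one[of "lk m v"] M.l_one M.r_one by (simp del: free_alg_simps)
      qed (use x k in \<open>auto simp del: free_alg_simps intro!: M.nat_pow_closed\<close>)
    qed (use yM k in \<open>auto simp del: free_alg_simps intro!: M.nat_pow_closed\<close>)
    ultimately show ?thesis by simp
  qed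
  have eq: "lin ?b' t = lin ?b t" if "ks t \<subseteq> ?I \<times> ?J" for t
  proof (rule lin_cong)
    fix u assume "u \<in> ks t"
    then have "fst u \<in> ?I" "snd u \<in> ?J" using that by auto
    then show "?b' u = ?b u" by (simp add: split_beta iA(3) iB(3))
  qed
  note transfer = basis_transfer[where \<phi> = "\<lambda>m. (s.part_one m, s.part_two m)" and K = ?K and
      K' = "?I \<times> ?J" and b = "mon_eval M x" and b' = ?b]
  show ?thesis
  proof (rule tensor_iso[OF A B MS_kalg f g iA(1,2) iB(1,2)])
    fix t assume t: "ks t \<subseteq> ?I \<times> ?J" "lin ?b' t = 0"
    show "t = 0"
    proof (rule transfer(1)[OF s.part_image val])
      show "lin ?b t = 0" using eq[OF t(1)] t(2) by (rule trans[OF sym])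
    qed (assumption, erule (1) indep, rule t(1))
  next
    fix z :: "'a list \<Rightarrow>\<^sub>0 'p mod_ring" assume z: "ks z \<subseteq> lists L"
    have "\<exists>t. ks t \<subseteq> ?I \<times> ?J \<and> lin ?b t = z"
      by (rule transfer(2)[OF s.part_image val span[OF z]])
    then obtain t where t: "ks t \<subseteq> ?I \<times> ?J" "lin ?b t = z" by (elim exE conjE)
    then show "\<exists>t. ks t \<subseteq> ?I \<times> ?J \<and> lin ?b' t = z"
      using eq[OF t(1)] by (intro exI[of _ t] conjI) simp_all
  qed
qed

end

section \<open>Semigroups in the class J\<close>

context quasi_shuffle begin

lemma funpow_mult_add: "a \<in> L \<Longrightarrow>
    sgmult S ((sgmult S a ^^ j) a) ((sgmult S a ^^ k) a) = (sgmult S a ^^ (j + k + 1)) a"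
proof (induction j)
  case (Suc j)
  then show ?case
    using sg_assoc[OF Suc.prems sgpow_closed[OF Suc.prems, of j] sgpow_closed[OF Suc.prems, of k]] by simp
qed simp

lemma funpow_mult_mult: "a \<in> L \<Longrightarrow>
    (sgmult S ((sgmult S a ^^ j) a) ^^ k) ((sgmult S a ^^ j) a) = (sgmult S a ^^ (j + k * (j + 1))) a"
proof (induction k)
  case (Suc k)
  then have "(sgmult S ((sgmult S a ^^ j) a) ^^ Suc k) ((sgmult S a ^^ j) a) =
      sgmult S ((sgmult S a ^^ j) a) ((sgmult S a ^^ (j + k * (j + 1))) a)" by simp
  also have "\<dots> = (sgmult S a ^^ (j + (j + k * (j + 1)) + 1)) a" by (rule funpow_mult_add[OF Suc.prems])
  also have "j + (j + k * (j + 1)) + 1 = j + Suc k * (j + 1)" by simp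
  finally show ?case .
qed simp

text \<open>Brings the hypothesis \<open>g ^ (p ^ 2) = g ^ p\<close> into the form that the Frobenius map is idempotent
  on letters.\<close>

lemma sgpow_sgpow:
  assumes "a \<in> L" "0 < p" shows "sgpow S (sgpow S a p) p = sgpow S a (p\<^sup>2)"
proof -
  obtain q where q: "p = Suc q" using assms(2) by (cases p) auto
  have "p\<^sup>2 - 1 = q + q * (q + 1)" by (simp add: q power2_eq_square)
  then show ?thesis using funpow_mult_mult[OF assms(1), of q q] by (simp add: sgpow_def q)
qed

end

context mixable begin

lemma has_lead_unique:
  assumes "has_lead f u c" "has_lead f v d" "c \<noteq> 0" "d \<noteq> 0"
  shows "u = v"
proof -
  have "u \<in> ks f" "v \<in> ks f" using assms by (simp_all add: has_lead_def in_keys_iff)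
  then have "u = v \<or> u \<sqsubset> v" "v = u \<or> v \<sqsubset> u" using assms by (auto simp: has_lead_def)
  then show ?thesis using wless_trans[of u v u] wless_irrefl[of u] by auto
qed

lemma J_wp_idem:
  assumes J: "class_J p S" and w: "w \<in> lists L"
  shows "wp (wp w) = wp w"
proof -
  have "sgpow S (sgpow S a p) p = sgpow S a p" if "a \<in> L" for a
    using J sgpow_sgpow[OF that, of p] p_ge_2 that by (simp add: class_J_def)
  then show ?thesis using w by (auto simp: word_pow_def)
qed

text \<open>A letter that is not fixed is replaced by its \<open>p\<close>-th power, which is fixed and therefore smaller.\<close>

lemma J_wp_less:
  assumes J: "class_J p S" and w: "w \<in> lists L"
  shows "wp w \<lless>= w"
  using w
proof (induction w)
  case (Cons a w)
  have a: "a \<in> L" and IH: "wp w \<lless>= w" using Cons by auto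
  have "sgpow S a p = a \<or> (sgpow S a p, a) \<in> sgless S"
  proof (cases "sgpow S a p = a")
    case False
    have "sgpow S (sgpow S a p) p = sgpow S a p"
      using J sgpow_sgpow[OF a, of p] p_ge_2 a by (simp add: class_J_def)
    then have "sgpow S a p \<in> sg1 p S" using sgpow_p_closed[OF a] by (simp add: sg1_def)
    moreover have "a \<in> sg2 p S" using a False by (simp add: sg2_def sg1_def)
    ultimately show ?thesis using J by (simp add: class_J_def)
  qed simp
  then show ?case using IH by (auto simp: word_pow_def)
qed (simp add: word_pow_def)

definition frob_defect :: "'a list \<Rightarrow> ('a list \<Rightarrow>\<^sub>0 'p mod_ring)" where
  "frob_defect w = word w - word (wp w)"

text \<open>The Frobenius map is additive, so it sends \<open>v - v ^ p\<close> to \<open>v ^ p - v ^ (p ^ 2) = 0\<close>.\<close>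

lemma J_decomposition:
  assumes J: "class_J p S"
  shows "M \<cong>\<^sub>a frob_quot p (TL1 p S) (TL1 p S) \<otimes>\<^sub>a
    nil_quot p (TL2_tilde p S :: ('a list \<Rightarrow>\<^sub>0 'p mod_ring) set)"
proof -
  let ?T1 = "TL1 p S" and ?T2 = "TL2 p S" and ?d = frob_defect
  let ?I = "Idl\<^bsub>poly_alg ?T1\<^esub> {pvar z ^ p - scale 1 (pvar z) | z. z \<in> ?T1}"
  let ?J = "Idl\<^bsub>poly_alg (?d ` ?T2)\<^esub> {pvar z ^ p - scale 0 (pvar z) | z. z \<in> ?d ` ?T2}"
  have T: "TL = ?T1 \<union> ?T2" "?T1 \<inter> ?T2 = {}" by (rule TL_parts)+
  have T1L: "v \<in> lists L" if "v \<in> ?T1" for v using TL_lists T(1) that by blast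
  have T2L: "v \<in> lists L" if "v \<in> ?T2" for v using TL_lists T(1) that by blast
  define x where "x v = (if v \<in> ?T1 then word v else ?d v)" for v
  have dlead: "has_lead (?d v) v 1" if "v \<in> ?T2" for v
  proof -
    have v: "v \<in> lists L" "wp v \<in> lists L" using T2L[OF that] wp_lists by blast+
    have ne: "wp v \<noteq> v" by (rule TL_parts(4)[OF that])
    then have "wp v \<lless> v" using J_wp_less[OF J v(1)] by blast
    then have "wp v \<sqsubset> v" by (simp add: wless_iff)
    moreover have "ks (?d v) \<subseteq> {v, wp v}"
      by (auto simp: frob_defect_def in_keys_iff lookup_minus lookup_single when_def split: if_splits)
    moreover have "lk (?d v) v = 1" using ne by (simp add: frob_defect_def lookup_minus lookup_single when_def)
    ultimately show ?thesis using v unfolding has_lead_def by (intro conjI ballI) blast+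
  qed
  have lead: "has_lead (x v) v 1" if "v \<in> TL" for v
    using that T dlead T1L has_lead_word unfolding x_def by (cases "v \<in> ?T1") simp_all
  have xM: "x v \<in> carrier M" if "v \<in> ?T1 \<union> ?T2" for v
    using lead[of v] that T(1) by (simp add: has_lead_def)
  have inj: "inj_on ?d ?T2"
  proof (rule inj_onI)
    fix v v' assume v: "v \<in> ?T2" "v' \<in> ?T2" "?d v = ?d v'"
    show "v = v'" using has_lead_unique[OF dlead[OF v(1)]] dlead[OF v(2)] v(3) by simp
  qed
  have tilde: "TL2_tilde p S = ?d ` ?T2"
    unfolding TL2_tilde_def frob_defect_def by blast
  have s: "split_variables ?T1 ?T2 ?d ?T1 ?T2"
    by unfold_locales (simp_all add: T(2) inj)
  interpret A: power_relations p ?T1 ?T1 "\<lambda>_. 1" "lists L" ms "[]" word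
    "?I"
  proof unfold_locales
    show "word z [^]\<^bsub>M\<^esub> p = scale 1 (word z)" if "z \<in> ?T1" for z
      using word_power_p[OF T1L[OF that]] TL_parts(3)[OF that] by simp
  qed (use p_ge_2 T1L in simp_all)
  interpret B: power_relations p "?d ` ?T2" "?d ` ?T2" "\<lambda>_. 0" "lists L" ms "[]" "\<lambda>y. y"
    "?J"
  proof unfold_locales
    fix y assume "y \<in> ?d ` ?T2"
    then obtain v where v: "v \<in> ?T2" "y = ?d v" by blast
    show "ks y \<subseteq> lists L" using dlead[OF v(1)] v(2) by (simp add: has_lead_def)
    have vL: "v \<in> lists L" "wp v \<in> lists L" using T2L[OF v(1)] wp_lists by blast+
    have "?d v [^]\<^bsub>M\<^esub> p = word v [^]\<^bsub>M\<^esub> p - word (wp v) [^]\<^bsub>M\<^esub> p"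
      using frobenius_diff[of "word v" "word (wp v)"] vL by (simp add: frob_defect_def p_card[symmetric])
    also have "\<dots> = 0"
      unfolding word_power_p[OF vL(1)] word_power_p[OF vL(2)] J_wp_idem[OF J vL(1)] by simp
    finally show "y [^]\<^bsub>M\<^esub> p = scale 0 y" by (simp add: v(2))
  qed (use p_ge_2 in simp_all)
  obtain f where f: "f \<in> alg_hom (quot_alg (poly_alg ?T1) ?I) M"
    "\<forall>m \<in> reduced p ?T1 ?T1. f (?I +>\<^bsub>poly_alg ?T1\<^esub> single m 1) = mon_eval M word m"
    using A.quot_mon_eval by (elim bexE) (rule that)
  obtain g where g: "g \<in> alg_hom (quot_alg (poly_alg (?d ` ?T2)) ?J) M"
    "\<forall>m \<in> reduced p (?d ` ?T2) (?d ` ?T2). g (?J +>\<^bsub>poly_alg (?d ` ?T2)\<^esub> single m 1) = mon_eval M (\<lambda>y. y) m"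
    using B.quot_mon_eval by (elim bexE) (rule that)
  note basis = lyndon_monomial_basis[of x, OF lead, unfolded T(1)]
  have "M \<cong>\<^sub>a quot_alg (poly_alg ?T1) ?I \<otimes>\<^sub>a
      quot_alg (poly_alg (?d ` ?T2)) ?J"
  proof (rule tensor_of_split[OF A.quot_kalg B.quot_kalg f(1) g(1) s A.reduced_coset_closed A.quot_lspan _
        B.reduced_coset_closed B.quot_lspan _ xM])
    show "word v = x v" if "v \<in> ?T1" for v using that by (simp add: x_def)
    show "?d v = x v" if "v \<in> ?T2" for v using that T(2) by (auto simp: x_def)
  qed (use f(2) g(2) basis in \<open>simp_all only:\<close>)
  then show ?thesis by (simp add: frob_quot_def nil_quot_def tilde)
qed

end

section \<open>Semigroups in the class P\<close>

context mixable begin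

context
  assumes P: "class_P p S"
begin

lemma P_mono: "a \<in> L \<Longrightarrow> b \<in> L \<Longrightarrow> (b, a) \<in> sgless S \<Longrightarrow> (sgpow S b p, sgpow S a p) \<in> sgless S"
  and P_increasing: "a \<in> L \<Longrightarrow> (a, sgpow S a p) \<in> sgle S"
  using P unfolding class_P_def by blast+

lemma wp_mono: "u \<in> lists L \<Longrightarrow> v \<in> lists L \<Longrightarrow> u \<lless> v \<Longrightarrow> wp u \<lless> wp v"
proof (induction u arbitrary: v)
  case Nil
  then show ?case by (cases v) (auto simp: word_pow_def)
next
  case (Cons a u)
  then show ?case using P_mono by (cases v) (auto simp: word_pow_def)
qed

lemma wp_mono_iff: "u \<in> lists L \<Longrightarrow> v \<in> lists L \<Longrightarrow> wp u \<lless> wp v \<longleftrightarrow> u \<lless> v"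
  using wp_mono[of u v] wp_mono[of v u] lt_total[of u v] lt_trans[of "wp u" "wp v" "wp u"]
    lt_irrefl[of "wp u"] by auto

lemma wp_inj: "u \<in> lists L \<Longrightarrow> v \<in> lists L \<Longrightarrow> wp u = wp v \<Longrightarrow> u = v"
  using wp_mono[of u v] wp_mono[of v u] lt_total[of u v] lt_irrefl[of "wp u"] by auto

lemma wp_funpow_inj:
  "u \<in> lists L \<Longrightarrow> v \<in> lists L \<Longrightarrow> (wp ^^ k) u = (wp ^^ k) v \<Longrightarrow> u = v"
proof (induction k)
  case (Suc k)
  have "(wp ^^ k) u \<in> lists L" "(wp ^^ k) v \<in> lists L"
    by (rule wp_funpow_lists[OF Suc.prems(1)], rule wp_funpow_lists[OF Suc.prems(2)])
  from wp_inj[OF this] have "(wp ^^ k) u = (wp ^^ k) v" using Suc.prems(3) by simp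
  then show ?case using Suc.IH Suc.prems by blast
qed simp

lemma wp_append: "wp (u @ v) = wp u @ wp v"
  by (simp add: word_pow_def)

text \<open>Lyndon words are defined by comparing words with their suffixes, and letterwise powers preserve
  and reflect these comparisons.\<close>

lemma wp_lyn: "u \<in> lists L \<Longrightarrow> wp u \<in> lyn \<longleftrightarrow> u \<in> lyn"
proof
  assume u: "u \<in> lists L" and l: "wp u \<in> lyn"
  have "u \<lless> y" if "u = x @ y" "x \<noteq> []" "y \<noteq> []" for x y
  proof -
    have "wp x @ wp y \<lless> wp y"
      using lynD(3)[of "wp x" "wp y"] l that by (simp add: wp_append word_pow_def)
    then have "wp u \<lless> wp y" by (simp add: that wp_append)
    moreover have "y \<in> lists L" using u that by simp
    ultimately show ?thesis using wp_mono_iff u by blast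
  qed
  moreover have "u \<noteq> []" using lynD(2)[OF l] by (auto simp: word_pow_def)
  ultimately show "u \<in> lyn" using u unfolding lyn_def by blast
next
  assume u: "u \<in> lists L" and l: "u \<in> lyn"
  have "wp u \<lless> y" if e: "wp u = x @ y" and ne: "x \<noteq> []" "y \<noteq> []" for x y
  proof -
    let ?x = "take (length x) u" and ?y = "drop (length x) u"
    have len: "length u = length x + length y" using arg_cong[OF e, of length] by simp
    have y: "wp ?y = y" using arg_cong[OF e, of "drop (length x)"] by (simp add: word_pow_def drop_map)
    have "?x @ ?y \<lless> ?y" by (rule lynD(3)) (use l ne len in auto)
    then have "u \<lless> ?y" by simp
    moreover have "?y \<in> lists L" using u by (auto dest: in_set_dropD)
    ultimately have "wp u \<lless> wp ?y" using wp_mono u by blast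
    then show ?thesis by (simp only: y)
  qed
  moreover have "wp u \<noteq> []" using lynD(2)[OF l] by (simp add: word_pow_def)
  ultimately show "wp u \<in> lyn" using wp_lists[OF u] unfolding lyn_def by blast
qed

lemma wp_increasing: "u \<in> lists L \<Longrightarrow> u \<lless>= wp u"
proof (induction u)
  case (Cons a u)
  then have "a = sgpow S a p \<or> (a, sgpow S a p) \<in> sgless S"
    using P_increasing[of a] by (auto simp: sgless_def)
  then show ?case using Cons by (auto simp: word_pow_def)
qed (simp add: word_pow_def)

text \<open>Taking \<open>p\<close>-th roots of letters as long as possible terminates because it makes words smaller
  without changing their length.\<close>

lemma lyn_root:
  "l \<in> lyn \<Longrightarrow> \<exists>e \<in> Ew p S lyn. \<exists>k. l = (wp ^^ k) e \<and> (k = 0 \<or> wp e \<noteq> e)"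
proof (induction l rule: wf_induct[OF wf_lenlex[OF wf_sgless]])
  case (1 l)
  show ?case
  proof (cases "l \<in> Ew p S lyn")
    case True
    then show ?thesis by (intro bexI[of _ l] exI[of _ 0]) simp_all
  next
    case False
    then obtain u where u: "u \<in> lists L" "l = wp u" and ne: "l \<noteq> wp l"
      using 1(2) unfolding Ew_def by blast
    have "u \<noteq> wp u" using ne u(2) by auto
    then have "u \<lless> l" using wp_increasing[OF u(1)] u(2) by blast
    then have "u \<sqsubset> l" by (simp add: wless_iff u(2))
    moreover have "u \<in> lyn" using wp_lyn[OF u(1)] u(2) 1(2) by blast
    ultimately obtain e k where e: "e \<in> Ew p S lyn" "u = (wp ^^ k) e" "k = 0 \<or> wp e \<noteq> e"
      using 1(1) by blast
    have "wp e \<noteq> e"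
    proof
      assume f: "wp e = e"
      then have "u = e" using e by auto
      then show False using f u(2) ne by simp
    qed
    then show ?thesis using e(1,2) u(2) by (intro bexI[of _ e] exI[of _ "Suc k"]) simp_all
  qed
qed

lemma TEL_parts: "TEL p S = TEL1 p S \<union> TEL2 p S" "e \<in> TEL1 p S \<Longrightarrow> wp e = e"
  "e \<in> TEL2 p S \<Longrightarrow> wp e \<noteq> e" "e \<in> TEL2 p S \<Longrightarrow> u \<in> lists L \<Longrightarrow> e \<noteq> wp u"
  "e \<in> TEL p S \<Longrightarrow> e \<in> TL" "e \<in> TEL p S \<Longrightarrow> e \<in> lists L" "TEL1 p S \<inter> TEL2 p S = {}"
proof -
  have pp: "0 < p ^ i" for i using p_ge_2 by simp
  show 1: "TEL p S = TEL1 p S \<union> TEL2 p S"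
    unfolding TEL_def TEL1_def TEL2_def Tw_def Ew_def part1_def part2_def by blast
  show 2: "wp e = e" if "e \<in> TEL1 p S" for e
    using that wp_word_rep_fixed[OF pp] by (auto simp: TEL1_def Tw_def Ew_def part1_def)
  show 3: "wp e \<noteq> e" if "e \<in> TEL2 p S" for e
    using that wp_word_rep_fixed[OF pp] by (auto simp: TEL2_def Tw_def Ew_def part2_def)
  show "TEL1 p S \<inter> TEL2 p S = {}" using 2 3 by blast
  show 4: "e \<in> TL" if "e \<in> TEL p S" for e
    using that by (auto simp: TEL_def Tw_def Ew_def Lyn_eq)
  show "e \<in> lists L" if "e \<in> TEL p S" for e by (rule TL_lists[OF 4[OF that]])
  show "e \<noteq> wp u" if e: "e \<in> TEL2 p S" and u: "u \<in> lists L" for e u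
  proof
    assume eq: "e = wp u"
    from e obtain l i where l: "e = word_rep l (p ^ i)" "wp l \<noteq> l"
      "\<forall>u \<in> lists L. l \<noteq> wp u"
      by (auto simp: TEL2_def Tw_def Ew_def part2_def)
    obtain j where "p ^ i = Suc j" using pp[of i] by (cases "p ^ i") auto
    then have "take (length l) e = l" by (simp add: l(1) word_rep_def)
    then have "l = wp (take (length l) u)" by (simp add: eq word_pow_def take_map)
    moreover have "take (length l) u \<in> lists L" using u by (auto dest: in_set_takeD)
    ultimately show False using l(3) by blast
  qed
qed

lemma TEL1_subset: "e \<in> TEL1 p S \<Longrightarrow> e \<in> TEL p S"
  and TEL2_subset: "e \<in> TEL2 p S \<Longrightarrow> e \<in> TEL p S"
  and TEL_not1: "e \<in> TEL p S \<Longrightarrow> e \<notin> TEL1 p S \<Longrightarrow> e \<in> TEL2 p S"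
  and TEL_not2: "e \<in> TEL p S \<Longrightarrow> e \<notin> TEL2 p S \<Longrightarrow> e \<in> TEL1 p S"
  by (simp_all add: TEL_parts(1))

lemma TL_root:
  assumes "v \<in> TL"
  shows "\<exists>e \<in> TEL p S. \<exists>k. v = (wp ^^ k) e \<and> (k = 0 \<or> e \<in> TEL2 p S)"
proof -
  from assms obtain l i where l: "l \<in> lyn" "v = word_rep l (p ^ i)" by (rule TL_cases)
  from lyn_root[OF l(1)] obtain e k where e: "e \<in> Ew p S lyn" "l = (wp ^^ k) e" "k = 0 \<or> wp e \<noteq> e"
    by blast
  have "(wp ^^ k) (word_rep e (p ^ i)) = word_rep ((wp ^^ k) e) (p ^ i)"
    by (induction k) (simp_all add: wp_word_rep)
  moreover have "word_rep e (p ^ i) \<in> TEL p S" using e(1) unfolding TEL_def Tw_def Lyn_eq by blast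
  moreover have "word_rep e (p ^ i) \<in> TEL2 p S" if "wp e \<noteq> e"
    using e(1) that unfolding TEL2_def Tw_def Ew_def part2_def Lyn_eq by blast
  ultimately show ?thesis using e l(2) by (intro bexI[of _ "word_rep e (p ^ i)"] exI[of _ k]) auto
qed

text \<open>Cancelling the common part of the two orbits leaves \<open>e = (wp ^^ j) e'\<close>; for \<open>j > 0\<close> the word \<open>e\<close>
  is a \<open>p\<close>-th power and hence fixed, which makes \<open>e'\<close> fixed as well, contrary to
  \<open>e' \<in> TEL2 p S\<close>.\<close>

lemma TL_root_unique_aux:
  assumes e: "e \<in> TEL p S" and e': "e' \<in> TEL p S" "k' = 0 \<or> e' \<in> TEL2 p S"
    and eq: "(wp ^^ k) e = (wp ^^ k') e'" and le: "k \<le> k'"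
  shows "e = e' \<and> k = k'"
proof -
  have L: "e \<in> lists L" "e' \<in> lists L" by (rule TEL_parts(6)[OF e], rule TEL_parts(6)[OF e'(1)])
  obtain j where j: "k' = k + j" using le le_Suc_ex by blast
  then have "(wp ^^ k) e = (wp ^^ k) ((wp ^^ j) e')" using eq by (simp add: funpow_add)
  then have ej: "e = (wp ^^ j) e'" by (rule wp_funpow_inj[OF L(1) wp_funpow_lists[OF L(2)]])
  show ?thesis
  proof (cases j)
    case (Suc i)
    then have t: "e' \<in> TEL2 p S" using e'(2) j by simp
    have "(wp ^^ j) e' = wp ((wp ^^ i) e')" by (simp only: Suc funpow.simps comp_apply)
    with ej have "e = wp ((wp ^^ i) e')" by (rule trans)
    then have "e \<notin> TEL2 p S" using TEL_parts(4)[OF _ wp_funpow_lists[OF L(2), of i], of e] by (rule contrapos_pn)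
    then have "wp e = e" using TEL_parts(2)[OF TEL_not2[OF e]] by simp
    then have "(wp ^^ j) (wp e') = (wp ^^ j) e'" unfolding ej funpow_swap1 .
    then have "wp e' = e'" by (rule wp_funpow_inj[OF wp_lists[OF L(2)] L(2)])
    then show ?thesis using TEL_parts(3)[OF t] by simp
  qed (use ej j in simp)
qed

lemma TL_root_unique:
  assumes "e \<in> TEL p S" "k = 0 \<or> e \<in> TEL2 p S" "e' \<in> TEL p S" "k' = 0 \<or> e' \<in> TEL2 p S"
    and "(wp ^^ k) e = (wp ^^ k') e'"
  shows "e = e' \<and> k = k'"
proof (cases "k \<le> k'")
  case True
  then show ?thesis by (rule TL_root_unique_aux[OF assms(1,3,4,5)])
next
  case False
  then show ?thesis using TL_root_unique_aux[OF assms(3,1,2) assms(5)[symmetric]] by simp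
qed

text \<open>The word \<open>v = (wp ^^ k) e\<close> is the \<open>p ^ k\<close>-th power of the root \<open>e\<close> of its orbit in the
  algebra, so it is expressed by the exponent \<open>p ^ k\<close> at \<open>e\<close>.\<close>

definition root_expo :: "'a list \<Rightarrow> ('a list \<Rightarrow>\<^sub>0 nat)" where
  "root_expo v = (SOME n. \<exists>e k. e \<in> TEL p S \<and> v = (wp ^^ k) e \<and> (k = 0 \<or> e \<in> TEL2 p S) \<and>
     n = single e (p ^ k))"

lemma root_expo: "v \<in> TL \<Longrightarrow> \<exists>e k. e \<in> TEL p S \<and> v = (wp ^^ k) e \<and> (k = 0 \<or> e \<in> TEL2 p S) \<and>
     root_expo v = single e (p ^ k)"
  unfolding root_expo_def by (rule someI_ex) (use TL_root[of v] in blast)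

lemma root_expo_eq:
  assumes "e \<in> TEL p S" "k = 0 \<or> e \<in> TEL2 p S" "(wp ^^ k) e \<in> TL"
  shows "root_expo ((wp ^^ k) e) = single e (p ^ k)"
proof -
  from root_expo[OF assms(3)] obtain e' k' where
    *: "e' \<in> TEL p S" "(wp ^^ k) e = (wp ^^ k') e'" "k' = 0 \<or> e' \<in> TEL2 p S"
    "root_expo ((wp ^^ k) e) = single e' (p ^ k')" by (elim exE conjE) (rule that)
  from TL_root_unique[OF assms(1,2) *(1,3,2)] show ?thesis using *(4) by simp
qed

lemma wp_funpow_TL: "v \<in> TL \<Longrightarrow> (wp ^^ k) v \<in> TL"
proof (induction k)
  case (Suc k)
  then have "(wp ^^ k) v \<in> TL" by blast
  then obtain l i where l: "l \<in> lyn" "(wp ^^ k) v = word_rep l (p ^ i)" by (rule TL_cases)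
  have "wp l \<in> lyn" using wp_lyn[OF lynD(1)[OF l(1)]] l(1) by blast
  then show ?case by (auto simp: l(2) wp_word_rep Tw_def)
qed simp

text \<open>Every Frobenius orbit in \<open>TL\<close> either is a fixed word or starts at a word of \<open>TEL2\<close> and
  moves on forever. Since \<open>p\<close>-th powers move along orbits, collecting the exponents of an orbit in
  base \<open>p\<close> turns reduced monomials in \<open>TL\<close> into monomials in \<open>TEL\<close> with the same value.\<close>

lemma root_expo_image:
  "total_expo root_expo ` reduced p TL TL = reduced p (TEL p S) (TEL1 p S)"
proof (intro equalityI subsetI)
  fix n assume "n \<in> total_expo root_expo ` reduced p TL TL"
  then obtain m where m: "m \<in> reduced p TL TL" "n = total_expo root_expo m" by blast
  have k: "ks m \<subseteq> TL" using m(1) by (simp add: reduced_def)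
  have "ks n \<subseteq> TEL p S"
    unfolding m(2)
  proof (rule order_trans[OF keys_total_expo], rule UN_least)
    fix v assume "v \<in> ks m"
    then have "v \<in> TL" using k by blast
    from root_expo[OF this] obtain e k where "e \<in> TEL p S" "root_expo v = single e (p ^ k)"
      by (elim exE conjE) (rule that)
    then show "ks (root_expo v) \<subseteq> TEL p S" by simp
  qed
  moreover have "lk n e < p" if e: "e \<in> TEL1 p S" for e
  proof -
    have eT: "e \<in> TEL p S" "e \<in> TL" using TEL1_subset[OF e] TEL_parts(5)[OF TEL1_subset[OF e]] by simp_all
    have "lk n e = (\<Sum>v\<in>ks m. if v = e then lk m v else 0)"
      unfolding m(2) lookup_total_expo
    proof (rule sum.cong[OF refl])
      fix v assume "v \<in> ks m"
      then have "v \<in> TL" using k by blast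
      from root_expo[OF this] obtain e' j where e': "e' \<in> TEL p S" "v = (wp ^^ j) e'"
        "j = 0 \<or> e' \<in> TEL2 p S" "root_expo v = single e' (p ^ j)" by (elim exE conjE) (rule that)
      show "lk m v * lk (root_expo v) e = (if v = e then lk m v else 0)"
      proof (cases "e' = e")
        case True
        then have "j = 0" using e'(3) e TEL_parts(7) by blast
        then show ?thesis using e' True by simp
      next
        case False
        have "v \<noteq> e"
        proof
          assume "v = e"
          then have "(wp ^^ 0) e = (wp ^^ j) e'" using e'(2) by simp
          from TL_root_unique[OF eT(1) _ e'(1,3) this] show False using False by simp
        qed
        then show ?thesis using e'(4) False by (simp add: lookup_single when_def)
      qed
    qed
    also have "\<dots> = lk m e" by (simp add: in_keys_iff)
    finally show ?thesis using m(1) eT(2) by (simp add: reduced_def)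
  qed
  ultimately show "n \<in> reduced p (TEL p S) (TEL1 p S)" by (simp add: reduced_def)
next
  fix n assume n: "n \<in> reduced p (TEL p S) (TEL1 p S)"
  have "\<exists>m \<in> reduced p TL TL. total_expo root_expo m = n"
  proof (rule total_expo_surj[OF p_ge_2])
    fix e k assume e: "e \<in> ks n" and k: "p ^ k \<le> lk n e"
    have eT: "e \<in> TEL p S" using e n by (auto simp: reduced_def)
    have "k = 0 \<or> e \<in> TEL2 p S"
    proof (cases "e \<in> TEL1 p S")
      case True
      then have "lk n e < p" using n by (simp add: reduced_def)
      then have "p ^ k < p ^ 1" using k by simp
      then show ?thesis using p_ge_2 power_less_imp_less_exp[of p k 1] by simp
    next
      case False
      then show ?thesis using TEL_not1[OF eT] by simp
    qed
    moreover have "(wp ^^ k) e \<in> TL" by (rule wp_funpow_TL[OF TEL_parts(5)[OF eT]])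
    ultimately show "\<exists>v\<in>TL. root_expo v = single e (p ^ k)"
      using root_expo_eq[OF eT] by (intro bexI[of _ "(wp ^^ k) e"])
  qed
  then obtain m where "m \<in> reduced p TL TL" "total_expo root_expo m = n" by (elim bexE) (rule that)
  then show "n \<in> total_expo root_expo ` reduced p TL TL" by (intro image_eqI[of _ _ m]) simp_all
qed

lemma word_carrier: "v \<in> TL \<Longrightarrow> word v \<in> carrier M"
  using TL_lists by simp

lemma root_expo_value:
  assumes "m \<in> reduced p TL TL"
  shows "mon_eval M word (total_expo root_expo m) = mon_eval M word m"
proof (rule M.mon_eval_total_expo[where V = TL and U = "TEL p S"])
  fix v assume v: "v \<in> TL"
  from root_expo[OF v] obtain e k where e: "e \<in> TEL p S" "v = (wp ^^ k) e"
    "root_expo v = single e (p ^ k)" by (elim exE conjE) (rule that)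
  show "ks (root_expo v) \<subseteq> TEL p S" unfolding e(3) using e(1) by simp
  have "mon_eval M word (root_expo v) = word e [^]\<^bsub>M\<^esub> (p ^ k)"
    unfolding e(3) by (rule M.mon_eval_single[of word]) (rule word_carrier[OF TEL_parts(5)[OF e(1)]])
  also have "\<dots> = word v" unfolding word_power_p_iter[OF TEL_parts(6)[OF e(1)]] e(2) ..
  finally show "mon_eval M word (root_expo v) = word v" .
next
  show "ks m \<subseteq> TL" using assms by (simp add: reduced_def)
qed (rule word_carrier, assumption, rule word_carrier, erule TEL_parts(5))

lemma TEL_basis:
  "ks t \<subseteq> reduced p (TEL p S) (TEL1 p S) \<Longrightarrow> lin (mon_eval M word) t = 0 \<Longrightarrow> t = 0"
  "ks z \<subseteq> lists L \<Longrightarrow> \<exists>t. ks t \<subseteq> reduced p (TEL p S) (TEL1 p S) \<and> lin (mon_eval M word) t = z"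
proof -
  have lead: "has_lead (word v) v 1" if "v \<in> TL" for v by (rule has_lead_word[OF TL_lists[OF that]])
  have indep: "t = 0" if "ks t \<subseteq> reduced p TL TL" "lin (mon_eval M word) t = 0" for t
    by (rule lyndon_monomial_basis(1)[of word, OF lead that])
  have span: "\<exists>t. ks t \<subseteq> reduced p TL TL \<and> lin (mon_eval M word) t = z" if "ks z \<subseteq> lists L"
    by (rule lyndon_monomial_basis(2)[of word, OF lead that])
  show "t = 0" if "ks t \<subseteq> reduced p (TEL p S) (TEL1 p S)" "lin (mon_eval M word) t = 0"
    by (rule basis_transfer(1)[OF root_expo_image, where b = "mon_eval M word" and b' = "mon_eval M word"])
      (erule root_expo_value, erule (1) indep, rule that(1), rule that(2))
  show "\<exists>t. ks t \<subseteq> reduced p (TEL p S) (TEL1 p S) \<and> lin (mon_eval M word) t = z" if "ks z \<subseteq> lists L"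
    by (rule basis_transfer(2)[OF root_expo_image, where b = "mon_eval M word" and b' = "mon_eval M word"])
      (erule root_expo_value, rule span[OF that])
qed

lemma P_relations:
  assumes "Y \<subseteq> TEL p S" "TEL1 p S \<subseteq> Y"
  shows "power_relations p Y (TEL1 p S) (\<lambda>_. 1) (lists L) ms [] (word :: _ \<Rightarrow> 'a list \<Rightarrow>\<^sub>0 'p mod_ring)"
proof (rule power_relations.intro)
  fix v assume "v \<in> Y"
  then show "ks (word v) \<subseteq> lists L" using TEL_parts(6)[OF subsetD[OF assms(1)]] by simp
next
  fix z assume z: "z \<in> TEL1 p S"
  then have "z \<in> lists L" by (intro TEL_parts(6) TEL1_subset)
  then show "word z [^]\<^bsub>M\<^esub> p = scale 1 (word z)" using word_power_p TEL_parts(2)[OF z] by simp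
qed (use p_ge_2 assms MS_kalg in simp_all)

lemma P_presentation: "M \<cong>\<^sub>a frob_quot p (TEL p S) (TEL1 p S)"
proof -
  interpret A: power_relations p "TEL p S" "TEL1 p S" "\<lambda>_. 1" "lists L" ms "[]" word
    "Idl\<^bsub>poly_alg (TEL p S)\<^esub> {pvar z ^ p - scale 1 (pvar z) | z. z \<in> TEL1 p S}"
    by (rule P_relations) (simp_all add: TEL_parts(1))
  have iso: "quot_alg (poly_alg (TEL p S)) (Idl\<^bsub>poly_alg (TEL p S)\<^esub> {pvar z ^ p - scale 1 (pvar z) | z. z \<in> TEL1 p S})
      \<cong>\<^sub>a M"
    by (rule A.quot_iso_of_basis[OF TEL_basis])
  show ?thesis using alg_iso_sym[OF A.quot_kalg iso] unfolding frob_quot_def scale_one .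
qed

lemma P_decomposition: "M \<cong>\<^sub>a frob_quot p (TEL1 p S) (TEL1 p S) \<otimes>\<^sub>a poly_alg (TEL2 p S)"
proof -
  let ?T1 = "TEL1 p S" and ?T2 = "TEL2 p S"
  let ?I = "Idl\<^bsub>poly_alg ?T1\<^esub> {pvar z ^ p - scale 1 (pvar z) | z. z \<in> ?T1}"
  interpret A: power_relations p ?T1 ?T1 "\<lambda>_. 1" "lists L" ms "[]" word ?I
    by (rule P_relations) (simp_all add: TEL_parts(1))
  have T2: "v \<in> lists L" if "v \<in> ?T2" for v by (rule TEL_parts(6)[OF TEL2_subset[OF that]])
  have s: "split_variables ?T1 ?T2 (\<lambda>v. v) ?T1 {}"
    by unfold_locales (simp_all add: TEL_parts(7))
  obtain f where f: "f \<in> alg_hom (quot_alg (poly_alg ?T1) ?I) M"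
    "\<forall>m \<in> reduced p ?T1 ?T1. f (?I +>\<^bsub>poly_alg ?T1\<^esub> single m 1) = mon_eval M word m"
    using A.quot_mon_eval by (elim bexE) (rule that)
  have g: "lin (mon_eval M word) \<in> alg_hom (poly_alg ?T2) M"
    by (rule lin_mon_eval_hom[OF MS_kalg]) (use T2 in simp)
  \<comment> \<open>In the second factor no variable is subject to a relation, so all monomials are reduced.\<close>
  have red: "reduced p ((\<lambda>v. v) ` ?T2) ((\<lambda>v. v) ` {}) = {m. ks m \<subseteq> ?T2}"
    by (simp add: reduced_def)
  have "M \<cong>\<^sub>a quot_alg (poly_alg ?T1) ?I \<otimes>\<^sub>a poly_alg ?T2"
  proof (rule tensor_of_split[OF A.quot_kalg poly_alg_kalg f(1) g s A.reduced_coset_closed A.quot_lspan,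
        where iB = "\<lambda>m. single m 1" and x = word and xA = word and xB = word])
    show "carrier (poly_alg ?T2) \<subseteq> lspan (poly_alg ?T2)
      ((\<lambda>m. single m 1) ` reduced p ((\<lambda>v. v) ` ?T2) ((\<lambda>v. v) ` {}))"
      unfolding red by (rule lspan_poly_alg)
    show "word v \<in> carrier M" if "v \<in> ?T1 \<union> ?T2" for v
      by (rule word_carrier[OF TEL_parts(5)]) (use that in \<open>simp add: TEL_parts(1)\<close>)
    show "single m 1 \<in> carrier (poly_alg ?T2)"
      if "m \<in> reduced p ((\<lambda>v. v) ` ?T2) ((\<lambda>v. v) ` {})" for m using that unfolding red by simp
    show "t = 0" if "ks t \<subseteq> reduced p (?T1 \<union> ?T2) (?T1 \<union> {})" "lin (mon_eval M word) t = 0" for t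
      using that TEL_basis(1)[of t] by (simp add: TEL_parts(1))
    show "\<exists>t. ks t \<subseteq> reduced p (?T1 \<union> ?T2) (?T1 \<union> {}) \<and> lin (mon_eval M word) t = z"
      if "ks z \<subseteq> lists L" for z
      using TEL_basis(2)[OF that] by (simp add: TEL_parts(1))
  qed (use f(2) in simp_all)
  then show ?thesis by (simp add: frob_quot_def)
qed

lemma P_free:
  assumes "TEL1 p S = {}" shows "M \<cong>\<^sub>a poly_alg (TEL p S)"
proof -
  have red: "reduced p (TEL p S) (TEL1 p S) = {m. ks m \<subseteq> TEL p S}"
    by (simp add: reduced_def assms)
  have h: "lin (mon_eval M word) \<in> alg_hom (poly_alg (TEL p S)) M"
    by (rule lin_mon_eval_hom[OF MS_kalg]) (use TEL_parts(6) in simp)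
  have "bij_betw (lin (mon_eval M word)) (carrier (poly_alg (TEL p S))) (carrier M)"
  proof (rule bij_betw_imageI)
    show "inj_on (lin (mon_eval M word)) (carrier (poly_alg (TEL p S)))"
    proof (rule inj_onI)
      fix t u assume t: "t \<in> carrier (poly_alg (TEL p S))" and u: "u \<in> carrier (poly_alg (TEL p S))"
        and e: "lin (mon_eval M word) t = lin (mon_eval M word) u"
      have "ks (t + - u) \<subseteq> {m. ks m \<subseteq> TEL p S}" using t u by (intro keys_subset_add) simp_all
      then have "t - u = 0" using TEL_basis(1)[of "t - u"] e unfolding red by (simp add: lin_diff)
      then show "t = u" by simp
    qed
    show "lin (mon_eval M word) ` carrier (poly_alg (TEL p S)) = carrier M"
    proof (intro equalityI subsetI)
      fix z assume "z \<in> lin (mon_eval M word) ` carrier (poly_alg (TEL p S))"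
      then show "z \<in> carrier M" using alg_homD(3)[OF h] by blast
    next
      fix z assume "z \<in> carrier M"
      then obtain t where "ks t \<subseteq> {m. ks m \<subseteq> TEL p S}" "lin (mon_eval M word) t = z"
        using TEL_basis(2)[of z] unfolding red by auto
      then show "z \<in> lin (mon_eval M word) ` carrier (poly_alg (TEL p S))"
        by (intro image_eqI[of _ _ t]) simp_all
    qed
  qed
  from alg_iso_sym[OF poly_alg_kalg alg_isoI[OF h this]] show ?thesis .
qed

end

end

section \<open>Free abelian semigroups\<close>

context
  fixes G :: "'x set" and r :: "'x rel"
  assumes fin: "finite G" and lin_r: "linear_order_on G r"
begin

lemma generators_trans: "(x, y) \<in> r - Id \<Longrightarrow> (y, z) \<in> r - Id \<Longrightarrow> (x, z) \<in> r - Id"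
proof -
  have "trans r" "antisym r" using lin_r by (simp_all add: order_on_defs)
  then show "(x, y) \<in> r - Id \<Longrightarrow> (y, z) \<in> r - Id \<Longrightarrow> (x, z) \<in> r - Id"
    by (auto dest: transD antisymD)
qed

lemma generators_total: "x \<in> G \<Longrightarrow> y \<in> G \<Longrightarrow> x = y \<or> (x, y) \<in> r - Id \<or> (y, x) \<in> r - Id"
  using lin_r by (auto simp: order_on_defs total_on_def)

lemma largest_generator:
  assumes "x \<in> Q" "Q \<subseteq> G"
  obtains z where "z \<in> Q" "\<And>y. (z, y) \<in> r - Id \<Longrightarrow> y \<notin> Q"
proof -
  have "trans (r - Id)" using generators_trans by (rule transI)
  then have "acyclic (r - Id)" by (simp add: acyclic_def)
  moreover have "finite (r - Id)"
  proof (rule finite_subset)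
    show "r - Id \<subseteq> G \<times> G" using lin_r by (auto simp: order_on_defs refl_on_def)
  qed (simp add: fin)
  ultimately have "wf ((r - Id)\<inverse>)" by (intro finite_acyclic_wf_converse)
  then have "\<exists>z\<in>Q. \<forall>y. (y, z) \<in> (r - Id)\<inverse> \<longrightarrow> y \<notin> Q"
    using assms(1) by (simp only: wf_eq_minimal)
  then obtain z where "z \<in> Q" "\<forall>y. (y, z) \<in> (r - Id)\<inverse> \<longrightarrow> y \<notin> Q"
    by (elim bexE) (rule that)
  then show ?thesis by (intro that[of z]) simp_all
qed

abbreviation "dless \<equiv> deglex_less G r"

lemma deglex_irrefl: "\<not> dless M M"
  by (simp add: deglex_less_def)

lemma deglex_trans:
  assumes "dless M N" "dless N K" shows "dless M K"
proof (cases "size M < size N \<or> size N < size K")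
  case True
  then show ?thesis using assms by (auto simp: deglex_less_def)
next
  case False
  then have s: "size M = size N" "size N = size K" using assms by (auto simp: deglex_less_def)
  from assms(1) s obtain x where x: "x \<in> G" "count M x < count N x"
    "\<forall>y \<in> G. (x, y) \<in> r - Id \<longrightarrow> count M y = count N y" unfolding deglex_less_def by auto
  from assms(2) s obtain y where y: "y \<in> G" "count N y < count K y"
    "\<forall>z \<in> G. (y, z) \<in> r - Id \<longrightarrow> count N z = count K z" unfolding deglex_less_def by auto
  have "\<exists>z \<in> G. count M z < count K z \<and> (\<forall>w \<in> G. (z, w) \<in> r - Id \<longrightarrow> count M w = count K w)"
    using generators_total[OF x(1) y(1)]
  proof (elim disjE)
    assume "x = y"
    then show ?thesis using x y by (intro bexI[of _ x]) simp_all
  next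
    assume xy: "(x, y) \<in> r - Id"
    then have "count M y = count N y" using x y by blast
    moreover have "count M w = count K w" if w: "w \<in> G" "(y, w) \<in> r - Id" for w
      using x(3) y(3) w generators_trans[OF xy w(2)] by simp
    ultimately show ?thesis using y by (intro bexI[of _ y]) simp_all
  next
    assume yx: "(y, x) \<in> r - Id"
    then have "count N x = count K x" using x y by blast
    moreover have "count M w = count K w" if w: "w \<in> G" "(x, w) \<in> r - Id" for w
      using x(3) y(3) w generators_trans[OF yx w(2)] by simp
    ultimately show ?thesis using x by (intro bexI[of _ x]) simp_all
  qed
  then show ?thesis using s by (simp add: deglex_less_def)
qed

lemma deglex_total:
  assumes "set_mset M \<subseteq> G" "set_mset N \<subseteq> G" "M \<noteq> N"
  shows "dless M N \<or> dless N M"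
proof (cases "size M = size N")
  case True
  let ?Q = "{x \<in> G. count M x \<noteq> count N x}"
  obtain x where x: "count M x \<noteq> count N x" using assms(3) by (auto simp: multiset_eq_iff)
  then have "x \<in># M \<or> x \<in># N" by (rule contrapos_np) (simp add: not_in_iff)
  then have "x \<in> ?Q" using x assms by auto
  then obtain z where z: "z \<in> ?Q" "\<And>y. (z, y) \<in> r - Id \<Longrightarrow> y \<notin> ?Q" by (rule largest_generator) auto
  then have "\<forall>y \<in> G. (z, y) \<in> r - Id \<longrightarrow> count M y = count N y"
    "\<forall>y \<in> G. (z, y) \<in> r - Id \<longrightarrow> count N y = count M y" by auto
  then have "dless M N" if "count M z < count N z" "z \<in> G"
    using that True unfolding deglex_less_def by (intro disjI2 conjI bexI[of _ z]) simp_all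
  moreover have "dless N M" if "count N z < count M z" "z \<in> G"
    using that True \<open>\<forall>y \<in> G. (z, y) \<in> r - Id \<longrightarrow> count N y = count M y\<close>
    unfolding deglex_less_def by (intro disjI2 conjI bexI[of _ z]) simp_all
  ultimately show ?thesis using z(1) by (simp add: nat_neq_iff) blast
qed (auto simp: deglex_less_def)

text \<open>There are finitely many multisets on \<open>G\<close> of bounded size, which makes the degree-lexicographic
  order a well-order.\<close>

lemma finite_deglex_below: "finite {M. set_mset M \<subseteq> G \<and> dless M N}"
proof (rule finite_subset)
  show "{M. set_mset M \<subseteq> G \<and> dless M N} \<subseteq> mset ` {xs. set xs \<subseteq> G \<and> length xs \<le> size N}"
  proof
    fix M assume M: "M \<in> {M. set_mset M \<subseteq> G \<and> dless M N}"
    obtain xs where xs: "mset xs = M" using ex_mset by blast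
    have "set xs \<subseteq> G" "length xs \<le> size N" using M xs[symmetric] by (auto simp: deglex_less_def)
    then show "M \<in> mset ` {xs. set xs \<subseteq> G \<and> length xs \<le> size N}" using xs by blast
  qed
qed (simp add: fin finite_lists_length_le)

abbreviation "fsg \<equiv> free_ab_semigroup G r"

lemma free_carrier [simp]: "M \<in> carrier fsg \<longleftrightarrow> M \<noteq> {#} \<and> set_mset M \<subseteq> G"
  by (simp add: free_ab_semigroup_def Let_def)

lemma free_sgle: "(M, N) \<in> sgle fsg \<longleftrightarrow> M \<in> carrier fsg \<and> N \<in> carrier fsg \<and> (M = N \<or> dless M N)"
  by (simp add: free_ab_semigroup_def Let_def)

lemma free_sgless: "(M, N) \<in> sgless fsg \<longleftrightarrow> M \<in> carrier fsg \<and> N \<in> carrier fsg \<and> dless M N"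
  using deglex_irrefl by (auto simp: sgless_def free_sgle)

lemma free_pow_count: "0 < n \<Longrightarrow> count (sgpow fsg M n) x = n * count M x"
proof -
  have "count ((sgmult fsg M ^^ k) M) x = (k + 1) * count M x" for k
    by (induction k) (simp_all add: free_ab_semigroup_def Let_def)
  then show "0 < n \<Longrightarrow> count (sgpow fsg M n) x = n * count M x" by (cases n) (simp_all add: sgpow_def)
qed

lemma free_pow_size: "0 < n \<Longrightarrow> size (sgpow fsg M n) = n * size M"
proof -
  have "size ((sgmult fsg M ^^ k) M) = (k + 1) * size M" for k
    by (induction k) (simp_all add: free_ab_semigroup_def Let_def)
  then show "0 < n \<Longrightarrow> size (sgpow fsg M n) = n * size M" by (cases n) (simp_all add: sgpow_def)
qed

lemma free_pow_closed:
  assumes "0 < n" "M \<in> carrier fsg" shows "sgpow fsg M n \<in> carrier fsg"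
proof -
  have "set_mset (sgpow fsg M n) = set_mset M"
    by (rule Set.set_eqI) (use assms(1) in \<open>simp add: free_pow_count flip: count_greater_zero_iff\<close>)
  moreover have "sgpow fsg M n \<noteq> {#}"
    using free_pow_size[OF assms(1), of M] assms by auto
  ultimately show ?thesis using assms(2) by simp
qed

lemma free_abelian: "abelian_semigroup fsg"
  by (auto simp: abelian_semigroup_def free_ab_semigroup_def Let_def ac_simps)

lemma free_well_order: "well_order_on (carrier fsg) (sgle fsg)"
proof -
  have "trans (sgle fsg)"
    by (rule transI) (auto simp: free_sgle intro: deglex_trans)
  moreover have "antisym (sgle fsg)"
    by (rule antisymI) (auto simp: free_sgle dest: deglex_trans simp: deglex_irrefl)
  moreover have "refl_on (carrier fsg) (sgle fsg)" "sgle fsg \<subseteq> carrier fsg \<times> carrier fsg"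
    by (auto simp: refl_on_def free_sgle)
  moreover have "total_on (carrier fsg) (sgle fsg)"
    using deglex_total by (auto simp: total_on_def free_sgle)
  moreover have "wf (sgle fsg - Id)"
  proof (rule wf_subset[OF wf_measure])
    show "sgle fsg - Id \<subseteq> measure (\<lambda>N. card {M. set_mset M \<subseteq> G \<and> dless M N})"
    proof (rule subrelI)
      fix M N assume "(M, N) \<in> sgle fsg - Id"
      then have MN: "dless M N" "set_mset M \<subseteq> G" by (auto simp: free_sgle)
      have "{K. set_mset K \<subseteq> G \<and> dless K M} \<subset> {K. set_mset K \<subseteq> G \<and> dless K N}"
        using MN deglex_irrefl[of M] deglex_trans[of _ M N] by blast
      then show "(M, N) \<in> measure (\<lambda>N. card {M. set_mset M \<subseteq> G \<and> dless M N})"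
        using psubset_card_mono[OF finite_deglex_below] by simp
    qed
  qed
  ultimately show ?thesis by (simp add: well_order_on_def order_on_defs)
qed

lemma free_class_P:
  assumes n: "2 \<le> n" shows "class_P n fsg"
proof -
  have n0: "0 < n" using n by simp
  have pow: "dless (sgpow fsg M n) (sgpow fsg N n)" if "dless M N" for M N
    using that n0 unfolding deglex_less_def by (simp add: free_pow_count free_pow_size)
  have inc: "dless M (sgpow fsg M n)" if M: "M \<in> carrier fsg" for M
  proof -
    have "0 < size M" using M by (simp flip: nonempty_has_size)
    then have "1 * size M < n * size M" using n by (intro mult_strict_right_mono) simp_all
    then show ?thesis by (simp add: deglex_less_def free_pow_size[OF n0])
  qed
  show ?thesis
    unfolding class_P_def well_ordered_abelian_semigroup_def
  proof (intro conjI ballI impI)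
    show "(sgpow fsg N n, sgpow fsg M n) \<in> sgless fsg" if "(N, M) \<in> sgless fsg" for M N
      using that free_pow_closed[OF n0] pow by (simp add: free_sgless del: free_carrier)
    show "(M, sgpow fsg M n) \<in> sgle fsg" if "M \<in> carrier fsg" for M
      using that free_pow_closed[OF n0] inc by (simp add: free_sgle del: free_carrier)
  qed (rule free_abelian, rule free_well_order)
qed

text \<open>Powers multiply the size of a multiset by \<open>n\<close>, so no letter is fixed.\<close>

lemma free_TEL1:
  assumes n: "2 \<le> n" shows "TEL1 n fsg = {}"
proof -
  have "word_pow n fsg l \<noteq> l" if l: "l \<in> Lyn fsg" for l
  proof
    assume e: "word_pow n fsg l = l"
    obtain M l' where M: "l = M # l'" "M \<in> carrier fsg" using l by (cases l) (auto simp: Lyn_def)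
    have "sgpow fsg M n = M" using e M by (simp add: word_pow_def)
    then have "n * size M = size M" using free_pow_size[of n M] n by simp
    then show False using n M(2) by simp
  qed
  then show ?thesis by (auto simp: TEL1_def Tw_def Ew_def part1_def)
qed

end

section \<open>The structure of the mixable shuffle algebras\<close>

lemma mixableI:
  fixes lam :: "'p::prime_card mod_ring"
  assumes "well_ordered_abelian_semigroup S" "lam \<noteq> 0" "p = CARD('p)"
  shows "mixable lam S p"
  using assms unfolding well_ordered_abelian_semigroup_def by unfold_locales simp_all

theorem theorem3p17:
  fixes p :: nat
    and lam :: "'p::prime_card mod_ring"
    and S :: "'a ord_semigroup"
    and G :: "'x set" and r :: "'x rel"
  assumes p: "p = CARD('p)"
    and lam: "lam \<noteq> 0"
  shows
    "(class_P p S \<longrightarrow>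
        MS lam S \<cong>\<^sub>a (frob_quot p (TEL p S) (TEL1 p S) :: ('p mod_ring, _) module) \<and>
        (frob_quot p (TEL p S) (TEL1 p S) :: ('p mod_ring, _) module)
          \<cong>\<^sub>a frob_quot p (TEL1 p S) (TEL1 p S) \<otimes>\<^sub>a poly_alg (TEL2 p S)) \<and>
     (finite G \<and> linear_order_on G r \<longrightarrow>
        MS lam (free_ab_semigroup G r) \<cong>\<^sub>a poly_alg (TEL p (free_ab_semigroup G r))) \<and>
     (class_J p S \<longrightarrow>
        MS lam S \<cong>\<^sub>a
          frob_quot p (TL1 p S) (TL1 p S) \<otimes>\<^sub>a
          nil_quot p (TL2_tilde p S :: ('a list \<Rightarrow>\<^sub>0 'p mod_ring) set))"
proof (intro conjI impI)
  assume P: "class_P p S"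
  then have "well_ordered_abelian_semigroup S" by (simp add: class_P_def)
  then interpret mixable lam S p by (rule mixableI[OF _ lam p])
  show pres: "MS lam S \<cong>\<^sub>a (frob_quot p (TEL p S) (TEL1 p S) :: ('p mod_ring, _) module)"
    unfolding MS_eq by (rule P_presentation[OF P])
  show "(frob_quot p (TEL p S) (TEL1 p S) :: ('p mod_ring, _) module)
      \<cong>\<^sub>a frob_quot p (TEL1 p S) (TEL1 p S) \<otimes>\<^sub>a poly_alg (TEL2 p S)"
    by (rule alg_iso_trans[OF alg_iso_sym[OF MS_kalg P_presentation[OF P]] P_decomposition[OF P]])
next
  assume G: "finite G \<and> linear_order_on G r"
  have p2: "2 \<le> p" using prime_ge_2_nat[OF prime_card[where ?'a = 'p]] by (simp add: p)
  have P: "class_P p (free_ab_semigroup G r)" using G p2 by (intro free_class_P) simp_all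
  then have "well_ordered_abelian_semigroup (free_ab_semigroup G r)" by (simp add: class_P_def)
  then interpret mixable lam "free_ab_semigroup G r" p by (rule mixableI[OF _ lam p])
  show "MS lam (free_ab_semigroup G r) \<cong>\<^sub>a poly_alg (TEL p (free_ab_semigroup G r))"
    unfolding MS_eq by (rule P_free[OF P free_TEL1]) (use G p2 in simp_all)
next
  assume J: "class_J p S"
  then have "well_ordered_abelian_semigroup S" by (simp add: class_J_def)
  then interpret mixable lam S p by (rule mixableI[OF _ lam p])
  show "MS lam S \<cong>\<^sub>a frob_quot p (TL1 p S) (TL1 p S) \<otimes>\<^sub>a
      nil_quot p (TL2_tilde p S :: ('a list \<Rightarrow>\<^sub>0 'p mod_ring) set)"
    unfolding MS_eq by (rule J_decomposition[OF J])
qed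

end
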